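(* Let $K$ be an (oriented) virtual link diagram. Then the virtual crossing number $v(K)$ of $K$ is greater than or equal to the maximum k-degree of $\langle K\rangle_A$.
   Context: A virtual link diagram is a generic collection of closed curves in the plane whose double points are either classical crossings (with over/under information) or virtual crossings (without). The classical Reidemeister moves I, II, III are the usual ones, involving only classical crossings. The virtual Reidemeister moves I, II, III are the analogous moves with all crossings virtual, and the virtual Reidemeister move IV moves a strand with two consecutive virtual crossings past a classical crossing. Two diagrams are virtually equivalent if they are related by a sequence of classical and virtual Reidemeister moves; a virtual link is an equivalence class of diagrams. The virtual crossing number $v(K)$ is the minimum number of virtual crossings in any diagram virtually equivalent to $K$. Diagrams are oriented. States. A state $S$ of $K$ is obtained by choosing, at every classical crossing, one of two planar smoothings: the oriented smoothing, which joins each incoming end to an outgoing end without crossing, or the disoriented smoothing, which joins the two incoming ends by one arc and the two outgoing ends by another disjoint arc. In a disoriented smoothing each of the two arcs carries one vertex, called a cusp, which points, transversally to its arc, toward the other arc of the same smoothing. At a positive crossing the oriented smoothing has coefficient $A$ and the disoriented one $A^{-1}$; at a negative crossing the oriented smoothing has coefficient $A^{-1}$ and the disoriented one $A$. The state is a collection of $|S|$ closed curves (loops) decorated with cusps, possibly with virtual crossings. Reduction. Traverse a loop $C$; each cusp points to the left or right of the direction of traversal. Two (cyclically) adjacent cusps pointing to the same side cancel; adjacent cusps pointing to opposite sides do not. Let $m$ be the number of cusps left after all cancellations ($m$ is even) and $a(C)=m/2$. Put $\langle C\rangle=1$ if $a(C)=0$ and $\langle C\rangle=K_{a(C)}$ if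 $a(C)>0$, where $K_1,K_2,\dots$ are independent commuting variables. Put $\langle S\rangle=\prod_{C}\langle C\rangle$ over the loops $C$ of $S$. Arrow polynomial. With $d=-A^2-A^{-2}$, and $\alpha$, $\beta$ the numbers of smoothings in $S$ with coefficients $A$, $A^{-1}$ respectively, $$\langle K\rangle_A=\sum_S A^{\alpha-\beta}d^{|S|-1}\langle S\rangle\in\mathbb{Z}[A,A^{-1},K_1,K_2,\dots],$$ the sum being over all states of $K$. The summands of $\langle K\rangle_A$ are the monomials occurring in it with non-zero coefficient. The k-degree of a summand $A^m K_{i_1}^{j_1}K_{i_2}^{j_2}\cdots K_{i_v}^{j_v}$ (up to its integer coefficient) is $i_1j_1+i_2j_2+\cdots+i_vj_v$, and it is $0$ if no variable $K_i$ occurs. The maximum k-degree of $\langle K\rangle_A$ is the largest k-degree of its summands. *)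

theory Defs
  imports
    "HOL-Library.Poly_Mapping"
    "HOL-Library.Product_Plus"
    "HOL-Combinatorics.Orbits"
begin

section \<open>Virtual link diagrams\<close>

text \<open>
  A plane diagram in general position with respect to the height function is cut by horizontal
  lines into layers, each of which contains a single event: a local minimum (\<open>Cup\<close>), a local
  maximum (\<open>Cap\<close>), or a double point (\<open>Cross\<close>); all other strands of the layer run vertically.
  A diagram is the list of its layers, read from the bottom to the top.  The direction in which
  an oriented strand passes a horizontal line is recorded as \<open>Up\<close> or \<open>Down\<close>.
\<close>

datatype direction = Up | Down

fun opp :: "direction \<Rightarrow> direction" where
  "opp Up = Down"
| "opp Down = Up"

text \<open>\<open>Over\<close> and \<open>Under\<close> tell how the strand joining the lower left to the upper right end
  of the crossing passes the other one.\<close>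

datatype crossing_kind = Over | Under | Virtual

fun flip :: "crossing_kind \<Rightarrow> crossing_kind" where
  "flip Over = Under"
| "flip Under = Over"
| "flip Virtual = Virtual"

text \<open>In \<open>Cross k a b\<close>, \<open>a\<close> is the direction of the strand through the lower left end and \<open>b\<close>
  that of the strand through the lower right end.\<close>

datatype tile = Cup direction | Cap direction | Cross crossing_kind direction direction

fun tile_dom :: "tile \<Rightarrow> direction list" where
  "tile_dom (Cup c) = []"
| "tile_dom (Cap c) = [c, opp c]"
| "tile_dom (Cross k a b) = [a, b]"

fun tile_cod :: "tile \<Rightarrow> direction list" where
  "tile_cod (Cup c) = [c, opp c]"
| "tile_cod (Cap c) = []"
| "tile_cod (Cross k a b) = [b, a]"

text \<open>A layer consists of the strands to the left of the event, the event, and the strands to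
  the right of it.\<close>

type_synonym layer = "direction list \<times> tile \<times> direction list"

fun bottom :: "layer \<Rightarrow> direction list" where
  "bottom (l, t, r) = l @ tile_dom t @ r"

fun top :: "layer \<Rightarrow> direction list" where
  "top (l, t, r) = l @ tile_cod t @ r"

fun left_width :: "layer \<Rightarrow> nat" where
  "left_width (l, t, r) = length l"

fun tile_of :: "layer \<Rightarrow> tile" where
  "tile_of (l, t, r) = t"

type_synonym diagram = "layer list"

fun composable :: "direction list \<Rightarrow> diagram \<Rightarrow> direction list \<Rightarrow> bool" where
  "composable xs [] ys \<longleftrightarrow> xs = ys"
| "composable xs (L # D) ys \<longleftrightarrow> xs = bottom L \<and> composable (top L) D ys"

definition virtual_link_diagram :: "diagram \<Rightarrow> bool" where
  "virtual_link_diagram D \<longleftrightarrow> D \<noteq> [] \<and> composable [] D []"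

fun virtual_tile :: "tile \<Rightarrow> bool" where
  "virtual_tile (Cross k a b) \<longleftrightarrow> k = Virtual"
| "virtual_tile _ \<longleftrightarrow> False"

fun classical_tile :: "tile \<Rightarrow> bool" where
  "classical_tile (Cross k a b) \<longleftrightarrow> k \<noteq> Virtual"
| "classical_tile _ \<longleftrightarrow> False"

definition num_virtual :: "diagram \<Rightarrow> nat" where
  "num_virtual D = card {n. n < length D \<and> virtual_tile (tile_of (D ! n))}"


section \<open>Virtual equivalence\<close>

text \<open>
  The local moves below are completed by further strands on both sides and by further layers
  below and above.  All labels are arbitrary, so every orientation of the strands is covered.

  Planar isotopy.  A generic isotopy of the plane changes the layers of a diagram only when two
  events exchange their heights, when a minimum and a maximum on one strand are created or
  cancel (in two mirror images), or when a crossing slides over a minimum or a maximum of one of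
  its strands.
\<close>

inductive planar_isotopy :: "diagram \<Rightarrow> diagram \<Rightarrow> bool" where
  exchange: "planar_isotopy
     [([], s, m @ tile_dom t), (tile_cod s @ m, t, [])]
     [(tile_dom s @ m, t, []), ([], s, m @ tile_cod t)]"
| zigzag_right: "planar_isotopy [([c], Cup (opp c), []), ([], Cap c, [c])] []"
| zigzag_left: "planar_isotopy [([], Cup c, [c]), ([c], Cap (opp c), [])] []"
| slide_cup: "planar_isotopy
     [([], Cup c, [e]), ([c], Cross k (opp c) e, [])]
     [([e], Cup c, []), ([], Cross (flip k) e c, [opp c])]"
| slide_cap: "planar_isotopy
     [([], Cross k c e, [opp c]), ([e], Cap c, [])]
     [([c], Cross (flip k) e (opp c), []), ([], Cap c, [e])]"

text \<open>
  The three Reidemeister configurations, with the kinds of the crossings as parameters.  In the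
  third one the strands \<open>a\<close>, \<open>b\<close>, \<open>c\<close> start in this order; \<open>x\<close>, \<open>y\<close>, \<open>z\<close> are the kinds of
  the crossings of \<open>a\<close> with \<open>b\<close>, \<open>a\<close> with \<open>c\<close>, and \<open>b\<close> with \<open>c\<close>.
\<close>

inductive move_I :: "crossing_kind \<Rightarrow> diagram \<Rightarrow> diagram \<Rightarrow> bool" for k where
  "move_I k [([], Cross k (opp c) c, []), ([], Cap c, [])] [([], Cap (opp c), [])]"
| "move_I k [([], Cup c, []), ([], Cross k c (opp c), [])] [([], Cup (opp c), [])]"

inductive move_II :: "crossing_kind \<Rightarrow> diagram \<Rightarrow> diagram \<Rightarrow> bool" for k where
  "move_II k [([], Cross k a b, []), ([], Cross (flip k) b a, [])] []"

inductive move_III ::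
  "crossing_kind \<Rightarrow> crossing_kind \<Rightarrow> crossing_kind \<Rightarrow> diagram \<Rightarrow> diagram \<Rightarrow> bool" for x y z where
  "move_III x y z
     [([], Cross x a b, [c]), ([b], Cross y a c, []), ([], Cross z b c, [a])]
     [([a], Cross z b c, []), ([], Cross y a c, [b]), ([c], Cross x a b, [])]"

text \<open>In \<open>classical_III\<close> the last premise excludes exactly the two cyclic configurations
  (\<open>a\<close> over \<open>b\<close> over \<open>c\<close> over \<open>a\<close> and its reverse), in which no strand is the top one.\<close>

inductive classical_move :: "diagram \<Rightarrow> diagram \<Rightarrow> bool" where
  classical_I: "k \<noteq> Virtual \<Longrightarrow> move_I k U V \<Longrightarrow> classical_move U V"
| classical_II: "k \<noteq> Virtual \<Longrightarrow> move_II k U V \<Longrightarrow> classical_move U V"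
| classical_III: "x \<noteq> Virtual \<Longrightarrow> y \<noteq> Virtual \<Longrightarrow> z \<noteq> Virtual \<Longrightarrow> \<not> (x = z \<and> x \<noteq> y) \<Longrightarrow>
     move_III x y z U V \<Longrightarrow> classical_move U V"

text \<open>In move IV the strand with the two virtual crossings is \<open>a\<close>, \<open>b\<close> or \<open>c\<close>.\<close>

inductive virtual_move :: "diagram \<Rightarrow> diagram \<Rightarrow> bool" where
  virtual_I: "move_I Virtual U V \<Longrightarrow> virtual_move U V"
| virtual_II: "move_II Virtual U V \<Longrightarrow> virtual_move U V"
| virtual_III: "move_III Virtual Virtual Virtual U V \<Longrightarrow> virtual_move U V"
| virtual_IV_a: "k \<noteq> Virtual \<Longrightarrow> move_III Virtual Virtual k U V \<Longrightarrow> virtual_move U V"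
| virtual_IV_b: "k \<noteq> Virtual \<Longrightarrow> move_III Virtual k Virtual U V \<Longrightarrow> virtual_move U V"
| virtual_IV_c: "k \<noteq> Virtual \<Longrightarrow> move_III k Virtual Virtual U V \<Longrightarrow> virtual_move U V"

definition add_strands :: "direction list \<Rightarrow> direction list \<Rightarrow> diagram \<Rightarrow> diagram" where
  "add_strands l r = map (\<lambda>(l', t, r'). (l @ l', t, r' @ r))"

inductive diagram_move :: "diagram \<Rightarrow> diagram \<Rightarrow> bool" where
  "planar_isotopy U V \<or> classical_move U V \<or> virtual_move U V \<Longrightarrow>
   D = P @ add_strands l r U @ Q \<Longrightarrow> D' = P @ add_strands l r V @ Q \<Longrightarrow>
   virtual_link_diagram D \<Longrightarrow> virtual_link_diagram D' \<Longrightarrow> diagram_move D D'"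

definition virtually_equivalent :: "diagram \<Rightarrow> diagram \<Rightarrow> bool" where
  "virtually_equivalent = equivclp diagram_move"

definition virtual_crossing_number :: "diagram \<Rightarrow> nat" where
  "virtual_crossing_number D =
     (LEAST v. \<exists>D'. virtual_link_diagram D' \<and> virtually_equivalent D D' \<and> num_virtual D' = v)"


section \<open>States and their loops\<close>

definition classical_crossings :: "diagram \<Rightarrow> nat set" where
  "classical_crossings D = {n. n < length D \<and> classical_tile (tile_of (D ! n))}"

text \<open>A state is given by the set of those classical crossings (layer indices) that receive the
  disoriented smoothing; all the others receive the oriented one.\<close>

type_synonym state = "nat set"

definition states :: "diagram \<Rightarrow> state set" where
  "states D = Pow (classical_crossings D)"

text \<open>With both strands upwards, the crossing is positive iff the strand running from the lower
  left to the upper right is the upper one; reversing one strand changes the sign.\<close>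

fun positive_tile :: "tile \<Rightarrow> bool" where
  "positive_tile (Cross k a b) \<longleftrightarrow> k \<noteq> Virtual \<and> ((k = Over) = (a = b))"
| "positive_tile _ \<longleftrightarrow> False"

definition coefficient_A :: "diagram \<Rightarrow> state \<Rightarrow> nat \<Rightarrow> bool" where
  "coefficient_A D S n \<longleftrightarrow> (positive_tile (tile_of (D ! n)) \<longleftrightarrow> n \<notin> S)"

definition alpha :: "diagram \<Rightarrow> state \<Rightarrow> nat" where
  "alpha D S = card {n \<in> classical_crossings D. coefficient_A D S n}"

definition beta :: "diagram \<Rightarrow> state \<Rightarrow> nat" where
  "beta D S = card {n \<in> classical_crossings D. \<not> coefficient_A D S n}"

text \<open>The ends of the strands of a tile, at its four corners.\<close>

datatype corner = SW | SE | NW | NE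

fun horizontal :: "corner \<Rightarrow> corner" where
  "horizontal SW = SE" | "horizontal SE = SW" | "horizontal NW = NE" | "horizontal NE = NW"

fun vertical :: "corner \<Rightarrow> corner" where
  "vertical SW = NW" | "vertical NW = SW" | "vertical SE = NE" | "vertical NE = SE"

fun diagonal :: "corner \<Rightarrow> corner" where
  "diagonal SW = NE" | "diagonal NE = SW" | "diagonal SE = NW" | "diagonal NW = SE"

text \<open>The smoothing joining the two lower ends and the two upper ends is the oriented one iff one
  strand of the crossing goes up and the other one goes down.  If both go up, say, then it joins
  the two incoming (lower) ends, and the smoothing with vertical arcs is the oriented one.\<close>

fun horizontal_smoothing :: "bool \<Rightarrow> tile \<Rightarrow> bool" where
  "horizontal_smoothing disoriented (Cross k a b) \<longleftrightarrow> (disoriented \<longleftrightarrow> a = b)"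
| "horizontal_smoothing disoriented _ \<longleftrightarrow> True"

text \<open>The corner at which one leaves a tile of the state after entering it at a given corner.\<close>

definition exit_corner :: "bool \<Rightarrow> tile \<Rightarrow> corner \<Rightarrow> corner" where
  "exit_corner disoriented t c =
     (if virtual_tile t then diagonal c
      else if horizontal_smoothing disoriented t then horizontal c
      else vertical c)"

datatype side = LeftSide | RightSide

text \<open>The side to which the cusp points when the arc starting at the given corner is traversed.
  On the lower one of two horizontal arcs the cusp points upwards, on the upper one downwards; on
  the left one of two vertical arcs it points to the right, on the right one to the left.\<close>

fun cusp_horizontal :: "corner \<Rightarrow> side" where
  "cusp_horizontal SW = LeftSide" | "cusp_horizontal SE = RightSide"
| "cusp_horizontal NW = RightSide" | "cusp_horizontal NE = LeftSide"

fun cusp_vertical :: "corner \<Rightarrow> side" where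
  "cusp_vertical SW = RightSide" | "cusp_vertical NW = LeftSide"
| "cusp_vertical SE = LeftSide" | "cusp_vertical NE = RightSide"

definition tile_cusps :: "bool \<Rightarrow> tile \<Rightarrow> corner \<Rightarrow> side list" where
  "tile_cusps disoriented t c =
     (if classical_tile t \<and> disoriented
      then [if horizontal_smoothing disoriented t then cusp_horizontal c else cusp_vertical c]
      else [])"

text \<open>The point \<open>(n, p)\<close> is the \<open>p\<close>-th point, counted from the left starting at 0, on the
  horizontal line below layer \<open>n\<close>.  There is no point on the line above the last layer.\<close>

type_synonym point = "nat \<times> nat"

definition points :: "diagram \<Rightarrow> point set" where
  "points D = {(n, p). n < length D \<and> p < length (bottom (D ! n))}"

text \<open>A point together with the direction in which the traversal passes it.  From \<open>((n, p), Up)\<close>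
  one enters layer \<open>n\<close> from below, from \<open>((n, p), Down)\<close> layer \<open>n - 1\<close> from above.\<close>

type_synonym dpoint = "point \<times> direction"

fun entered_layer :: "dpoint \<Rightarrow> nat" where
  "entered_layer ((n, p), Up) = n"
| "entered_layer ((n, p), Down) = n - 1"

fun entered_corner :: "diagram \<Rightarrow> dpoint \<Rightarrow> corner option" where
  "entered_corner D ((n, p), Up) =
     (let i = left_width (D ! n) in
      if tile_dom (tile_of (D ! n)) = [] then None
      else if p = i then Some SW else if p = i + 1 then Some SE else None)"
| "entered_corner D ((n, p), Down) =
     (let i = left_width (D ! (n - 1)) in
      if tile_cod (tile_of (D ! (n - 1))) = [] then None
      else if p = i then Some NW else if p = i + 1 then Some NE else None)"

fun leave_corner :: "nat \<Rightarrow> nat \<Rightarrow> corner \<Rightarrow> dpoint" where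
  "leave_corner n i SW = ((n, i), Down)"
| "leave_corner n i SE = ((n, i + 1), Down)"
| "leave_corner n i NW = ((n + 1, i), Up)"
| "leave_corner n i NE = ((n + 1, i + 1), Up)"

text \<open>Following a strand that passes beside the event of the layer.\<close>

fun pass_by :: "diagram \<Rightarrow> dpoint \<Rightarrow> dpoint" where
  "pass_by D ((n, p), Up) =
     (if p < left_width (D ! n) then ((n + 1, p), Up)
      else ((n + 1, p + length (tile_cod (tile_of (D ! n)))
                      - length (tile_dom (tile_of (D ! n)))), Up))"
| "pass_by D ((n, p), Down) =
     (if p < left_width (D ! (n - 1)) then ((n - 1, p), Down)
      else ((n - 1, p + length (tile_dom (tile_of (D ! (n - 1))))
                      - length (tile_cod (tile_of (D ! (n - 1))))), Down))"

definition step :: "diagram \<Rightarrow> state \<Rightarrow> dpoint \<Rightarrow> dpoint" where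
  "step D S x =
     (let n = entered_layer x in
      case entered_corner D x of
        None \<Rightarrow> pass_by D x
      | Some c \<Rightarrow> leave_corner n (left_width (D ! n)) (exit_corner (n \<in> S) (tile_of (D ! n)) c))"

definition step_cusps :: "diagram \<Rightarrow> state \<Rightarrow> dpoint \<Rightarrow> side list" where
  "step_cusps D S x =
     (let n = entered_layer x in
      case entered_corner D x of
        None \<Rightarrow> []
      | Some c \<Rightarrow> tile_cusps (n \<in> S) (tile_of (D ! n)) c)"

text \<open>A loop is the set of the points passed by a traversal; its two directions of traversal
  give the same loop.\<close>

definition loop_through :: "diagram \<Rightarrow> state \<Rightarrow> dpoint \<Rightarrow> point set" where
  "loop_through D S x = fst ` orbit (step D S) x"

definition loops :: "diagram \<Rightarrow> state \<Rightarrow> point set set" where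
  "loops D S = loop_through D S ` (points D \<times> UNIV)"

text \<open>The cusps met during one full traversal starting at \<open>x\<close>.\<close>

definition cusp_word :: "diagram \<Rightarrow> state \<Rightarrow> dpoint \<Rightarrow> side list" where
  "cusp_word D S x =
     concat (map (\<lambda>j. step_cusps D S ((step D S ^^ j) x)) [0..<card (orbit (step D S) x)])"

text \<open>The second rule cancels the last and the first cusp of the cyclic word.\<close>

inductive cancel :: "side list \<Rightarrow> side list \<Rightarrow> bool" where
  "cancel (u @ [s, s] @ v) (u @ v)"
| "cancel ([s] @ u @ [s]) u"

definition remaining_cusps :: "side list \<Rightarrow> nat" where
  "remaining_cusps w =
     (THE m. \<exists>w'. cancel\<^sup>*\<^sup>* w w' \<and> (\<nexists>w''. cancel w' w'') \<and> length w' = m)"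

definition arrow_number :: "diagram \<Rightarrow> state \<Rightarrow> point set \<Rightarrow> nat" where
  "arrow_number D S C =
     (let x = (SOME x. x \<in> points D \<times> UNIV \<and> loop_through D S x = C)
      in remaining_cusps (cusp_word D S x) div 2)"


section \<open>The arrow polynomial\<close>

text \<open>The monomial \<open>(m, e)\<close> is $A^m \prod_i K_i^{e_i}$ with $m$ an integer; the variable with
  index 0 is never used.\<close>

type_synonym monomial = "int \<times> (nat \<Rightarrow>\<^sub>0 nat)"
type_synonym laurent = "monomial \<Rightarrow>\<^sub>0 int"

definition A_power :: "int \<Rightarrow> laurent" where
  "A_power m = Poly_Mapping.single (m, 0) 1"

definition K_var :: "nat \<Rightarrow> laurent" where
  "K_var i = Poly_Mapping.single (0, Poly_Mapping.single i 1) 1"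

definition loop_value :: laurent where
  "loop_value = - A_power 2 - A_power (- 2)"

definition loop_bracket :: "diagram \<Rightarrow> state \<Rightarrow> point set \<Rightarrow> laurent" where
  "loop_bracket D S C = (if arrow_number D S C = 0 then 1 else K_var (arrow_number D S C))"

definition state_bracket :: "diagram \<Rightarrow> state \<Rightarrow> laurent" where
  "state_bracket D S = (\<Prod>C\<in>loops D S. loop_bracket D S C)"

definition arrow_polynomial :: "diagram \<Rightarrow> laurent" where
  "arrow_polynomial D =
     (\<Sum>S\<in>states D. A_power (int (alpha D S) - int (beta D S))
        * loop_value ^ (card (loops D S) - 1) * state_bracket D S)"

definition k_degree :: "monomial \<Rightarrow> nat" where
  "k_degree M = (\<Sum>i\<in>Poly_Mapping.keys (snd M). i * Poly_Mapping.lookup (snd M) i)"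

definition max_k_degree :: "laurent \<Rightarrow> nat" where
  "max_k_degree P = Max (k_degree ` Poly_Mapping.keys P)"

end

theory Submission
  imports Defs Complex_Main
begin

text \<open>
  The proof has two halves: a single diagram with \<open>v\<close> virtual crossings has an arrow polynomial of
  k-degree at most \<open>v\<close>, and the set of k-degrees that occur in the arrow polynomial is the same for
  virtually equivalent diagrams.

  \<^emph>\<open>Arrow numbers as holonomies.\<close>  Along a loop of a state the cusps alternate between sources and
  sinks of the original orientation, so the number of cusps that survive the cancellation is the
  absolute value of an additive quantity: the sum over the cusps of a charge \<open>\<plusminus>1\<close> that depends on the
  side to which the cusp points and on whether it is a source or a sink
  (\<open>remaining_cusps_eq\<close>, \<open>cusp_path\<close>).  The charge is a cocycle on the state, and the Alexander
  numbering of the regions of the diagram is a potential that moves all of it from the cusps to the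
  virtual crossings, where the numbering jumps along a strand although there is no cusp
  (\<open>cusp_charge_eq_holonomy\<close>).  Hence twice the arrow number of a loop is the absolute value of a sum
  of terms \<open>\<plusminus>1\<close>, one for every passage of the loop through a virtual crossing.  A virtual crossing
  is passed twice, so the arrow numbers of a state add up to at most \<open>v\<close>
  (\<open>sum_arrow_number_le\<close>), and this is the bound on the degree (\<open>degree_arrow_polynomial\<close>).

  \<^emph>\<open>Invariance.\<close>  Let the integers act on a finite set of \<open>N\<close> colours, and colour the points of a
  state so that the colour is constant along the loops except that it is moved by the holonomy at
  virtual crossings.  A loop of arrow number \<open>a\<close> has as many colourings as there are fixed points of
  \<open>2a\<close>.  With $N = -A^2-A^{-2}$ the sum over the states becomes an evaluation of \<open>N\<close> times the arrow
  polynomial, at $K_a$ = (number of fixed points of \<open>2a\<close>)\<open>/N\<close> (\<open>amplitude_eq_evaluate\<close>).  On the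
  other hand colourings are local, so this sum is computed layer by layer by transfer operators
  (\<open>amplitude_eq_state_sum\<close>), in which a classical crossing is the usual Kauffman combination of two
  planar smoothings, and a virtual crossing a transposition followed by the action of \<open>\<plusminus>1\<close>.  The
  moves are now local identities between transfer operators; only the first
  classical move changes the amplitude, by a factor $-A^{\pm 3}$ (\<open>diagram_move_amplitude\<close>).

  There are enough actions to recover the polynomial: if the numbers of orbits of the various sizes
  grow at sufficiently different rates, then distinct monomials grow at different rates, so that a
  nonzero Laurent polynomial has a nonzero evaluation (\<open>evaluation_separates\<close>).  Thus a move
  multiplies the arrow polynomial by a unit $\pm A^m$.  With a single colour, and a sixth
  root of unity for \<open>A\<close>, the evaluation is \<open>1\<close>, so the arrow polynomial is never zero and
  its maximum k-degree is attained.
\<close>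


section \<open>The number of remaining cusps\<close>

fun cusp_sign :: "side \<Rightarrow> int" where
  "cusp_sign LeftSide = 1"
| "cusp_sign RightSide = - 1"

fun alternating_sum :: "side list \<Rightarrow> int" where
  "alternating_sum [] = 0"
| "alternating_sum (s # w) = cusp_sign s - alternating_sum w"

lemma alternating_sum_append:
  "alternating_sum (u @ v) = alternating_sum u + (- 1) ^ length u * alternating_sum v"
  by (induction u) (auto simp: algebra_simps)

text \<open>The two letters of a cancelling pair have opposite signs in the alternating sum: this is clear for
  neighbours, and holds for the last and the first letter because the length is even.  Removing the
  first letter changes all remaining signs, whence the absolute value.\<close>

lemma cancel_invariant:
  assumes "cancel w w'" "even (length w)"
  shows "\<bar>alternating_sum w'\<bar> = \<bar>alternating_sum w\<bar> \<and> even (length w') \<and> length w' < length w"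
  using assms
proof (induction rule: cancel.induct)
  case (1 u s v)
  then show ?case by (simp add: alternating_sum_append)
next
  case (2 s u)
  then show ?case by (simp add: alternating_sum_append)
qed

lemma cancel_rtranclp_invariant:
  assumes "cancel\<^sup>*\<^sup>* w w'" "even (length w)"
  shows "\<bar>alternating_sum w'\<bar> = \<bar>alternating_sum w\<bar> \<and> even (length w')"
  using assms by (induction rule: rtranclp_induct) (use cancel_invariant in fastforce)+

lemma cancel_normal_form_exists:
  "even (length w) \<Longrightarrow> \<exists>w'. cancel\<^sup>*\<^sup>* w w' \<and> (\<nexists>w''. cancel w' w'')"
proof (induction "length w" arbitrary: w rule: less_induct)
  case less
  show ?case
  proof (cases "\<exists>v. cancel w v")
    case True
    then obtain v where v: "cancel w v" by blast
    with less show ?thesis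
      by (meson cancel_invariant converse_rtranclp_into_rtranclp)
  qed blast
qed

text \<open>If no two neighbours are equal, then the letters alternate and all terms of the alternating
  sum have the same sign.\<close>

lemma alternating_sum_of_alternating_word:
  assumes "\<And>u s v. w \<noteq> u @ [s, s] @ v"
  shows "w = [] \<or> alternating_sum w = cusp_sign (hd w) * int (length w)"
  using assms
proof (induction w)
  case (Cons s w)
  have "\<And>u s' v. w \<noteq> u @ [s', s'] @ v"
    using Cons.prems by (metis append_Cons)
  note IH = Cons.IH[OF this]
  show ?case
  proof (cases w)
    case (Cons s' w')
    have "s \<noteq> s'" using Cons.prems[of "[]" s w'] Cons by simp
    then have "cusp_sign s' = - cusp_sign s" by (cases s; cases s') auto
    with IH Cons show ?thesis by (simp add: algebra_simps)
  qed simp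
qed simp

text \<open>Cancellation shortens the word, so it stops, and a word without equal neighbours has a length that
  can be read off from the invariant.  In particular the length does not depend on the order of the
  cancellations.\<close>

lemma remaining_cusps_eq:
  assumes "even (length w)"
  shows "int (remaining_cusps w) = \<bar>alternating_sum w\<bar>"
proof -
  have len: "int (length w') = \<bar>alternating_sum w\<bar>"
    if "cancel\<^sup>*\<^sup>* w w'" "\<nexists>w''. cancel w' w''" for w'
  proof -
    have "w' = [] \<or> alternating_sum w' = cusp_sign (hd w') * int (length w')"
      using that(2) by (intro alternating_sum_of_alternating_word) (metis cancel.intros(1))
    moreover have "\<bar>cusp_sign s\<bar> = 1" for s by (cases s) auto
    ultimately have "int (length w') = \<bar>alternating_sum w'\<bar>"
      by (auto simp: abs_mult)
    with cancel_rtranclp_invariant[OF that(1) assms] show ?thesis by simp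
  qed
  obtain w' where w': "cancel\<^sup>*\<^sup>* w w'" "\<nexists>w''. cancel w' w''"
    using cancel_normal_form_exists[OF assms] by blast
  have "remaining_cusps w = length w'"
    unfolding remaining_cusps_def
  proof (rule the_equality)
    show "\<exists>w'a. cancel\<^sup>*\<^sup>* w w'a \<and> (\<nexists>w''. cancel w'a w'') \<and> length w'a = length w'"
      using w' by blast
  qed (use len w' len[OF w'] in \<open>metis of_nat_eq_iff\<close>)
  with len[OF w'] show ?thesis by simp
qed

section \<open>Traversing a state\<close>

fun dsign :: "direction \<Rightarrow> int" where
  "dsign Up = 1"
| "dsign Down = - 1"

lemma UNIV_direction: "(UNIV :: direction set) = {Up, Down}"
  using direction.exhaust by auto

lemma dsign_opp [simp]: "dsign (opp c) = - dsign c"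
  by (cases c) auto

lemma opp_opp [simp]: "opp (opp c) = c"
  by (cases c) auto

lemma opp_neq [simp]: "opp c \<noteq> c" "c \<noteq> opp c"
  by (cases c; simp)+

definition reverse :: "'p \<times> direction \<Rightarrow> 'p \<times> direction" where
  "reverse x = (fst x, opp (snd x))"

lemma reverse_simps [simp]:
  "reverse (p, c) = (p, opp c)" "fst (reverse x) = fst x" "snd (reverse x) = opp (snd x)"
  "reverse (reverse x) = x" "reverse x \<noteq> x" "x \<noteq> reverse x"
  by (cases x; simp add: reverse_def)+

text \<open>The directions of the strands on the horizontal line number \<open>n\<close>.  The line above the last layer
  is included as an empty line, so that every layer lies between the lines \<open>n\<close> and \<open>n + 1\<close>.\<close>

definition strands :: "diagram \<Rightarrow> nat \<Rightarrow> direction list" where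
  "strands D n = (if n < length D then bottom (D ! n) else [])"

lemma points_eq: "points D = {(n, p). p < length (strands D n)}"
  by (auto simp: points_def strands_def split: if_splits)

lemma finite_points: "finite (points D)"
proof -
  have "points D = (SIGMA n:{..<length D}. {..<length (bottom (D ! n))})"
    by (auto simp: points_def)
  then show ?thesis by simp
qed

lemma composable_nth:
  assumes "composable xs D ys" "n < length D"
  shows "top (D ! n) = (if Suc n < length D then bottom (D ! Suc n) else ys)"
  using assms
proof (induction D arbitrary: xs n)
  case (Cons L D)
  then show ?case
    by (cases n; cases D) auto
qed simp

fun corners :: "tile \<Rightarrow> corner set" where
  "corners (Cup c) = {NW, NE}"
| "corners (Cap c) = {SW, SE}"
| "corners (Cross k a b) = UNIV"

fun enter_corner :: "nat \<Rightarrow> nat \<Rightarrow> corner \<Rightarrow> dpoint" where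
  "enter_corner n i SW = ((n, i), Up)"
| "enter_corner n i SE = ((n, i + 1), Up)"
| "enter_corner n i NW = ((n + 1, i), Down)"
| "enter_corner n i NE = ((n + 1, i + 1), Down)"

lemma reverse_leave_corner [simp]: "reverse (leave_corner n i c) = enter_corner n i c"
  by (cases c) auto

lemma reverse_enter_corner [simp]: "reverse (enter_corner n i c) = leave_corner n i c"
  by (cases c) auto

lemma UNIV_corner: "(UNIV :: corner set) = {SW, SE, NW, NE}"
  using corner.exhaust by auto

lemma exit_corner_in_corners: "c \<in> corners t \<Longrightarrow> exit_corner b t c \<in> corners t"
  by (cases t; cases c) (auto simp: exit_corner_def)

text \<open>Smoothings are involutions on the corners.  As leaving a tile through a corner is the reverse of
  entering it there, this makes traversals reversible.\<close>

lemma exit_exit_corner: "exit_corner b t (exit_corner b t c) = c"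
  by (cases c) (auto simp: exit_corner_def)

locale link_diagram =
  fixes D :: diagram
  assumes valid: "virtual_link_diagram D"
begin

lemma top_eq_strands: "n < length D \<Longrightarrow> top (D ! n) = strands D (Suc n)"
  using valid composable_nth[of "[]" D "[]" n] by (auto simp: virtual_link_diagram_def strands_def)

lemma bottom_eq_strands: "n < length D \<Longrightarrow> bottom (D ! n) = strands D n"
  by (simp add: strands_def)

lemma strands_0 [simp]: "strands D 0 = []"
  using valid by (cases D) (auto simp: virtual_link_diagram_def strands_def)

definition dpoints :: "dpoint set" where
  "dpoints = points D \<times> UNIV"

lemma finite_dpoints: "finite dpoints"
  by (simp add: dpoints_def finite_points UNIV_direction)

lemma dpoints_iff: "x \<in> dpoints \<longleftrightarrow> fst x \<in> points D"
  by (cases x) (auto simp: dpoints_def)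

text \<open>The ways to enter the layer \<open>n = (l, t, r)\<close>: beside its tile, on the left or on the right,
  upwards or downwards, or through a corner of the tile.\<close>

inductive enters :: "nat \<Rightarrow> layer \<Rightarrow> dpoint \<Rightarrow> bool" for n where
  left_up: "p < length l \<Longrightarrow> enters n (l, t, r) ((n, p), Up)"
| left_down: "p < length l \<Longrightarrow> enters n (l, t, r) ((Suc n, p), Down)"
| right_up: "q < length r \<Longrightarrow> enters n (l, t, r) ((n, length l + length (tile_dom t) + q), Up)"
| right_down: "q < length r \<Longrightarrow> enters n (l, t, r) ((Suc n, length l + length (tile_cod t) + q), Down)"
| corner: "c \<in> corners t \<Longrightarrow> enters n (l, t, r) (enter_corner n (length l) c)"

lemma dpoint_enters:
  assumes "x \<in> dpoints"
  obtains n where "n < length D" "enters n (D ! n) x"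
proof -
  obtain m p c where x: "x = ((m, p), c)" by (cases x) auto
  show thesis
  proof (cases c)
    case Up
    have n: "m < length D" using assms x by (auto simp: dpoints_def points_def)
    obtain l t r where L: "D ! m = (l, t, r)" by (cases "D ! m")
    have p: "p < length l + length (tile_dom t) + length r"
      using assms x n L by (auto simp: dpoints_def points_def)
    consider "p < length l" | "length l + length (tile_dom t) \<le> p"
      | "length l \<le> p" "p < length l + length (tile_dom t)" by linarith
    then have "enters m (l, t, r) x"
    proof cases
      case 1
      then show ?thesis using x Up by (auto intro: enters.intros)
    next
      case 2
      then show ?thesis using p x Up
        using right_up[of "p - (length l + length (tile_dom t))" r m l t] by auto
    next
      case 3
      then show ?thesis
        using x Up corner[of SW t m l r] corner[of SE t m l r]
        by (cases t; cases "p = length l") (auto simp: le_less_Suc_eq dest: le_antisym)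
    qed
    then show ?thesis using that n L by metis
  next
    case Down
    have "m \<noteq> 0" using assms x by (auto simp: dpoints_def points_eq intro!: gr0I)
    then obtain n where m: "m = Suc n" by (cases m) auto
    have n: "n < length D" using assms x m by (auto simp: dpoints_def points_def)
    obtain l t r where L: "D ! n = (l, t, r)" by (cases "D ! n")
    have p: "p < length l + length (tile_cod t) + length r"
      using assms x n L m top_eq_strands[OF n] by (auto simp: dpoints_def points_eq dest: sym)
    consider "p < length l" | "length l + length (tile_cod t) \<le> p"
      | "length l \<le> p" "p < length l + length (tile_cod t)" by linarith
    then have "enters n (l, t, r) x"
    proof cases
      case 1
      then show ?thesis using x m Down by (auto intro: enters.intros)
    next
      case 2
      then show ?thesis using p x m Down
        using right_down[of "p - (length l + length (tile_cod t))" r n l t] by auto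
    next
      case 3
      then show ?thesis
        using x m Down corner[of NW t n l r] corner[of NE t n l r]
        by (cases t; cases "p = length l") (auto simp: le_less_Suc_eq dest: le_antisym)
    qed
    then show ?thesis using that n L by metis
  qed
qed

lemma enters_dpoint:
  assumes "enters n (D ! n) x" "n < length D"
  shows "x \<in> dpoints"
  using assms(1)
proof (cases rule: enters.cases)
  case (left_up p l t r)
  then show ?thesis using bottom_eq_strands[OF assms(2)] by (auto simp: dpoints_def points_eq dest: sym)
next
  case (left_down p l t r)
  then show ?thesis using top_eq_strands[OF assms(2)] by (auto simp: dpoints_def points_eq dest: sym)
next
  case (right_up q r l t)
  then show ?thesis using bottom_eq_strands[OF assms(2)] by (auto simp: dpoints_def points_eq dest: sym)
next
  case (right_down q r l t)
  then show ?thesis using top_eq_strands[OF assms(2)] by (auto simp: dpoints_def points_eq dest: sym)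
next
  case (corner c t l r)
  then show ?thesis using bottom_eq_strands[OF assms(2)] top_eq_strands[OF assms(2)]
    by (cases t; cases c) (auto simp: dpoints_def points_eq dest: sym)
qed

lemma step_beside:
  assumes "D ! n = (l, t, r)"
  shows "p < length l \<Longrightarrow> step D S ((n, p), Up) = ((Suc n, p), Up)"
    and "p < length l \<Longrightarrow> step D S ((Suc n, p), Down) = ((n, p), Down)"
    and "step D S ((n, length l + length (tile_dom t) + q), Up) =
           ((Suc n, length l + length (tile_cod t) + q), Up)"
    and "step D S ((Suc n, length l + length (tile_cod t) + q), Down) =
           ((n, length l + length (tile_dom t) + q), Down)"
  using assms by (cases t; simp add: step_def Let_def)+

lemma entered_corner_beside:
  assumes "D ! n = (l, t, r)"
  shows "p < length l \<Longrightarrow> entered_corner D ((n, p), Up) = None"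
    and "p < length l \<Longrightarrow> entered_corner D ((Suc n, p), Down) = None"
    and "entered_corner D ((n, length l + length (tile_dom t) + q), Up) = None"
    and "entered_corner D ((Suc n, length l + length (tile_cod t) + q), Down) = None"
  using assms by (cases t; simp add: Let_def)+

lemma entered_corner_enter_corner:
  assumes "D ! n = (l, t, r)" "c \<in> corners t"
  shows "entered_corner D (enter_corner n (length l) c) = Some c"
    "entered_layer (enter_corner n (length l) c) = n"
  using assms by (cases t; cases c; simp add: Let_def)+

lemma step_corner:
  assumes "D ! n = (l, t, r)" "c \<in> corners t"
  shows "step D S (enter_corner n (length l) c) =
    leave_corner n (length l) (exit_corner (n \<in> S) t c)"
  using entered_corner_enter_corner[OF assms] assms(1) by (simp add: step_def)

lemma fst_enter_corner_inj: "fst (enter_corner n i c) = fst (enter_corner n i c') \<longleftrightarrow> c = c'"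
  by (cases c; cases c') auto

lemma exit_corner_neq: "exit_corner b t c \<noteq> c"
  by (cases c) (auto simp: exit_corner_def)

text \<open>Traversals are reversible, and they never stay at a point.  These facts alone determine the
  structure of the loops as needed below.\<close>

lemma step_facts:
  assumes "x \<in> dpoints"
  shows step_in_dpoints: "step D S x \<in> dpoints"
    and step_reverse_step: "step D S (reverse (step D S x)) = reverse x"
    and fst_step_neq: "fst (step D S x) \<noteq> fst x"
proof -
  obtain n where n: "n < length D" and e: "enters n (D ! n) x"
    using dpoint_enters[OF assms] .
  have "enters n (D ! n) (reverse (step D S x)) \<and> step D S (reverse (step D S x)) = reverse x
     \<and> fst (step D S x) \<noteq> fst x"
    using e
  proof (cases rule: enters.cases)
    case (left_up p l t r)
    then show ?thesis using step_beside(1,2)[of n l t r p S] by (auto intro: enters.intros dest: sym)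
  next
    case (left_down p l t r)
    then show ?thesis using step_beside(1,2)[of n l t r p S] by (auto intro: enters.intros dest: sym)
  next
    case (right_up q r l t)
    then show ?thesis using step_beside(3,4)[of n l t r S q] by (auto intro: enters.intros dest: sym)
  next
    case (right_down q r l t)
    then show ?thesis using step_beside(3,4)[of n l t r S q] by (auto intro: enters.intros dest: sym)
  next
    case (corner c t l r)
    let ?c = "exit_corner (n \<in> S) t c"
    have c: "?c \<in> corners t" using corner exit_corner_in_corners by blast
    have "fst (leave_corner n (length l) ?c) = fst (enter_corner n (length l) ?c)"
      by (metis reverse_enter_corner reverse_simps(2))
    then show ?thesis
      using step_corner[of n l t r c S] step_corner[of n l t r ?c S] corner c
        exit_exit_corner[of "n \<in> S" t c] exit_corner_neq[of "n \<in> S" t c]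
      by (auto intro: enters.intros simp: fst_enter_corner_inj)
  qed
  moreover from this have "reverse (step D S x) \<in> dpoints" using enters_dpoint n by blast
  ultimately show "step D S x \<in> dpoints" "step D S (reverse (step D S x)) = reverse x"
    "fst (step D S x) \<noteq> fst x" by (auto simp: dpoints_iff)
qed

end


section \<open>The holonomy of a loop\<close>

text \<open>The holonomy picked up by a passage through a virtual crossing.  It is the negative of the jump of
  the Alexander numbering: the strand passes from one side of the other strand to the other side.\<close>

fun tile_holonomy :: "tile \<Rightarrow> corner \<Rightarrow> int" where
  "tile_holonomy (Cross Virtual a b) SW = - dsign b"
| "tile_holonomy (Cross Virtual a b) NE = dsign b"
| "tile_holonomy (Cross Virtual a b) SE = dsign a"
| "tile_holonomy (Cross Virtual a b) NW = - dsign a"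
| "tile_holonomy _ _ = 0"

definition holonomy :: "diagram \<Rightarrow> dpoint \<Rightarrow> int" where
  "holonomy D x =
     (case entered_corner D x of
        None \<Rightarrow> 0
      | Some c \<Rightarrow> tile_holonomy (tile_of (D ! entered_layer x)) c)"

definition along :: "diagram \<Rightarrow> dpoint \<Rightarrow> bool" where
  "along D x \<longleftrightarrow> strands D (fst (fst x)) ! snd (fst x) = snd x"

text \<open>Sinks pointing to the left and sources pointing to the right have charge \<open>1\<close>, the other cusps
  have charge \<open>- 1\<close>.  Reversing the traversal turns left into right but keeps sinks and sources, so
  it changes the sign of the charge.\<close>

definition cusp_charge :: "diagram \<Rightarrow> state \<Rightarrow> dpoint \<Rightarrow> int" where
  "cusp_charge D S x =
     (if along D x then 1 else - 1) * sum_list (map cusp_sign (step_cusps D S x))"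

text \<open>The average of the Alexander numbers of the regions to the left and to the right of the \<open>p\<close>-th
  point, shifted by one half to make it an integer.\<close>

definition numbering :: "direction list \<Rightarrow> nat \<Rightarrow> int" where
  "numbering xs p = sum_list (map dsign (take p xs)) + (if xs ! p = Up then 1 else 0)"

definition potential :: "diagram \<Rightarrow> point \<Rightarrow> int" where
  "potential D z = numbering (strands D (fst z)) (snd z)"

lemma sum_dsign_tile: "sum_list (map dsign (tile_dom t)) = sum_list (map dsign (tile_cod t))"
  by (cases t) auto

lemma numbering_beside:
  "p < length l \<Longrightarrow> numbering (l @ xs) p = numbering l p"
  "sum_list (map dsign u) = sum_list (map dsign v) \<Longrightarrow>
   numbering (l @ u @ r) (length l + length u + q) = numbering (l @ v @ r) (length l + length v + q)"
  by (auto simp: numbering_def nth_append)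

lemma numbering_at:
  "numbering (l @ a # r) (length l) = sum_list (map dsign l) + (if a = Up then 1 else 0)"
  "numbering (l @ a # b # r) (Suc (length l)) =
     sum_list (map dsign l) + dsign a + (if b = Up then 1 else 0)"
  by (auto simp: numbering_def nth_append)

context link_diagram
begin

text \<open>Strands beside the tile see the same numbering above and below it, because the directions at the
  bottom and at the top of a tile have the same sum.  At a classical crossing the numbering changes
  along the arcs of the oriented smoothing by nothing and along those of the disoriented one by the
  charge of the cusp.  At a cusp, and only there, the traversal changes between following and opposing
  the orientation.\<close>

lemma
  assumes "x \<in> dpoints"
  shows cusp_charge_eq_holonomy: "cusp_charge D S x =
           holonomy D x + potential D (fst (step D S x)) - potential D (fst x)"
    and along_step: "along D (step D S x) \<longleftrightarrow> (along D x \<longleftrightarrow> step_cusps D S x = [])"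
    and holonomy_reverse_step: "holonomy D (reverse (step D S x)) = - holonomy D x"
proof -
  obtain n where n: "n < length D" and e: "enters n (D ! n) x"
    using dpoint_enters[OF assms] .
  note bt = bottom_eq_strands[OF n] top_eq_strands[OF n]
  have "cusp_charge D S x = holonomy D x + potential D (fst (step D S x)) - potential D (fst x) \<and>
    (along D (step D S x) \<longleftrightarrow> (along D x \<longleftrightarrow> step_cusps D S x = [])) \<and>
    holonomy D (reverse (step D S x)) = - holonomy D x"
    using e
  proof (cases rule: enters.cases)
    case (left_up p l t r)
    with bt have "strands D n = l @ tile_dom t @ r" "strands D (Suc n) = l @ tile_cod t @ r" by auto
    with left_up show ?thesis
      using step_beside(1,2)[of n l t r p S] entered_corner_beside(1,2)[of n l t r p]
      by (simp add: cusp_charge_def holonomy_def step_cusps_def potential_def numbering_beside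
          along_def nth_append)
  next
    case (left_down p l t r)
    with bt have "strands D n = l @ tile_dom t @ r" "strands D (Suc n) = l @ tile_cod t @ r" by auto
    with left_down show ?thesis
      using step_beside(1,2)[of n l t r p S] entered_corner_beside(1,2)[of n l t r p]
      by (simp add: cusp_charge_def holonomy_def step_cusps_def potential_def numbering_beside
          along_def nth_append)
  next
    case (right_up q r l t)
    with bt have "strands D n = l @ tile_dom t @ r" "strands D (Suc n) = l @ tile_cod t @ r" by auto
    with right_up show ?thesis
      using step_beside(3,4)[of n l t r S q] entered_corner_beside(3,4)[of n l t r q]
        numbering_beside(2)[OF sum_dsign_tile, of l t r q]
      by (simp add: cusp_charge_def holonomy_def step_cusps_def potential_def
          along_def nth_append)
  next
    case (right_down q r l t)
    with bt have "strands D n = l @ tile_dom t @ r" "strands D (Suc n) = l @ tile_cod t @ r" by auto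
    with right_down show ?thesis
      using step_beside(3,4)[of n l t r S q] entered_corner_beside(3,4)[of n l t r q]
        numbering_beside(2)[OF sum_dsign_tile, of l t r q]
      by (simp add: cusp_charge_def holonomy_def step_cusps_def potential_def
          along_def nth_append)
  next
    case (corner c t l r)
    let ?c = "exit_corner (n \<in> S) t c"
    have c: "?c \<in> corners t" using corner exit_corner_in_corners by blast
    have L: "D ! n = (l, t, r)" using corner by simp
    have s: "strands D n = l @ tile_dom t @ r" "strands D (Suc n) = l @ tile_cod t @ r"
      using bt L by auto
    have 1: "step D S x = leave_corner n (length l) ?c" 
      using step_corner[of n l t r c S] corner by auto
    have 2: "step_cusps D S x = tile_cusps (n \<in> S) t c" "holonomy D x = tile_holonomy t c"
      using entered_corner_enter_corner[of n l t r c] corner L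
      by (auto simp: step_cusps_def holonomy_def)
    have 3: "holonomy D (reverse (step D S x)) = tile_holonomy t ?c"
      using entered_corner_enter_corner[of n l t r ?c] L c 1
      by (auto simp: step_cusps_def holonomy_def)
    have 4: "tile_holonomy t ?c = - tile_holonomy t c"
    proof (cases t)
      case (Cross k a b)
      then show ?thesis by (cases k; cases c) (auto simp: exit_corner_def)
    qed auto
    have 5: "along D (leave_corner n (length l) ?c) \<longleftrightarrow>
      (along D (enter_corner n (length l) c) \<longleftrightarrow> tile_cusps (n \<in> S) t c = [])"
    proof (cases t)
      case (Cup a)
      then show ?thesis using s corner(3)
        by (cases c; cases a) (auto simp: along_def exit_corner_def tile_cusps_def nth_append)
    next
      case (Cap a)
      then show ?thesis using s corner(3)
        by (cases c; cases a) (auto simp: along_def exit_corner_def tile_cusps_def nth_append)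
    next
      case (Cross k a b)
      then show ?thesis using s
        by (cases c; cases a; cases b; cases k)
          (auto simp: along_def exit_corner_def tile_cusps_def nth_append)
    qed
    have 6: "(if along D (enter_corner n (length l) c) then 1 else - 1) *
        sum_list (map cusp_sign (tile_cusps (n \<in> S) t c)) = tile_holonomy t c +
        potential D (fst (leave_corner n (length l) ?c)) - potential D (fst (enter_corner n (length l) c))"
    proof (cases t)
      case (Cup a)
      then show ?thesis using s corner(3)
        by (cases c; cases a) (auto simp: along_def exit_corner_def tile_cusps_def
              nth_append potential_def numbering_at)
    next
      case (Cap a)
      then show ?thesis using s corner(3)
        by (cases c; cases a) (auto simp: along_def exit_corner_def tile_cusps_def
              nth_append potential_def numbering_at)
    next
      case (Cross k a b)
      then show ?thesis using s
        by (cases c; cases a; cases b; cases k)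
          (auto simp: along_def exit_corner_def tile_cusps_def
              nth_append potential_def numbering_at)
    qed
    show ?thesis using 1 2 3 4 5 6 corner(2) by (simp add: cusp_charge_def)
  qed
  then show "cusp_charge D S x = holonomy D x + potential D (fst (step D S x)) - potential D (fst x)"
    "along D (step D S x) \<longleftrightarrow> (along D x \<longleftrightarrow> step_cusps D S x = [])"
    "holonomy D (reverse (step D S x)) = - holonomy D x" by auto
qed

lemma funpow_step_in_dpoints: "x \<in> dpoints \<Longrightarrow> (step D S ^^ k) x \<in> dpoints"
  by (induction k) (auto simp: step_in_dpoints)

lemma step_cusps_cases:
  obtains "step_cusps D S x = []" | s where "step_cusps D S x = [s]"
proof -
  have "step_cusps D S x = [] \<or> (\<exists>s. step_cusps D S x = [s])"
    by (cases "entered_corner D x") (auto simp: step_cusps_def tile_cusps_def Let_def)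
  then show thesis using that by blast
qed

text \<open>Whether the traversal follows the orientation is determined by the parity of the number of cusps
  met so far; so the alternating signs of the letters turn into the signs in the definition of the
  charge.\<close>

lemma cusp_path:
  fixes S :: state
  assumes "x \<in> dpoints"
  defines "w \<equiv> \<lambda>k. concat (map (\<lambda>j. step_cusps D S ((step D S ^^ j) x)) [0..<k])"
  shows "(along D ((step D S ^^ k) x) \<longleftrightarrow> (along D x \<longleftrightarrow> even (length (w k)))) \<and>
    alternating_sum (w k) =
      (if along D x then 1 else - 1) * (\<Sum>j<k. cusp_charge D S ((step D S ^^ j) x))"
proof (induction k)
  case 0
  then show ?case by (simp add: w_def)
next
  case (Suc k)
  let ?y = "(step D S ^^ k) x"
  have y: "?y \<in> dpoints" using assms funpow_step_in_dpoints by blast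
  have w: "w (Suc k) = w k @ step_cusps D S ?y" by (simp add: w_def)
  show ?case
    using Suc along_step[OF y, of S] 
    by (cases rule: step_cusps_cases[of S ?y])
      (auto simp: w alternating_sum_append cusp_charge_def)
qed

end

section \<open>Colourings of the loops of a traversal\<close>

text \<open>The part of the structure of a state that matters for its loops, as an abstract notion: a
  permutation of the directed points that is inverted by reversal.\<close>

locale traversal =
  fixes V :: "'p set" and f :: "'p \<times> direction \<Rightarrow> 'p \<times> direction"
  assumes finite_V: "finite V"
    and f_closed: "fst x \<in> V \<Longrightarrow> fst (f x) \<in> V"
    and f_reverse_f: "fst x \<in> V \<Longrightarrow> f (reverse (f x)) = reverse x"
    and f_moves: "fst x \<in> V \<Longrightarrow> fst (f x) \<noteq> fst x"
begin

lemma f_inject: "fst x \<in> V \<Longrightarrow> fst y \<in> V \<Longrightarrow> f x = f y \<Longrightarrow> x = y"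
  by (metis f_reverse_f reverse_simps(4))

lemma funpow_closed: "fst x \<in> V \<Longrightarrow> fst ((f ^^ k) x) \<in> V"
  by (induction k) (auto simp: f_closed)

text \<open>Reversibility makes \<open>f\<close> injective, so it permutes a finite set.\<close>

lemma in_own_orbit: assumes "fst x \<in> V" shows "x \<in> orbit f x"
proof -
  let ?A = "V \<times> (UNIV :: direction set)"
  have A: "?A = {x. fst x \<in> V}" by auto
  have fin: "finite ?A" using finite_V by (simp add: UNIV_direction)
  let ?F = "perm_restrict f ?A"
  have "inj_on f ?A" by (rule inj_onI) (use f_inject A in auto)
  then have "bij_betw f ?A ?A"
    using fin A f_closed by (intro bij_betw_imageI endo_inj_surj) auto
  then have "bij_betw ?F ?A ?A"
    by (rule bij_betw_cong[THEN iffD1, rotated]) (simp add: perm_restrict_def)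
  then have "?F permutes ?A"
    by (intro bij_imp_permutes) (auto simp: perm_restrict_def)
  then have "permutation ?F" using fin permutation_permutes by blast
  then have "x \<in> orbit ?F x" by (rule permutation_self_in_orbit)
  also have "orbit ?F x = orbit f x"
    by (rule orbit_cong0[symmetric, of x ?A])
      (use assms A f_closed in \<open>auto simp: perm_restrict_def\<close>)
  finally show ?thesis .
qed

lemma orbit_closed: "fst x \<in> V \<Longrightarrow> y \<in> orbit f x \<Longrightarrow> fst y \<in> V"
  using funpow_closed[of x] unfolding orbit_altdef by blast

lemma finite_orbit: "fst x \<in> V \<Longrightarrow> finite (orbit f x)"
  using Orbits.finite_orbit in_own_orbit by metis

lemma
  assumes "fst x \<in> V"
  shows orbit_bij: "bij_betw (\<lambda>j. (f ^^ j) x) {..<card (orbit f x)} (orbit f x)"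
    and funpow_period: "(f ^^ card (orbit f x)) x = x"
    and card_orbit_pos: "card (orbit f x) > 0"
proof -
  have *: "x \<in> orbit f x" using in_own_orbit[OF assms] .
  then have b: "bij_betw (\<lambda>j. (f ^^ j) x) {0..<funpow_dist1 f x x} (orbit f x)"
    using inj_on_funpow_dist1[OF *] orbit_conv_funpow_dist1[OF *] by (auto simp: bij_betw_def)
  then have c: "card (orbit f x) = funpow_dist1 f x x"
    using bij_betw_same_card by fastforce
  then show "bij_betw (\<lambda>j. (f ^^ j) x) {..<card (orbit f x)} (orbit f x)"
    using b by (simp add: atLeast0LessThan)
  show "(f ^^ card (orbit f x)) x = x" using funpow_dist1_prop[OF *] c by metis
  show "card (orbit f x) > 0" using c by simp
qed

lemma sum_orbit: "fst x \<in> V \<Longrightarrow> sum h (orbit f x) = (\<Sum>j<card (orbit f x). h ((f ^^ j) x))"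
  by (rule sum.reindex_bij_betw[symmetric, OF orbit_bij])

lemma orbit_eq: "fst x \<in> V \<Longrightarrow> y \<in> orbit f x \<Longrightarrow> orbit f y = orbit f x"
  by (meson in_own_orbit orbit_swap orbit_trans subsetI subset_antisym)

text \<open>A loop never runs through the same point in both directions: a path from \<open>x\<close> to its reverse could
  be shortened by one step at both ends, down to a path of length one or zero.\<close>

lemma funpow_neq_reverse:
  "fst x \<in> V \<Longrightarrow> (f ^^ k) x \<noteq> reverse x"
proof (induction k arbitrary: x rule: less_induct)
  case (less k)
  consider "k = 0" | "k = 1" | j where "k = Suc (Suc j)"
    by (metis One_nat_def not0_implies_Suc)
  then show ?case
  proof cases
    case 1
    then show ?thesis by simp
  next
    case 2
    then show ?thesis using f_moves[OF less.prems] by (auto dest: arg_cong[of _ _ fst])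
  next
    case 3
    have "(f ^^ j) (f x) \<noteq> reverse (f x)" using less 3 f_closed by simp
    moreover have "fst ((f ^^ Suc j) x) \<in> V" by (rule funpow_closed[OF less.prems])
    ultimately have "f ((f ^^ Suc j) x) \<noteq> f (reverse (f x))"
      using f_inject f_closed[OF less.prems] by (metis funpow_swap1 funpow.simps(2) comp_apply reverse_simps(2))
    then show ?thesis using 3 f_reverse_f[OF less.prems] by simp
  qed
qed

lemma reverse_notin_orbit:
  assumes "fst x \<in> V" "y \<in> orbit f x"
  shows "reverse y \<notin> orbit f x"
proof
  assume "reverse y \<in> orbit f x"
  then have "reverse y \<in> orbit f y" using orbit_eq assms by metis
  then obtain k where "reverse y = (f ^^ k) y" unfolding orbit_altdef by blast
  then show False using funpow_neq_reverse[OF orbit_closed[OF assms]] by metis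
qed

lemma same_point: "fst y = fst z \<Longrightarrow> z = y \<or> z = reverse y"
  by (cases y; cases z; cases "snd y"; cases "snd z") auto

lemma inj_on_fst_orbit: "fst x \<in> V \<Longrightarrow> inj_on fst (orbit f x)"
  by (rule inj_onI) (metis reverse_notin_orbit same_point)

lemma funpow_reverse: "fst x \<in> V \<Longrightarrow> (f ^^ k) (reverse ((f ^^ k) x)) = reverse x"
proof (induction k)
  case (Suc k)
  have "(f ^^ Suc k) (reverse ((f ^^ Suc k) x)) = (f ^^ k) (f (reverse (f ((f ^^ k) x))))"
    by (simp add: funpow_swap1)
  also have "\<dots> = reverse x" using Suc f_reverse_f funpow_closed by simp
  finally show ?case .
qed simp

lemma orbit_reverse: assumes "fst x \<in> V" shows "orbit f (reverse x) = reverse ` orbit f x"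
proof -
  have *: "reverse z \<in> orbit f (reverse y)" if y: "fst y \<in> V" "z \<in> orbit f y" for y z
  proof -
    obtain k where "z = (f ^^ k) y" using y(2) by (auto simp: orbit_altdef)
    then have z: "(f ^^ k) (reverse z) = reverse y" using funpow_reverse y(1) by simp
    have "fst (reverse z) \<in> V" using y orbit_closed by simp
    then have "reverse y \<in> orbit f (reverse z)" 
      using z in_own_orbit funpow_in_orbit by metis
    then show ?thesis using orbit_eq[of "reverse z" "reverse y"] in_own_orbit \<open>fst (reverse z) \<in> V\<close> by blast
  qed
  show ?thesis
  proof
    show "reverse ` orbit f x \<subseteq> orbit f (reverse x)" using * assms by blast
    show "orbit f (reverse x) \<subseteq> reverse ` orbit f x"
    proof
      fix z assume "z \<in> orbit f (reverse x)"
      then have "reverse z \<in> orbit f x" using *[of "reverse x" z] assms by simp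
      then have "reverse (reverse z) \<in> reverse ` orbit f x" by (rule imageI)
      then show "z \<in> reverse ` orbit f x" by simp
    qed
  qed
qed

definition components :: "'p set set" where
  "components = (\<lambda>x. fst ` orbit f x) ` (V \<times> UNIV)"

lemma component_eq:
  assumes "fst x \<in> V" "p \<in> fst ` orbit f x"
  shows "fst ` orbit f (p, c) = fst ` orbit f x"
proof -
  obtain y where y: "y \<in> orbit f x" "p = fst y" using assms by auto
  then have "(p, c) = y \<or> (p, c) = reverse y" using same_point[of y "(p, c)"] by auto
  moreover have "orbit f y = orbit f x" using orbit_eq assms y by blast
  moreover have "orbit f (reverse y) = reverse ` orbit f y" using orbit_reverse orbit_closed assms y by blast
  ultimately show ?thesis by (metis (no_types, lifting) image_cong image_image reverse_simps(2))
qed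

lemma finite_components: "finite components"
proof -
  have "components \<subseteq> Pow V" using orbit_closed by (auto simp: components_def)
  then show ?thesis using finite_V by (meson finite_Pow_iff finite_subset)
qed

lemma component_obtain:
  assumes "C \<in> components"
  obtains x where "fst x \<in> V" "C = fst ` orbit f x"
  using assms by (auto simp: components_def)

lemma Union_components: "\<Union> components = V"
proof
  show "\<Union> components \<subseteq> V" using orbit_closed by (auto simp: components_def)
  show "V \<subseteq> \<Union> components"
  proof
    fix p assume "p \<in> V"
    then have "(p, Up) \<in> orbit f (p, Up)" "fst ` orbit f (p, Up) \<in> components"
      using in_own_orbit[of "(p, Up)"] by (auto simp: components_def)
    then show "p \<in> \<Union> components" by (metis UnionI fst_conv imageI)
  qed
qed

lemma components_disjoint: "C \<in> components \<Longrightarrow> C' \<in> components \<Longrightarrow> p \<in> C \<Longrightarrow> p \<in> C' \<Longrightarrow> C = C'"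
  using component_eq by (metis component_obtain)

lemma component_closed:
  assumes "C \<in> components" "fst x \<in> C" shows "fst (f x) \<in> C"
proof -
  obtain y where y: "fst y \<in> V" "C = fst ` orbit f y" using component_obtain assms(1) .
  then have "C = fst ` orbit f x" using component_eq[of y "fst x" "snd x"] assms by simp
  then show ?thesis using orbit.base by (metis imageI)
qed

end


locale colours =
  fixes X :: "'c set" and U :: "int \<Rightarrow> 'c \<Rightarrow> 'c"
  assumes finite_X: "finite X"
    and U_closed: "c \<in> X \<Longrightarrow> U m c \<in> X"
    and U_zero: "c \<in> X \<Longrightarrow> U 0 c = c"
    and U_add: "c \<in> X \<Longrightarrow> U (m + n) c = U m (U n c)"
begin

lemma U_inverse: "c \<in> X \<Longrightarrow> U (- m) (U m c) = c" "c \<in> X \<Longrightarrow> U m (U (- m) c) = c"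
  using U_add[of c "- m" m] U_add[of c m "- m"] U_zero by auto

definition fixed_colours :: "int \<Rightarrow> 'c set" where
  "fixed_colours m = {c \<in> X. U m c = c}"

lemma fixed_colours_uminus: "fixed_colours (- m) = fixed_colours m"
proof -
  have "U (- m) c = c \<longleftrightarrow> U m c = c" if "c \<in> X" for c
    using U_inverse[OF that, of m] by metis
  then show ?thesis by (auto simp: fixed_colours_def)
qed

lemma fixed_colours_abs: "fixed_colours \<bar>m\<bar> = fixed_colours m"
  by (simp add: abs_if fixed_colours_uminus)

lemma fixed_colours_zero: "fixed_colours 0 = X"
  using U_zero by (auto simp: fixed_colours_def)

end

locale coloured_traversal = traversal V f + colours X U
  for V :: "'p set" and f and X :: "'c set" and U +
  fixes h :: "'p \<times> direction \<Rightarrow> int"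
  assumes h_reverse: "fst x \<in> V \<Longrightarrow> h (reverse (f x)) = - h x"
begin

definition colourings :: "'p set \<Rightarrow> ('p \<Rightarrow> 'c) set" where
  "colourings W = {\<chi> \<in> W \<rightarrow>\<^sub>E X. \<forall>x. fst x \<in> W \<longrightarrow> \<chi> (fst (f x)) = U (h x) (\<chi> (fst x))}"

lemma colouringsD:
  assumes "\<chi> \<in> colourings W"
  shows "p \<in> W \<Longrightarrow> \<chi> p \<in> X" "p \<notin> W \<Longrightarrow> \<chi> p = undefined"
    "fst x \<in> W \<Longrightarrow> \<chi> (fst (f x)) = U (h x) (\<chi> (fst x))"
  using assms unfolding colourings_def PiE_def extensional_def by blast+

lemma colouringsI:
  assumes "\<And>p. p \<in> W \<Longrightarrow> \<chi> p \<in> X" "\<And>p. p \<notin> W \<Longrightarrow> \<chi> p = undefined"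
    "\<And>x. fst x \<in> W \<Longrightarrow> \<chi> (fst (f x)) = U (h x) (\<chi> (fst x))"
  shows "\<chi> \<in> colourings W"
  using assms by (auto simp: colourings_def PiE_def extensional_def)

text \<open>A colouring of a loop is determined by the colour of one point, and an initial colour can be
  propagated around the loop if and only if it is fixed by the total holonomy.\<close>

lemma card_colourings_component:
  assumes x: "fst x \<in> V"
  shows "card (colourings (fst ` orbit f x)) = card (fixed_colours (sum h (orbit f x)))"
proof -
  define C where "C = fst ` orbit f x"
  define k where "k = card (orbit f x)"
  define s where "s j = (\<Sum>i<j. h ((f ^^ i) x))" for j
  define g where "g j = fst ((f ^^ j) x)" for j
  have s_k: "s k = sum h (orbit f x)" by (simp add: s_def k_def sum_orbit[OF x])
  have s_Suc: "s (Suc j) = h ((f ^^ j) x) + s j" for j by (simp add: s_def)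
  have g_k: "g k = g 0" using funpow_period[OF x] by (simp add: g_def k_def)
  have k: "k > 0" using card_orbit_pos[OF x] by (simp add: k_def)
  have C: "C \<in> components" using x unfolding C_def components_def by (cases x) auto
  have g_C: "g j \<in> C" for j
    unfolding C_def g_def by (intro imageI funpow_in_orbit in_own_orbit x)
  have g_bij: "bij_betw g {..<k} C"
  proof -
    have "g = fst \<circ> (\<lambda>j. (f ^^ j) x)" by (auto simp: g_def)
    then show ?thesis
      using bij_betw_trans[OF orbit_bij[OF x] inj_on_imp_bij_betw[OF inj_on_fst_orbit[OF x]]]
      by (simp only: C_def k_def)
  qed
  have path: "\<chi> (g j) = U (s j) (\<chi> (g 0))" if "\<chi> \<in> colourings C" for \<chi> j
  proof (induction j)
    case 0
    have "s 0 = 0" by (simp add: s_def)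
    then show ?case using U_zero[OF colouringsD(1)[OF that g_C]] by simp
  next
    case (Suc j)
    have "\<chi> (g (Suc j)) = U (h ((f ^^ j) x)) (\<chi> (g j))"
      using colouringsD(3)[OF that, of "(f ^^ j) x"] g_C[of j] by (simp add: g_def)
    also have "\<dots> = U (s (Suc j)) (\<chi> (g 0))"
      using U_add[OF colouringsD(1)[OF that g_C[of 0]]] Suc s_Suc by simp
    finally show ?case .
  qed
  have "bij_betw (\<lambda>\<chi>. \<chi> (g 0)) (colourings C) (fixed_colours (s k))"
  proof (intro bij_betwI')
    fix \<chi> \<chi>' assume *: "\<chi> \<in> colourings C" "\<chi>' \<in> colourings C"
    show "\<chi> (g 0) = \<chi>' (g 0) \<longleftrightarrow> \<chi> = \<chi>'"
    proof
      assume "\<chi> (g 0) = \<chi>' (g 0)"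
      then have "\<chi> (g j) = \<chi>' (g j)" for j using path * by metis
      then have "\<chi> p = \<chi>' p" if "p \<in> C" for p
        using that g_bij by (metis bij_betw_imp_surj_on imageE)
      then show "\<chi> = \<chi>'" using colouringsD(2) * by (metis ext)
    qed simp
  next
    fix \<chi> assume *: "\<chi> \<in> colourings C"
    have "\<chi> (g 0) \<in> X" using colouringsD(1)[OF * g_C] .
    then show "\<chi> (g 0) \<in> fixed_colours (s k)" using path[OF *, of k] g_k by (auto simp: fixed_colours_def)
  next
    fix c assume c: "c \<in> fixed_colours (s k)"
    then have cX: "c \<in> X" by (simp add: fixed_colours_def)
    define \<chi> where "\<chi> = (\<lambda>p\<in>C. U (s (inv_into {..<k} g p)) c)"
    have \<chi>_g: "\<chi> (g j) = U (s j) c" if "j < k" for j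
      using that g_C[of j] g_bij by (simp add: \<chi>_def bij_betw_inv_into_left[OF g_bij])
    have \<chi>_g': "\<chi> (g j) = U (s j) c" if "j \<le> k" for j
      using \<chi>_g[of j] \<chi>_g[of 0] that k g_k c U_zero[OF cX]
      by (cases "j = k") (auto simp: fixed_colours_def s_def)
    \<comment> \<open>The rule holds for one direction of traversal by construction, and for the other by reversibility.\<close>
    have fwd: "\<chi> (fst (f y)) = U (h y) (\<chi> (fst y))" if "y \<in> orbit f x" for y
    proof -
      have "y \<in> (\<lambda>j. (f ^^ j) x) ` {..<k}"
        using that bij_betw_imp_surj_on[OF orbit_bij[OF x]] by (simp add: k_def)
      then obtain j where j: "j < k" "y = (f ^^ j) x" by auto
      have "\<chi> (fst (f y)) = \<chi> (g (Suc j))" by (simp add: g_def j)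
      also have "\<dots> = U (h y + s j) c" using \<chi>_g'[of "Suc j"] j s_Suc by simp
      also have "\<dots> = U (h y) (\<chi> (fst y))" using U_add[OF cX] \<chi>_g[of j] j by (simp add: g_def)
      finally show ?thesis .
    qed
    have \<chi>_X: "\<chi> p \<in> X" if "p \<in> C" for p
      using that U_closed[OF cX] by (simp add: \<chi>_def)
    have bwd: "\<chi> (fst (f y)) = U (h y) (\<chi> (fst y))" if ry: "reverse y \<in> orbit f x" for y
    proof -
      obtain i where i: "0 < i" "reverse y = (f ^^ i) x" using ry by (auto simp: orbit_altdef)
      define w where "w = (f ^^ (i - 1)) x"
      have w: "reverse y = f w" "w \<in> orbit f x"
        using i funpow_in_orbit[OF in_own_orbit[OF x]] by (cases i; simp add: w_def)+
      have wV: "fst w \<in> V" using orbit_closed[OF x w(2)] .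
      have y: "y = reverse (f w)" using w(1) by (metis reverse_simps(4))
      have "\<chi> (fst w) \<in> X" using \<chi>_X w(2) by (simp add: C_def)
      then show ?thesis
        using fwd[OF w(2)] U_inverse f_reverse_f[OF wV] h_reverse[OF wV] by (simp add: y)
    qed
    have "y \<in> orbit f x \<or> reverse y \<in> orbit f x" if y: "fst y \<in> C" for y
    proof -
      obtain z where "z \<in> orbit f x" "fst y = fst z" using y by (auto simp: C_def)
      then show ?thesis using same_point[of z y] same_point[of y z] by auto
    qed
    then have step: "\<chi> (fst (f y)) = U (h y) (\<chi> (fst y))" if "fst y \<in> C" for y
      using fwd bwd that by blast
    have "\<chi> \<in> colourings C"
      by (rule colouringsI) (use step \<chi>_X in \<open>simp_all add: \<chi>_def\<close>)
    moreover have "c = \<chi> (g 0)" using \<chi>_g[of 0] k U_zero[OF cX] by (simp add: s_def)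
    ultimately show "\<exists>\<chi>\<in>colourings C. c = \<chi> (g 0)" by blast
  qed
  then show ?thesis using bij_betw_same_card s_k C_def by metis
qed

text \<open>The conditions on a colouring never relate different loops.\<close>

lemma card_colourings: "card (colourings V) = (\<Prod>C\<in>components. card (colourings C))"
proof -
  define comp where "comp p = fst ` orbit f (p, Up)" for p
  have comp: "comp p \<in> components" "p \<in> comp p" if "p \<in> V" for p
    using that in_own_orbit[of "(p, Up)"] by (force simp: comp_def components_def)+
  have comp_eq: "comp p = C" if "C \<in> components" "p \<in> C" for p C
    using comp that components_disjoint Union_components by (metis UnionI)
  have sub: "C \<subseteq> V" if "C \<in> components" for C using that Union_components by blast
  have "bij_betw (\<lambda>\<chi>. \<lambda>C\<in>components. restrict \<chi> C) (colourings V) (PiE components colourings)"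
  proof (rule bij_betw_byWitness[where f' = "\<lambda>\<Phi>. \<lambda>p\<in>V. \<Phi> (comp p) p"])
    show "\<forall>\<chi>\<in>colourings V. (\<lambda>p\<in>V. (\<lambda>C\<in>components. restrict \<chi> C) (comp p) p) = \<chi>"
      using comp by (auto simp: fun_eq_iff restrict_def dest: colouringsD(2))
    show "\<forall>\<Phi>\<in>PiE components colourings.
        (\<lambda>C\<in>components. restrict (\<lambda>p\<in>V. \<Phi> (comp p) p) C) = \<Phi>"
    proof
      fix \<Phi> assume \<Phi>: "\<Phi> \<in> PiE components colourings"
      show "(\<lambda>C\<in>components. restrict (\<lambda>p\<in>V. \<Phi> (comp p) p) C) = \<Phi>"
      proof (rule extensionalityI[of _ components])
        fix C assume C: "C \<in> components"
        then have "\<Phi> C \<in> colourings C" using \<Phi> by auto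
        then show "(\<lambda>C\<in>components. restrict (\<lambda>p\<in>V. \<Phi> (comp p) p) C) C = \<Phi> C"
          using C sub[OF C] comp_eq[OF C] colouringsD(2)[of "\<Phi> C" C]
          by (auto simp: fun_eq_iff restrict_def)
      qed (use \<Phi> in \<open>auto simp: PiE_def\<close>)
    qed
    show "(\<lambda>\<chi>. \<lambda>C\<in>components. restrict \<chi> C) ` colourings V \<subseteq> PiE components colourings"
    proof clarsimp
      fix \<chi> C assume *: "\<chi> \<in> colourings V" "C \<in> components"
      show "restrict \<chi> C \<in> colourings C"
        using colouringsD[OF *(1)] sub[OF *(2)] component_closed[OF *(2)]
        by (intro colouringsI) (auto simp: subset_iff)
    qed
    show "(\<lambda>\<Phi>. \<lambda>p\<in>V. \<Phi> (comp p) p) ` PiE components colourings \<subseteq> colourings V"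
    proof
      fix \<chi> assume "\<chi> \<in> (\<lambda>\<Phi>. \<lambda>p\<in>V. \<Phi> (comp p) p) ` PiE components colourings"
      then obtain \<Phi> where \<Phi>: "\<Phi> \<in> PiE components colourings" "\<chi> = (\<lambda>p\<in>V. \<Phi> (comp p) p)" by blast
      have col: "\<Phi> (comp p) \<in> colourings (comp p)" if "p \<in> V" for p using \<Phi> comp that by auto
      have "\<chi> p \<in> X" if "p \<in> V" for p using colouringsD(1)[OF col[OF that] comp(2)[OF that]] that \<Phi>(2) by simp
      moreover have "\<chi> (fst (f x)) = U (h x) (\<chi> (fst x))" if x: "fst x \<in> V" for x
      proof -
        have "fst (f x) \<in> comp (fst x)" using component_closed comp x by blast
        then have "comp (fst (f x)) = comp (fst x)" using comp_eq comp x by blast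
        then show ?thesis
          using colouringsD(3)[OF col[OF x] comp(2)[OF x]] f_closed[OF x] x by (simp add: \<Phi>(2))
      qed
      ultimately show "\<chi> \<in> colourings V" by (intro colouringsI) (auto simp: \<Phi>(2))
    qed
  qed
  then show ?thesis
    using bij_betw_same_card card_PiE[OF finite_components] by metis
qed

end


section \<open>Arrow numbers and virtual crossings\<close>

lemma even_alternating_sum: "even (alternating_sum w) \<longleftrightarrow> even (length w)"
proof (induction w)
  case (Cons s w)
  then show ?case by (cases s) auto
qed simp

context link_diagram
begin

sublocale traversal "points D" "step D S" for S :: state
  by unfold_locales
    (use finite_points step_in_dpoints step_reverse_step fst_step_neq in \<open>auto simp: dpoints_iff\<close>)

lemma loops_eq_components: "loops D S = components S"
  by (simp add: loops_def components_def loop_through_def)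

text \<open>Around a closed loop the contribution of the potential telescopes to zero, so the charges of the
  cusps can be replaced by the holonomies at the virtual crossings.\<close>

lemma
  assumes x: "x \<in> dpoints"
  shows even_length_cusp_word: "even (length (cusp_word D S x))"
    and alternating_sum_cusp_word:
      "\<bar>alternating_sum (cusp_word D S x)\<bar> = \<bar>sum (holonomy D) (orbit (step D S) x)\<bar>"
proof -
  let ?k = "card (orbit (step D S) x)" and ?y = "\<lambda>j. (step D S ^^ j) x"
  have xV: "fst x \<in> points D" using x by (simp add: dpoints_iff)
  have p: "?y ?k = x" using funpow_period[OF xV] .
  show "even (length (cusp_word D S x))"
    using cusp_path[OF x, where S = S and k = ?k] p unfolding cusp_word_def by auto
  have "(\<Sum>j<?k. cusp_charge D S (?y j)) =
      (\<Sum>j<?k. holonomy D (?y j) + (potential D (fst (?y (Suc j))) - potential D (fst (?y j))))"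
    by (rule sum.cong) (use cusp_charge_eq_holonomy funpow_step_in_dpoints[OF x] in auto)
  also have "\<dots> = (\<Sum>j<?k. holonomy D (?y j)) + (potential D (fst (?y ?k)) - potential D (fst (?y 0)))"
    by (subst sum.distrib, subst sum_lessThan_telescope) simp
  also have "\<dots> = sum (holonomy D) (orbit (step D S) x)"
    using p sum_orbit[OF xV, of "holonomy D"] by simp
  finally show "\<bar>alternating_sum (cusp_word D S x)\<bar> = \<bar>sum (holonomy D) (orbit (step D S) x)\<bar>"
    using cusp_path[OF x, where S = S and k = ?k] unfolding cusp_word_def by (simp add: abs_mult)
qed

text \<open>The base point is the one chosen in the definition of the arrow number.\<close>

lemma arrow_number_eq:
  assumes "C \<in> loops D S"
  obtains x where "fst x \<in> points D" "C = fst ` orbit (step D S) x"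
    "2 * int (arrow_number D S C) = \<bar>sum (holonomy D) (orbit (step D S) x)\<bar>"
proof -
  define x where "x = (SOME x. x \<in> points D \<times> UNIV \<and> loop_through D S x = C)"
  have "\<exists>x. x \<in> points D \<times> UNIV \<and> loop_through D S x = C"
    using assms by (auto simp: loops_def)
  then have x: "x \<in> points D \<times> UNIV \<and> loop_through D S x = C"
    unfolding x_def by (rule someI_ex)
  then have xd: "x \<in> dpoints" by (auto simp: dpoints_iff)
  let ?w = "cusp_word D S x"
  have "arrow_number D S C = remaining_cusps ?w div 2"
    by (simp add: arrow_number_def x_def Let_def)
  moreover have "int (remaining_cusps ?w) = \<bar>alternating_sum ?w\<bar>"
    using remaining_cusps_eq even_length_cusp_word[OF xd] by blast
  moreover have "even (alternating_sum ?w)"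
    using even_alternating_sum even_length_cusp_word[OF xd] by blast
  ultimately have "2 * int (arrow_number D S C) = \<bar>alternating_sum ?w\<bar>" by presburger
  then show thesis
    using that[of x] x alternating_sum_cusp_word[OF xd] by (auto simp: loop_through_def)
qed

lemma holonomy_nonzero:
  assumes "x \<in> dpoints" "holonomy D x \<noteq> 0"
  obtains n c where "n < length D" "virtual_tile (tile_of (D ! n))"
    "x = enter_corner n (left_width (D ! n)) c"
proof -
  obtain n where n: "n < length D" and e: "enters n (D ! n) x"
    using dpoint_enters[OF assms(1)] .
  from e show thesis
  proof (cases rule: enters.cases)
    case (corner c t l r)
    have L: "D ! n = (l, t, r)" using corner by simp
    have "holonomy D x = tile_holonomy t c"
      using entered_corner_enter_corner[OF L corner(3)] L unfolding holonomy_def corner(2) by simp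
    then have "virtual_tile t" using assms(2) by (cases "(t, c)" rule: tile_holonomy.cases) auto
    then show thesis using that[of n c] n corner by (metis left_width.simps tile_of.simps)
  qed (use assms(2) entered_corner_beside[of n] in \<open>auto simp: holonomy_def dest: sym\<close>)
qed

lemma abs_holonomy_le: "\<bar>holonomy D x\<bar> \<le> 1"
proof -
  have "\<bar>dsign a\<bar> = 1" for a by (cases a) auto
  then have "\<bar>tile_holonomy t c\<bar> \<le> 1" for t c by (cases "(t, c)" rule: tile_holonomy.cases) auto
  then show ?thesis by (auto simp: holonomy_def split: option.splits)
qed

lemma card_holonomy_nonzero: "card {x \<in> dpoints. holonomy D x \<noteq> 0} \<le> 4 * num_virtual D"
proof -
  let ?N = "{n. n < length D \<and> virtual_tile (tile_of (D ! n))}"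
  have fin: "finite (?N \<times> (UNIV :: corner set))" by (simp add: UNIV_corner)
  have "{x \<in> dpoints. holonomy D x \<noteq> 0} \<subseteq>
      (\<lambda>(n, c). enter_corner n (left_width (D ! n)) c) ` (?N \<times> UNIV)"
  proof clarify
    fix a b c assume "((a, b), c) \<in> dpoints" "holonomy D ((a, b), c) \<noteq> 0"
    then obtain n c' where "n \<in> ?N" "((a, b), c) = enter_corner n (left_width (D ! n)) c'"
      by (metis (mono_tags, lifting) holonomy_nonzero mem_Collect_eq)
    then show "((a, b), c) \<in> (\<lambda>(n, c). enter_corner n (left_width (D ! n)) c) ` (?N \<times> UNIV)"
      by (intro image_eqI[of _ _ "(n, c')"]) auto
  qed
  then have "card {x \<in> dpoints. holonomy D x \<noteq> 0} \<le> card (?N \<times> (UNIV :: corner set))"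
    by (rule surj_card_le[OF fin])
  also have "\<dots> = card ?N * 4" by (simp add: card_cartesian_product UNIV_corner)
  finally show ?thesis by (simp add: num_virtual_def)
qed

text \<open>Each virtual crossing can be entered at four corners.  If one direction of traversal is fixed for
  every loop, then the entries used in this direction and those used in the opposite direction are
  disjoint, so at most half of them contribute; and each contributes at most \<open>1\<close> to twice the sum of
  the arrow numbers.\<close>

theorem sum_arrow_number_le: "(\<Sum>C\<in>loops D S. arrow_number D S C) \<le> num_virtual D"
proof -
  define base where "base C = (SOME x. fst x \<in> points D \<and> C = fst ` orbit (step D S) x \<and>
    2 * int (arrow_number D S C) = \<bar>sum (holonomy D) (orbit (step D S) x)\<bar>)" for C
  have "fst (base C) \<in> points D \<and> C = fst ` orbit (step D S) (base C) \<and>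
      2 * int (arrow_number D S C) = \<bar>sum (holonomy D) (orbit (step D S) (base C))\<bar>"
    if "C \<in> loops D S" for C
  proof -
    have "\<exists>x. fst x \<in> points D \<and> C = fst ` orbit (step D S) x \<and>
      2 * int (arrow_number D S C) = \<bar>sum (holonomy D) (orbit (step D S) x)\<bar>"
      by (rule arrow_number_eq[OF that]) blast
    then show ?thesis unfolding base_def by (rule someI_ex)
  qed
  note base = this
  let ?H = "{x \<in> dpoints. holonomy D x \<noteq> 0}"
  define Q where "Q C = orbit (step D S) (base C)" for C
  have finQ: "finite (Q C)" if "C \<in> loops D S" for C
    unfolding Q_def using finite_orbit base[OF that] by blast
  have Q_dp: "Q C \<subseteq> dpoints" if "C \<in> loops D S" for C
    using orbit_closed base[OF that] unfolding Q_def dpoints_iff[abs_def] subset_iff by blast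
  have fin_loops: "finite (loops D S)" using finite_components by (simp add: loops_eq_components)
  have fin_H: "finite ?H" using finite_dpoints by simp
  have disj: "C = C'" if "C \<in> loops D S" "C' \<in> loops D S" "x \<in> Q C" "y \<in> Q C'" "fst x = fst y" for C C' x y
  proof -
    have "fst x \<in> C" using base[OF that(1)] that(3) by (simp add: Q_def) (metis imageI)
    moreover have "fst x \<in> C'" using base[OF that(2)] that(4,5) by (simp add: Q_def) (metis imageI)
    ultimately show ?thesis using components_disjoint that(1,2) unfolding loops_eq_components by blast
  qed
  define R where "R = (\<Union>C\<in>loops D S. ?H \<inter> Q C)"
  have "2 * int (arrow_number D S C) \<le> int (card (?H \<inter> Q C))" if C: "C \<in> loops D S" for C
  proof -
    have "2 * int (arrow_number D S C) = \<bar>sum (holonomy D) (Q C)\<bar>" using base[OF C] by (simp add: Q_def)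
    also have "sum (holonomy D) (Q C) = sum (holonomy D) (?H \<inter> Q C)"
      using Q_dp[OF C] by (intro sum.mono_neutral_right finQ C) auto
    also have "\<bar>\<dots>\<bar> \<le> (\<Sum>x\<in>?H \<inter> Q C. 1)"
      by (rule order_trans[OF sum_abs]) (rule sum_mono, rule abs_holonomy_le)
    finally show ?thesis by simp
  qed
  then have "2 * (\<Sum>C\<in>loops D S. int (arrow_number D S C)) \<le> (\<Sum>C\<in>loops D S. int (card (?H \<inter> Q C)))"
    by (subst sum_distrib_left) (rule sum_mono)
  also have "\<dots> = int (card R)"
  proof -
    have "(?H \<inter> Q C) \<inter> (?H \<inter> Q C') = {}" if "C \<in> loops D S" "C' \<in> loops D S" "C \<noteq> C'" for C C'
      using disj[OF that(1,2)] that(3) by blast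
    then show ?thesis
      unfolding R_def using fin_loops fin_H by (subst card_UN_disjoint) auto
  qed
  finally have 1: "2 * (\<Sum>C\<in>loops D S. int (arrow_number D S C)) \<le> int (card R)" .
  \<comment> \<open>Leaving the tile and turning around gives the entry used by the reversed loop.\<close>
  let ?g = "\<lambda>x. reverse (step D S x)"
  have R_dp: "R \<subseteq> dpoints" by (auto simp: R_def)
  have "inj_on ?g R"
    by (rule inj_onI) (metis R_dp dpoints_iff f_inject reverse_simps(4) subsetD)
  moreover have "?g ` R \<subseteq> ?H - R"
  proof (rule image_subsetI)
    fix x assume "x \<in> R"
    then obtain C where C: "C \<in> loops D S" "x \<in> Q C" "x \<in> ?H" by (auto simp: R_def)
    have s: "step D S x \<in> Q C" using C(2) unfolding Q_def by (rule orbit.step)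
    have "?g x \<notin> Q C" using reverse_notin_orbit base[OF C(1)] s unfolding Q_def by blast
    then have "?g x \<notin> R" using disj[OF C(1) _ s, of _ "?g x"] by (auto simp: R_def)
    moreover have "?g x \<in> ?H"
      using C step_in_dpoints[of x S] holonomy_reverse_step[of x S] by (simp add: dpoints_iff)
    ultimately show "?g x \<in> ?H - R" by blast
  qed
  ultimately have "card R \<le> card (?H - R)"
    using card_inj_on_le fin_H by blast
  moreover have "R \<subseteq> ?H" by (auto simp: R_def)
  ultimately have "2 * card R \<le> card ?H"
    using fin_H by (simp add: card_Diff_subset finite_subset)
  then have "int (card R) \<le> 2 * int (num_virtual D)" using card_holonomy_nonzero by linarith
  with 1 have "int (\<Sum>C\<in>loops D S. arrow_number D S C) \<le> int (num_virtual D)" by simp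
  then show ?thesis by linarith
qed

end

locale coloured_diagram = link_diagram D + colours X U
  for D and X :: "'c set" and U
begin

sublocale coloured_traversal "points D" "step D S" X U "holonomy D" for S :: state
  by unfold_locales (use holonomy_reverse_step in \<open>auto simp: dpoints_iff\<close>)

theorem card_colourings_points:
  "card (colourings S (points D)) = (\<Prod>C\<in>loops D S. card (fixed_colours (2 * int (arrow_number D S C))))"
proof -
  have "card (colourings S C) = card (fixed_colours (2 * int (arrow_number D S C)))"
    if "C \<in> loops D S" for C
    by (rule arrow_number_eq[OF that]) (metis card_colourings_component fixed_colours_abs)
  then show ?thesis unfolding card_colourings loops_eq_components[symmetric] by simp
qed

end


section \<open>The state sum as a transfer amplitude\<close>

lemma map_upt_eq_iff:
  "map f [a..<a + k] = map g [b..<b + k] \<longleftrightarrow> (\<forall>q<k. f (a + q) = g (b + q))"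
  by (simp add: list_eq_iff_nth_eq del: upt_Suc)

lemma sum_of_bool_eq_card:
  "finite P \<Longrightarrow> K = {x \<in> P. Q x} \<Longrightarrow> (\<Sum>x\<in>P. of_bool (Q x)) = (of_nat (card K) :: complex)"
  by (simp add: Int_def)

fun corner_colour :: "'c list \<Rightarrow> 'c list \<Rightarrow> corner \<Rightarrow> 'c" where
  "corner_colour xs zs SW = xs ! 0"
| "corner_colour xs zs SE = xs ! 1"
| "corner_colour xs zs NW = zs ! 0"
| "corner_colour xs zs NE = zs ! 1"

text \<open>The number of colours plays the role of the loop value $d = -A^2-A^{-2}$.\<close>

locale bracket_colours = colours X U for X :: "'c set" and U +
  fixes A :: complex
  assumes A_nonzero: "A \<noteq> 0"
    and card_X: "of_nat (card X) = - (A ^ 2) - inverse A ^ 2"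
begin

definition colour_lists :: "nat \<Rightarrow> 'c list set" where
  "colour_lists n = {xs. set xs \<subseteq> X \<and> length xs = n}"

lemma finite_colour_lists: "finite (colour_lists n)"
  unfolding colour_lists_def by (rule finite_lists_length_eq[OF finite_X])

text \<open>The rule for colourings, for all passages through one tile; it is phrased with corners in order to
  match the definition of a traversal.\<close>

definition tile_rel :: "bool \<Rightarrow> tile \<Rightarrow> 'c list \<Rightarrow> 'c list \<Rightarrow> bool" where
  "tile_rel b t xs zs \<longleftrightarrow> (\<forall>c\<in>corners t.
     corner_colour xs zs (exit_corner b t c) = U (tile_holonomy t c) (corner_colour xs zs c))"

definition smoothing_weight :: "bool \<Rightarrow> tile \<Rightarrow> complex" where
  "smoothing_weight b t = (if positive_tile t = b then inverse A else A)"

definition tile_weight :: "tile \<Rightarrow> 'c list \<Rightarrow> 'c list \<Rightarrow> complex" where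
  "tile_weight t xs zs =
     (if classical_tile t
      then smoothing_weight True t * of_bool (tile_rel True t xs zs) +
        smoothing_weight False t * of_bool (tile_rel False t xs zs)
      else of_bool (tile_rel False t xs zs))"

text \<open>The transfer operators act on functions of the colours of a horizontal line, from the top of a
  layer to its bottom.\<close>

definition tile_op :: "tile \<Rightarrow> ('c list \<Rightarrow> complex) \<Rightarrow> 'c list \<Rightarrow> complex" where
  "tile_op t F xs = (\<Sum>zs\<in>colour_lists (length (tile_cod t)). tile_weight t xs zs * F zs)"

fun layer_op :: "layer \<Rightarrow> ('c list \<Rightarrow> complex) \<Rightarrow> 'c list \<Rightarrow> complex" where
  "layer_op (l, t, r) F xs =
     tile_op t (\<lambda>zs. F (take (length l) xs @ zs @ drop (length l + length (tile_dom t)) xs))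
       (take (length (tile_dom t)) (drop (length l) xs))"

fun amplitude :: "diagram \<Rightarrow> ('c list \<Rightarrow> complex) \<Rightarrow> 'c list \<Rightarrow> complex" where
  "amplitude [] F = F"
| "amplitude (L # D) F = layer_op L (amplitude D F)"

lemma amplitude_append: "amplitude (D @ E) F = amplitude D (amplitude E F)"
  by (induction D) auto

definition beside_rel :: "layer \<Rightarrow> 'c list \<Rightarrow> 'c list \<Rightarrow> bool" where
  "beside_rel L xs zs = (case L of (l, t, r) \<Rightarrow>
     take (length l) xs = take (length l) zs \<and>
     drop (length l + length (tile_dom t)) xs = drop (length l + length (tile_cod t)) zs)"

definition layer_weight :: "layer \<Rightarrow> 'c list \<Rightarrow> 'c list \<Rightarrow> complex" where
  "layer_weight L xs zs =
     of_bool (beside_rel L xs zs) * tile_weight (tile_of L) (drop (left_width L) xs) (drop (left_width L) zs)"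

lemma tile_rel_append:
  assumes "length xs = length (tile_dom t)" "length zs = length (tile_cod t)"
  shows "tile_rel b t (xs @ xs') (zs @ zs') \<longleftrightarrow> tile_rel b t xs zs"
proof -
  have "corner_colour (xs @ xs') (zs @ zs') c = corner_colour xs zs c" if "c \<in> corners t" for c
    using that assms by (cases t; cases c) (auto simp: nth_append)
  then show ?thesis unfolding tile_rel_def using exit_corner_in_corners by simp
qed

lemma tile_weight_append:
  assumes "length xs = length (tile_dom t)" "length zs = length (tile_cod t)"
  shows "tile_weight t (xs @ xs') (zs @ zs') = tile_weight t xs zs"
  unfolding tile_weight_def using tile_rel_append[OF assms] by simp

lemma layer_op_eq_sum:
  assumes "xs \<in> colour_lists (length (bottom L))"
  shows "layer_op L F xs = (\<Sum>zs\<in>colour_lists (length (top L)). layer_weight L xs zs * F zs)"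
proof -
  obtain l t r where L: "L = (l, t, r)" by (cases L)
  define xl xm xr where "xl = take (length l) xs"
    and "xm = take (length (tile_dom t)) (drop (length l) xs)"
    and "xr = drop (length l + length (tile_dom t)) xs"
  have xs: "xs = xl @ xm @ xr"
    unfolding xl_def xm_def xr_def by (metis add.commute append_take_drop_id drop_drop)
  have len: "length xl = length l" "length xm = length (tile_dom t)" "length xr = length r"
    using assms by (auto simp: L xl_def xm_def xr_def colour_lists_def)
  have X: "set xl \<subseteq> X" "set xr \<subseteq> X" using assms xs by (auto simp: colour_lists_def)
  let ?B = "{zs \<in> colour_lists (length (top L)). beside_rel L xs zs}"
  have "(\<Sum>zs\<in>colour_lists (length (top L)). layer_weight L xs zs * F zs) =
      (\<Sum>zs\<in>?B. layer_weight L xs zs * F zs)"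
    by (rule sum.mono_neutral_right) (auto simp: finite_colour_lists layer_weight_def)
  also have "\<dots> = (\<Sum>zm\<in>colour_lists (length (tile_cod t)). tile_weight t xm zm * F (xl @ zm @ xr))"
  proof (rule sum.reindex_bij_witness[of _ "\<lambda>zm. xl @ zm @ xr"
        "\<lambda>zs. take (length (tile_cod t)) (drop (length l) zs)"])
    fix zs assume "zs \<in> ?B"
    then have z: "zs \<in> colour_lists (length l + length (tile_cod t) + length r)" "xl = take (length l) zs"
      "xr = drop (length l + length (tile_cod t)) zs"
      by (auto simp: L beside_rel_def xl_def xr_def add.assoc)
    let ?zm = "take (length (tile_cod t)) (drop (length l) zs)"
    show eq: "xl @ ?zm @ xr = zs"
      unfolding z(2,3) by (metis add.commute append_take_drop_id drop_drop)
    have "set ?zm \<subseteq> set zs" by (meson order_trans set_drop_subset set_take_subset)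
    then show zm: "?zm \<in> colour_lists (length (tile_cod t))"
      using z(1) by (auto simp: colour_lists_def)
    have "layer_weight L xs zs = tile_weight t (xm @ xr) (?zm @ xr)"
    proof -
      have "layer_weight L xs zs = tile_weight t (drop (length l) xs) (drop (length l) (xl @ ?zm @ xr))"
        using \<open>zs \<in> ?B\<close> by (simp add: layer_weight_def L eq)
      then show ?thesis using len by (simp add: xs)
    qed
    then show "tile_weight t xm ?zm * F (xl @ ?zm @ xr) = layer_weight L xs zs * F zs"
      using tile_weight_append[of xm t ?zm xr xr] len zm by (simp add: eq colour_lists_def)
  next
    fix zm assume zm: "zm \<in> colour_lists (length (tile_cod t))"
    then show "take (length (tile_cod t)) (drop (length l) (xl @ zm @ xr)) = zm"
      using len by (simp add: colour_lists_def)
    show "xl @ zm @ xr \<in> ?B"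
      using zm len X by (auto simp: colour_lists_def L beside_rel_def xs)
  qed
  also have "\<dots> = layer_op L F xs" by (simp add: L tile_op_def xl_def xm_def xr_def)
  finally show ?thesis ..
qed

lemma amplitude_cong:
  assumes "composable us D vs" "xs \<in> colour_lists (length us)"
    and "\<And>zs. zs \<in> colour_lists (length vs) \<Longrightarrow> F zs = G zs"
  shows "amplitude D F xs = amplitude D G xs"
  using assms(1,2)
proof (induction D arbitrary: us xs)
  case Nil
  then show ?case using assms(3) by simp
next
  case (Cons L D)
  then have "amplitude D F zs = amplitude D G zs" if "zs \<in> colour_lists (length (top L))" for zs
    using that by auto
  with Cons.prems show ?case by (simp add: layer_op_eq_sum del: layer_op.simps)
qed

end

locale bracket_diagram = link_diagram D + bracket_colours X U A
  for D and X :: "'c set" and U and A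
begin

sublocale coloured_diagram D X U ..

definition line :: "(point \<Rightarrow> 'c) \<Rightarrow> nat \<Rightarrow> 'c list" where
  "line \<chi> n = map (\<lambda>p. \<chi> (n, p)) [0..<length (strands D n)]"

definition upper_points :: "nat \<Rightarrow> point set" where
  "upper_points j = {z \<in> points D. j \<le> fst z}"

lemma finite_upper_points: "finite (upper_points j)"
  using finite_points by (simp add: upper_points_def)

lemma finite_colour_functions: "finite (upper_points j \<rightarrow>\<^sub>E X)"
  using finite_upper_points finite_X by (simp add: finite_PiE)

lemma line_in_colour_lists:
  "\<chi> \<in> upper_points j \<rightarrow>\<^sub>E X \<Longrightarrow> j \<le> n \<Longrightarrow> line \<chi> n \<in> colour_lists (length (strands D n))"
  by (force simp: line_def colour_lists_def upper_points_def points_eq)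

text \<open>Expanding the product of the transfer operators: the layers from the \<open>j\<close>-th one upwards contribute
  a sum over all ways to colour the points from the \<open>j\<close>-th line upwards.\<close>

lemma amplitude_eq_sum_colour_functions:
  assumes "j \<le> length D" "xs \<in> colour_lists (length (strands D j))"
  shows "amplitude (drop j D) (\<lambda>_. 1) xs =
    (\<Sum>\<chi> | \<chi> \<in> upper_points j \<rightarrow>\<^sub>E X \<and> line \<chi> j = xs.
       \<Prod>n\<in>{j..<length D}. layer_weight (D ! n) (line \<chi> n) (line \<chi> (Suc n)))"
  using assms
proof (induction "length D - j" arbitrary: j xs)
  case 0
  then have j: "j = length D" by simp
  have "upper_points j = {}" by (auto simp: j upper_points_def points_def)
  moreover have "strands D j = []" using j by (simp add: strands_def)
  ultimately have "{\<chi>. \<chi> \<in> upper_points j \<rightarrow>\<^sub>E X \<and> line \<chi> j = xs} = {\<lambda>_. undefined}"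
    using 0 by (auto simp: line_def colour_lists_def)
  then show ?case using j by simp
next
  case (Suc k)
  then have j: "j < length D" by simp
  let ?w = "\<lambda>\<chi> n. layer_weight (D ! n) (line \<chi> n) (line \<chi> (Suc n))"
  let ?P = "\<lambda>j. upper_points j \<rightarrow>\<^sub>E X"
  have drop: "drop j D = D ! j # drop (Suc j) D" using j by (simp add: Cons_nth_drop_Suc)
  have "amplitude (drop j D) (\<lambda>_. 1) xs = (\<Sum>zs\<in>colour_lists (length (strands D (Suc j))).
      layer_weight (D ! j) xs zs * amplitude (drop (Suc j) D) (\<lambda>_. 1) zs)"
    using Suc.prems bottom_eq_strands[OF j] top_eq_strands[OF j]
    by (simp add: drop layer_op_eq_sum del: layer_op.simps)
  also have "\<dots> = (\<Sum>zs\<in>colour_lists (length (strands D (Suc j))). layer_weight (D ! j) xs zs *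
      (\<Sum>\<chi> | \<chi> \<in> ?P (Suc j) \<and> line \<chi> (Suc j) = zs. \<Prod>n\<in>{Suc j..<length D}. ?w \<chi> n))"
    using Suc by (intro sum.cong arg_cong[of _ _ "\<lambda>x. _ * x"]) auto
  also have "\<dots> = (\<Sum>zs\<in>colour_lists (length (strands D (Suc j))).
      \<Sum>\<chi> | \<chi> \<in> ?P (Suc j) \<and> line \<chi> (Suc j) = zs.
         layer_weight (D ! j) xs (line \<chi> (Suc j)) * (\<Prod>n\<in>{Suc j..<length D}. ?w \<chi> n))"
    by (auto simp: sum_distrib_left intro!: sum.cong)
  also have "\<dots> = (\<Sum>\<chi>\<in>?P (Suc j).
      layer_weight (D ! j) xs (line \<chi> (Suc j)) * (\<Prod>n\<in>{Suc j..<length D}. ?w \<chi> n))"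
    using line_in_colour_lists
    by (intro sum.group finite_colour_functions finite_colour_lists) auto
  also have "\<dots> = (\<Sum>\<chi> | \<chi> \<in> ?P j \<and> line \<chi> j = xs. \<Prod>n\<in>{j..<length D}. ?w \<chi> n)"
  proof (rule sum.reindex_bij_witness[of _ "\<lambda>\<chi>. restrict \<chi> (upper_points (Suc j))"
        "\<lambda>\<chi> z. if fst z = j \<and> z \<in> points D then xs ! snd z else \<chi> z"])
    fix \<chi> assume \<chi>: "\<chi> \<in> ?P (Suc j)"
    let ?\<chi> = "\<lambda>z. if fst z = j \<and> z \<in> points D then xs ! snd z else \<chi> z"
    show "restrict ?\<chi> (upper_points (Suc j)) = \<chi>"
      using \<chi> by (auto simp: fun_eq_iff upper_points_def restrict_def PiE_def extensional_def)
    have l: "line ?\<chi> j = xs"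
      using Suc.prems by (auto simp: line_def points_eq colour_lists_def intro!: nth_equalityI)
    have l': "line ?\<chi> n = line \<chi> n" if "n \<ge> Suc j" for n
      using that by (auto simp: line_def)
    have x: "xs ! p \<in> X" if "p < length (strands D j)" for p
      using that Suc.prems(2) by (auto simp: colour_lists_def)
    have "?\<chi> \<in> ?P j"
    proof (intro PiE_I)
      fix z assume z: "z \<in> upper_points j"
      then show "?\<chi> z \<in> X"
        using x[of "snd z"] \<chi> by (cases z) (auto simp: upper_points_def points_eq PiE_def Pi_def)
    next
      fix z assume "z \<notin> upper_points j"
      then show "?\<chi> z = undefined"
        using \<chi> by (cases z) (auto simp: upper_points_def PiE_def extensional_def)
    qed
    with l show "?\<chi> \<in> {\<chi>. \<chi> \<in> ?P j \<and> line \<chi> j = xs}" by simp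
    show "(\<Prod>n\<in>{j..<length D}. ?w ?\<chi> n) =
        layer_weight (D ! j) xs (line \<chi> (Suc j)) * (\<Prod>n\<in>{Suc j..<length D}. ?w \<chi> n)"
      using j l l' by (simp add: prod.atLeast_Suc_lessThan)
  next
    fix \<chi> assume "\<chi> \<in> {\<chi>. \<chi> \<in> ?P j \<and> line \<chi> j = xs}"
    then have \<chi>: "\<chi> \<in> ?P j" "xs = line \<chi> j" by auto
    show "(\<lambda>z. if fst z = j \<and> z \<in> points D then xs ! snd z
        else restrict \<chi> (upper_points (Suc j)) z) = \<chi>"
    proof
      fix z show "(if fst z = j \<and> z \<in> points D then xs ! snd z
        else restrict \<chi> (upper_points (Suc j)) z) = \<chi> z"
      proof (cases "fst z = j \<and> z \<in> points D")
        case True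
        then show ?thesis by (cases z) (auto simp: \<chi>(2) line_def points_eq)
      next
        case False
        then have "z \<in> upper_points (Suc j) \<or> z \<notin> upper_points j \<and> z \<notin> upper_points (Suc j)"
          by (cases z; cases "fst z = j") (auto simp: upper_points_def)
        moreover have "\<chi> z = undefined" if "z \<notin> upper_points j"
          using PiE_arb[OF \<chi>(1) that] .
        ultimately show ?thesis unfolding if_not_P[OF False] restrict_apply by presburger
      qed
    qed
    show "restrict \<chi> (upper_points (Suc j)) \<in> ?P (Suc j)"
      unfolding restrict_PiE_iff using PiE_mem[OF \<chi>(1)] by (simp add: upper_points_def)
  qed
  finally show ?case .
qed

text \<open>The rule for a colouring is a condition on each layer separately.\<close>

lemma colouring_iff_tile_rel:
  assumes "\<chi> \<in> points D \<rightarrow>\<^sub>E X"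
  shows "\<chi> \<in> colourings S (points D) \<longleftrightarrow> (\<forall>n<length D. beside_rel (D ! n) (line \<chi> n) (line \<chi> (Suc n)) \<and>
    tile_rel (n \<in> S) (tile_of (D ! n)) (drop (left_width (D ! n)) (line \<chi> n))
      (drop (left_width (D ! n)) (line \<chi> (Suc n))))"
proof -
  have "\<chi> \<in> colourings S (points D) \<longleftrightarrow>
      (\<forall>x\<in>dpoints. \<chi> (fst (step D S x)) = U (holonomy D x) (\<chi> (fst x)))"
    using assms by (auto simp: colourings_def dpoints_iff)
  also have "\<dots> \<longleftrightarrow> (\<forall>n<length D. \<forall>x. enters n (D ! n) x \<longrightarrow>
      \<chi> (fst (step D S x)) = U (holonomy D x) (\<chi> (fst x)))"
    using dpoint_enters enters_dpoint by metis
  also have "\<dots> \<longleftrightarrow> (\<forall>n<length D. beside_rel (D ! n) (line \<chi> n) (line \<chi> (Suc n)) \<and>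
    tile_rel (n \<in> S) (tile_of (D ! n)) (drop (left_width (D ! n)) (line \<chi> n))
      (drop (left_width (D ! n)) (line \<chi> (Suc n))))"
  proof (intro all_cong)
    fix n assume n: "n < length D"
    obtain l t r where L: "D ! n = (l, t, r)" by (cases "D ! n")
    have s: "strands D n = l @ tile_dom t @ r" "strands D (Suc n) = l @ tile_cod t @ r"
      using bottom_eq_strands[OF n] top_eq_strands[OF n] L by auto
    have \<chi>_X: "p < length (strands D m) \<Longrightarrow> \<chi> (m, p) \<in> X" for m p
      using assms by (auto simp: points_eq)
    let ?ok = "\<lambda>x. \<chi> (fst (step D S x)) = U (holonomy D x) (\<chi> (fst x))"
    let ?i = "length l" let ?d = "length (tile_dom t)" let ?c = "length (tile_cod t)"
    note beside = step_beside[OF L] entered_corner_beside[OF L]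
    have 1: "?ok ((n, p), Up) \<longleftrightarrow> \<chi> (Suc n, p) = \<chi> (n, p)"
      "?ok ((Suc n, p), Down) \<longleftrightarrow> \<chi> (n, p) = \<chi> (Suc n, p)" if "p < ?i" for p
      using that beside U_zero[OF \<chi>_X, of p n] U_zero[OF \<chi>_X, of p "Suc n"] s
      by (auto simp: holonomy_def)
    have 2: "?ok ((n, ?i + ?d + q), Up) \<longleftrightarrow> \<chi> (Suc n, ?i + ?c + q) = \<chi> (n, ?i + ?d + q)"
      "?ok ((Suc n, ?i + ?c + q), Down) \<longleftrightarrow> \<chi> (n, ?i + ?d + q) = \<chi> (Suc n, ?i + ?c + q)"
      if "q < length r" for q
      using that beside(3,4,7,8) U_zero[OF \<chi>_X, of "?i + ?d + q" n] U_zero[OF \<chi>_X, of "?i + ?c + q" "Suc n"] s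
      by (auto simp: holonomy_def)
    let ?xs = "drop ?i (line \<chi> n)" and ?zs = "drop ?i (line \<chi> (Suc n))"
    have cc: "\<chi> (fst (enter_corner n ?i c)) = corner_colour ?xs ?zs c" if "c \<in> corners t" for c
      using that s by (cases t; cases c) (auto simp: line_def simp del: upt_Suc)
    have "\<chi> (fst (leave_corner n ?i c)) = \<chi> (fst (enter_corner n ?i c))" for c
      by (cases c) auto
    then have 3: "?ok (enter_corner n ?i c) \<longleftrightarrow>
        corner_colour ?xs ?zs (exit_corner (n \<in> S) t c) = U (tile_holonomy t c) (corner_colour ?xs ?zs c)"
      if "c \<in> corners t" for c
      using step_corner[OF L that, of S] entered_corner_enter_corner[OF L that] L
        cc[OF that] cc[OF exit_corner_in_corners[OF that, of "n \<in> S"]]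
      by (simp add: holonomy_def)
    have "(\<forall>x. enters n (l, t, r) x \<longrightarrow> ?ok x) \<longleftrightarrow>
       (\<forall>p<?i. \<chi> (Suc n, p) = \<chi> (n, p)) \<and>
       (\<forall>q<length r. \<chi> (Suc n, ?i + ?c + q) = \<chi> (n, ?i + ?d + q)) \<and>
       (\<forall>c\<in>corners t. ?ok (enter_corner n ?i c))" (is "?l \<longleftrightarrow> ?r")
    proof
      assume l: ?l
      have "\<forall>p<?i. \<chi> (Suc n, p) = \<chi> (n, p)" using l 1 left_up by blast
      moreover have "\<forall>q<length r. \<chi> (Suc n, ?i + ?c + q) = \<chi> (n, ?i + ?d + q)"
        using l 2 right_up by blast
      ultimately show ?r using l corner by blast
    next
      assume r: ?r
      show ?l
      proof (intro allI impI)
        fix x assume "enters n (l, t, r) x"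
        then show "?ok x"
        proof (cases rule: enters.cases)
          case (left_up p)
          then have p: "p < ?i" by simp
          show ?thesis using r p 1(1)[OF p] unfolding left_up by simp
        next
          case (left_down p)
          then have p: "p < ?i" by simp
          show ?thesis using r p 1(2)[OF p] unfolding left_down by simp
        next
          case (right_up q)
          then have q: "q < length r" by simp
          show ?thesis using r q 2(1)[OF q] right_up by simp
        next
          case (right_down q)
          then have q: "q < length r" by simp
          show ?thesis using r q 2(2)[OF q] right_down by simp
        next
          case (corner c)
          then show ?thesis using r by simp
        qed
      qed
    qed
    also have "(\<forall>c\<in>corners t. ?ok (enter_corner n ?i c)) \<longleftrightarrow> tile_rel (n \<in> S) t ?xs ?zs"
      using 3 by (auto simp: tile_rel_def)
    also have "(\<forall>p<?i. \<chi> (Suc n, p) = \<chi> (n, p)) \<longleftrightarrow>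
        take ?i (line \<chi> n) = take ?i (line \<chi> (Suc n))"
    proof -
      have "take ?i (line \<chi> m) = map (\<lambda>p. \<chi> (m, p)) [0..<0 + ?i]" if "m = n \<or> m = Suc n" for m
        using that s by (auto simp: line_def take_map simp del: upt_Suc)
      then show ?thesis using map_upt_eq_iff[of "\<lambda>p. \<chi> (n, p)" 0 ?i "\<lambda>p. \<chi> (Suc n, p)" 0] by auto
    qed
    also have "(\<forall>q<length r. \<chi> (Suc n, ?i + ?c + q) = \<chi> (n, ?i + ?d + q)) \<longleftrightarrow>
        drop (?i + ?d) (line \<chi> n) = drop (?i + ?c) (line \<chi> (Suc n))"
    proof -
      have "drop (?i + ?d) (line \<chi> n) = map (\<lambda>p. \<chi> (n, p)) [?i + ?d..<?i + ?d + length r]"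
        "drop (?i + ?c) (line \<chi> (Suc n)) = map (\<lambda>p. \<chi> (Suc n, p)) [?i + ?c..<?i + ?c + length r]"
        using s by (simp_all add: line_def drop_map add.assoc del: upt_Suc)
      then show ?thesis
        using map_upt_eq_iff[of "\<lambda>p. \<chi> (n, p)" "?i + ?d" "length r" "\<lambda>p. \<chi> (Suc n, p)" "?i + ?c"]
        by auto
    qed
    finally show "(\<forall>x. enters n (D ! n) x \<longrightarrow> ?ok x) \<longleftrightarrow>
      beside_rel (D ! n) (line \<chi> n) (line \<chi> (Suc n)) \<and>
      tile_rel (n \<in> S) (tile_of (D ! n)) (drop (left_width (D ! n)) (line \<chi> n))
      (drop (left_width (D ! n)) (line \<chi> (Suc n)))"
      by (simp add: L beside_rel_def conj_assoc)
  qed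
  finally show ?thesis .
qed

text \<open>The weight of a layer with a classical crossing is a sum over its two smoothings; expanding the
  product over these layers gives the sum over all states.\<close>

theorem amplitude_eq_state_sum:
  "amplitude D (\<lambda>_. 1) [] = (\<Sum>S\<in>states D.
     (\<Prod>n\<in>classical_crossings D. smoothing_weight (n \<in> S) (tile_of (D ! n))) *
     of_nat (card (colourings S (points D))))"
proof -
  let ?N = "{0..<length D}" and ?C = "classical_crossings D"
  let ?P = "points D \<rightarrow>\<^sub>E X"
  let ?w = "\<lambda>b n. smoothing_weight b (tile_of (D ! n))"
  define B where "B \<chi> n \<longleftrightarrow> beside_rel (D ! n) (line \<chi> n) (line \<chi> (Suc n))" for \<chi> n
  define T where "T \<chi> b n \<longleftrightarrow> tile_rel b (tile_of (D ! n)) (drop (left_width (D ! n)) (line \<chi> n))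
      (drop (left_width (D ! n)) (line \<chi> (Suc n)))" for \<chi> b n
  have C: "?C \<subseteq> ?N" "finite ?C" by (auto simp: classical_crossings_def)
  have fin: "finite ?P" using finite_points finite_X by (simp add: finite_PiE)
  have prod_eq: "(\<Prod>n\<in>?N. layer_weight (D ! n) (line \<chi> n) (line \<chi> (Suc n))) =
      (\<Sum>S\<in>Pow ?C. (\<Prod>n\<in>?C. ?w (n \<in> S) n) * of_bool (\<forall>n\<in>?N. B \<chi> n \<and> T \<chi> (n \<in> S) n))" for \<chi>
  proof -
    have "(\<Prod>n\<in>?N. layer_weight (D ! n) (line \<chi> n) (line \<chi> (Suc n))) =
        (\<Prod>n\<in>?N - ?C. of_bool (B \<chi> n \<and> T \<chi> False n)) *
        (\<Prod>n\<in>?C. ?w True n * of_bool (B \<chi> n \<and> T \<chi> True n) + ?w False n * of_bool (B \<chi> n \<and> T \<chi> False n))"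
      by (subst prod.subset_diff[OF C(1)])
        (auto intro!: arg_cong2[of _ _ _ _ "(*)"] prod.cong
          simp: layer_weight_def tile_weight_def classical_crossings_def B_def T_def
            of_bool_conj)
    also have "\<dots> = (\<Prod>n\<in>?N - ?C. of_bool (B \<chi> n \<and> T \<chi> False n)) *
        (\<Sum>S\<in>Pow ?C. (\<Prod>n\<in>S. ?w True n * of_bool (B \<chi> n \<and> T \<chi> True n)) *
          (\<Prod>n\<in>?C - S. ?w False n * of_bool (B \<chi> n \<and> T \<chi> False n)))"
      by (subst prod_add) (use C in auto)
    also have "\<dots> = (\<Sum>S\<in>Pow ?C. (\<Prod>n\<in>?C. ?w (n \<in> S) n) * of_bool (\<forall>n\<in>?N. B \<chi> n \<and> T \<chi> (n \<in> S) n))"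
      unfolding sum_distrib_left
    proof (rule sum.cong[OF refl])
      fix S assume "S \<in> Pow ?C"
      then have S: "S \<subseteq> ?C" by simp
      have "(\<Prod>n\<in>S. ?w True n * of_bool (B \<chi> n \<and> T \<chi> True n)) *
          (\<Prod>n\<in>?C - S. ?w False n * of_bool (B \<chi> n \<and> T \<chi> False n)) =
          (\<Prod>n\<in>?C. ?w (n \<in> S) n * of_bool (B \<chi> n \<and> T \<chi> (n \<in> S) n))"
      proof -
        have "(\<Prod>n\<in>S. ?w True n * of_bool (B \<chi> n \<and> T \<chi> True n)) =
            (\<Prod>n\<in>S. ?w (n \<in> S) n * of_bool (B \<chi> n \<and> T \<chi> (n \<in> S) n))"
          "(\<Prod>n\<in>?C - S. ?w False n * of_bool (B \<chi> n \<and> T \<chi> False n)) =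
            (\<Prod>n\<in>?C - S. ?w (n \<in> S) n * of_bool (B \<chi> n \<and> T \<chi> (n \<in> S) n))"
          by (rule prod.cong; simp)+
        then show ?thesis by (subst prod.subset_diff[OF S C(2)]) (simp only: mult.commute)
      qed
      also have "\<dots> = (\<Prod>n\<in>?C. ?w (n \<in> S) n) * (\<Prod>n\<in>?C. of_bool (B \<chi> n \<and> T \<chi> (n \<in> S) n))"
        by (rule prod.distrib)
      finally have *: "(\<Prod>n\<in>S. ?w True n * of_bool (B \<chi> n \<and> T \<chi> True n)) *
          (\<Prod>n\<in>?C - S. ?w False n * of_bool (B \<chi> n \<and> T \<chi> False n)) = \<dots>" .
      have "(\<Prod>n\<in>?N - ?C. of_bool (B \<chi> n \<and> T \<chi> False n)) =
          (\<Prod>n\<in>?N - ?C. of_bool (B \<chi> n \<and> T \<chi> (n \<in> S) n) :: complex)"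
      proof (rule prod.cong[OF refl])
        fix n assume "n \<in> ?N - ?C"
        then have "n \<notin> S" using S by blast
        then show "of_bool (B \<chi> n \<and> T \<chi> False n) = (of_bool (B \<chi> n \<and> T \<chi> (n \<in> S) n) :: complex)"
          by simp
      qed
      then have "(\<Prod>n\<in>?N - ?C. of_bool (B \<chi> n \<and> T \<chi> False n)) *
          (\<Prod>n\<in>?C. of_bool (B \<chi> n \<and> T \<chi> (n \<in> S) n)) =
          (\<Prod>n\<in>?N. of_bool (B \<chi> n \<and> T \<chi> (n \<in> S) n) :: complex)"
        by (simp add: prod.subset_diff[OF C(1)])
      also have "\<dots> = of_bool (\<forall>n\<in>?N. B \<chi> n \<and> T \<chi> (n \<in> S) n)"
      proof (cases "\<forall>n\<in>?N. B \<chi> n \<and> T \<chi> (n \<in> S) n")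
        case True
        then have "(\<Prod>n\<in>?N. of_bool (B \<chi> n \<and> T \<chi> (n \<in> S) n) :: complex) = (\<Prod>n\<in>?N. 1)"
          by (intro prod.cong) auto
        with True show ?thesis by simp
      next
        case False
        then obtain n where "n \<in> ?N" "\<not> (B \<chi> n \<and> T \<chi> (n \<in> S) n)" by blast
        then have "(\<Prod>n\<in>?N. of_bool (B \<chi> n \<and> T \<chi> (n \<in> S) n) :: complex) = 0"
          by (intro prod_zero) auto
        with False show ?thesis by (simp only: of_bool_eq)
      qed
      finally have **: "(\<Prod>n\<in>?N - ?C. of_bool (B \<chi> n \<and> T \<chi> False n)) *
          (\<Prod>n\<in>?C. of_bool (B \<chi> n \<and> T \<chi> (n \<in> S) n)) =
          (of_bool (\<forall>n\<in>?N. B \<chi> n \<and> T \<chi> (n \<in> S) n) :: complex)" .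
      show "(\<Prod>n\<in>?N - ?C. of_bool (B \<chi> n \<and> T \<chi> False n)) *
          ((\<Prod>n\<in>S. ?w True n * of_bool (B \<chi> n \<and> T \<chi> True n)) *
          (\<Prod>n\<in>?C - S. ?w False n * of_bool (B \<chi> n \<and> T \<chi> False n))) =
          (\<Prod>n\<in>?C. ?w (n \<in> S) n) * of_bool (\<forall>n\<in>?N. B \<chi> n \<and> T \<chi> (n \<in> S) n)"
        unfolding * **[symmetric] by (simp only: mult_ac)
    qed
    finally show ?thesis .
  qed
  have "upper_points 0 = points D" by (simp add: upper_points_def)
  then have "amplitude D (\<lambda>_. 1) [] =
      (\<Sum>\<chi>\<in>?P. \<Prod>n\<in>?N. layer_weight (D ! n) (line \<chi> n) (line \<chi> (Suc n)))"
    using amplitude_eq_sum_colour_functions[of 0 "[]"] by (simp add: colour_lists_def line_def)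
  also have "\<dots> = (\<Sum>S\<in>Pow ?C. \<Sum>\<chi>\<in>?P.
      (\<Prod>n\<in>?C. ?w (n \<in> S) n) * of_bool (\<forall>n\<in>?N. B \<chi> n \<and> T \<chi> (n \<in> S) n))"
    unfolding prod_eq by (rule sum.swap)
  also have "\<dots> = (\<Sum>S\<in>states D. (\<Prod>n\<in>?C. ?w (n \<in> S) n) * of_nat (card (colourings S (points D))))"
    unfolding states_def
  proof (intro sum.cong refl)
    fix S
    have "colourings S (points D) = {\<chi> \<in> ?P. \<forall>n\<in>?N. B \<chi> n \<and> T \<chi> (n \<in> S) n}"
    proof (rule set_eqI)
      fix \<chi>
      have "\<chi> \<in> ?P" if "\<chi> \<in> colourings S (points D)" using that by (simp add: colourings_def)
      then show "\<chi> \<in> colourings S (points D) \<longleftrightarrow> \<chi> \<in> {\<chi> \<in> ?P. \<forall>n\<in>?N. B \<chi> n \<and> T \<chi> (n \<in> S) n}"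
      proof (cases "\<chi> \<in> ?P")
        case True
        have ball: "(\<forall>n\<in>?N. P n) \<longleftrightarrow> (\<forall>n<length D. P n)" for P by auto
        show ?thesis
          unfolding colouring_iff_tile_rel[OF True] mem_Collect_eq B_def T_def ball
          by (simp only: True simp_thms)
      next
        case False
        then show ?thesis using \<open>\<chi> \<in> colourings S (points D) \<Longrightarrow> \<chi> \<in> ?P\<close> by blast
      qed
    qed
    then have "(\<Sum>\<chi>\<in>?P. of_bool (\<forall>n\<in>?N. B \<chi> n \<and> T \<chi> (n \<in> S) n)) =
        (of_nat (card (colourings S (points D))) :: complex)"
      by (rule sum_of_bool_eq_card[OF fin])
    then show "(\<Sum>\<chi>\<in>?P. (\<Prod>n\<in>?C. ?w (n \<in> S) n) * of_bool (\<forall>n\<in>?N. B \<chi> n \<and> T \<chi> (n \<in> S) n)) =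
        (\<Prod>n\<in>?C. ?w (n \<in> S) n) * of_nat (card (colourings S (points D)))"
      by (simp only: sum_distrib_left[symmetric])
  qed
  finally show ?thesis .
qed

end


section \<open>Invariance of the amplitude under the moves\<close>

context bracket_colours
begin

lemma colour_lists_0: "colour_lists 0 = {[]}"
  by (auto simp: colour_lists_def)

lemma colour_lists_Suc: "colour_lists (Suc n) = (\<lambda>(x, xs). x # xs) ` (X \<times> colour_lists n)"
proof (rule set_eqI)
  fix xs show "xs \<in> colour_lists (Suc n) \<longleftrightarrow> xs \<in> (\<lambda>(x, xs). x # xs) ` (X \<times> colour_lists n)"
    by (cases xs) (auto simp: colour_lists_def image_iff)
qed

lemma sum_colour_lists_Suc:
  "(\<Sum>xs\<in>colour_lists (Suc n). F xs) = (\<Sum>x\<in>X. \<Sum>xs\<in>colour_lists n. F (x # xs))"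
  unfolding colour_lists_Suc sum.cartesian_product
  by (subst sum.reindex) (auto simp: inj_on_def intro!: sum.cong)

lemma sum_colour_pairs: "(\<Sum>xs\<in>colour_lists 2. F xs) = (\<Sum>x\<in>X. \<Sum>y\<in>X. F [x, y])"
  by (simp add: numeral_2_eq_2 sum_colour_lists_Suc colour_lists_0)

lemma sum_delta_pair:
  assumes "u \<in> X" "v \<in> X"
  shows "(\<Sum>x\<in>X. \<Sum>y\<in>X. of_bool (x = u \<and> y = v) * F x y) = (F u v :: complex)"
proof -
  have "(\<Sum>x\<in>X. \<Sum>y\<in>X. of_bool (x = u \<and> y = v) * F x y) =
      (\<Sum>x\<in>X. if x = u then \<Sum>y\<in>X. if y = v then F x y else 0 else 0)"
    by (intro sum.cong refl) (auto intro!: sum.cong)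
  also have "\<dots> = F u v" using assms finite_X by simp
  finally show ?thesis .
qed

lemma sum_delta_diagonal:
  "(\<Sum>x\<in>X. \<Sum>y\<in>X. of_bool (y = x) * F x y) = (\<Sum>x\<in>X. F x x :: complex)"
proof (intro sum.cong refl)
  fix x assume "x \<in> X"
  have "(\<Sum>y\<in>X. of_bool (y = x) * F x y) = (\<Sum>y\<in>X. if y = x then F x y else 0)"
    by (intro sum.cong) auto
  then show "(\<Sum>y\<in>X. of_bool (y = x) * F x y) = F x x" using \<open>x \<in> X\<close> finite_X by simp
qed

lemma U_inject: "x \<in> X \<Longrightarrow> y \<in> X \<Longrightarrow> U m x = U m y \<longleftrightarrow> x = y"
  by (metis U_inverse(1))

lemma sum_U: "(\<Sum>y\<in>X. F (U m y)) = (\<Sum>y\<in>X. F y)"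
  by (rule sum.reindex_bij_witness[of _ "U (- m)" "U m"]) (auto simp: U_inverse U_closed)

text \<open>The coefficients of the vertical and the horizontal smoothing.  In terms of these the orientation
  disappears: it decides both the sign of the crossing and which smoothing is the oriented one.\<close>

definition kauffman_weights :: "crossing_kind \<Rightarrow> complex \<times> complex" where
  "kauffman_weights k = (if k = Over then (A, inverse A) else (inverse A, A))"

abbreviation vertical_weight :: "crossing_kind \<Rightarrow> complex" where
  "vertical_weight k \<equiv> fst (kauffman_weights k)"

abbreviation horizontal_weight :: "crossing_kind \<Rightarrow> complex" where
  "horizontal_weight k \<equiv> snd (kauffman_weights k)"

lemma tile_op_Cup: "tile_op (Cup c) F [] = (\<Sum>y\<in>X. F [y, y])"
proof -
  have "tile_weight (Cup c) [] [x, y] = of_bool (y = x)" if "x \<in> X" "y \<in> X" for x y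
    using that U_zero by (auto simp: tile_weight_def tile_rel_def exit_corner_def)
  then have "tile_op (Cup c) F [] = (\<Sum>x\<in>X. \<Sum>y\<in>X. of_bool (y = x) * F [x, y])"
    by (auto simp: tile_op_def sum_colour_pairs[unfolded numeral_2_eq_2] intro!: sum.cong)
  then show ?thesis by (simp only: sum_delta_diagonal)
qed

lemma tile_op_Cap:
  "x \<in> X \<Longrightarrow> y \<in> X \<Longrightarrow> tile_op (Cap c) F [x, y] = (if x = y then F [] else 0)"
  using U_zero
  by (auto simp: tile_op_def tile_weight_def tile_rel_def exit_corner_def colour_lists_0)

lemma tile_op_virtual:
  assumes "x \<in> X" "y \<in> X"
  shows "tile_op (Cross Virtual a b) F [x, y] = F [U (dsign a) y, U (- dsign b) x]"
proof -
  have "tile_weight (Cross Virtual a b) [x, y] [u, v] =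
      of_bool (u = U (dsign a) y \<and> v = U (- dsign b) x)" if "u \<in> X" "v \<in> X" for u v
    using that assms U_inverse
    by (auto simp: tile_weight_def tile_rel_def exit_corner_def UNIV_corner)
  then have "tile_op (Cross Virtual a b) F [x, y] =
     (\<Sum>u\<in>X. \<Sum>v\<in>X. of_bool (u = U (dsign a) y \<and> v = U (- dsign b) x) * F [u, v])"
    by (auto simp: tile_op_def sum_colour_pairs[unfolded numeral_2_eq_2] intro!: sum.cong)
  then show ?thesis using assms U_closed by (simp add: sum_delta_pair)
qed

lemma tile_op_classical:
  assumes "x \<in> X" "y \<in> X" "k \<noteq> Virtual"
  shows "tile_op (Cross k a b) F [x, y] = vertical_weight k * F [x, y] +
    horizontal_weight k * (if x = y then \<Sum>z\<in>X. F [z, z] else 0)"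
proof -
  let ?t = "Cross k a b"
  have hol: "tile_holonomy ?t c = 0" for c using assms(3) by (cases k) auto
  have rel: "tile_rel d ?t [x, y] [u, v] \<longleftrightarrow>
      (if d \<longleftrightarrow> a = b then x = y \<and> u = v else u = x \<and> v = y)" if "u \<in> X" "v \<in> X" for d u v
    using that assms U_zero by (auto simp: tile_rel_def exit_corner_def UNIV_corner hol)
  have w: "smoothing_weight d ?t = (if d \<longleftrightarrow> a = b then horizontal_weight k else vertical_weight k)" for d
    using assms(3) by (cases k) (auto simp: smoothing_weight_def kauffman_weights_def)
  have "tile_weight ?t [x, y] [u, v] = vertical_weight k * of_bool (u = x \<and> v = y) +
      horizontal_weight k * of_bool (x = y) * of_bool (v = u)" if "u \<in> X" "v \<in> X" for u v
  proof -
    have "classical_tile ?t" using assms(3) by simp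
    then show ?thesis
      unfolding tile_weight_def rel[OF that] w by (cases "a = b"; cases "x = y") auto
  qed
  then have "tile_op ?t F [x, y] = (\<Sum>u\<in>X. \<Sum>v\<in>X.
      vertical_weight k * (of_bool (u = x \<and> v = y) * F [u, v]) +
      horizontal_weight k * of_bool (x = y) * (of_bool (v = u) * F [u, v]))"
    by (auto simp: tile_op_def sum_colour_pairs[unfolded numeral_2_eq_2] algebra_simps intro!: sum.cong)
  also have "\<dots> = vertical_weight k * F [x, y] + horizontal_weight k * of_bool (x = y) * (\<Sum>z\<in>X. F [z, z])"
    by (simp only: sum.distrib sum_distrib_left[symmetric] sum_delta_pair[OF assms(1,2)] sum_delta_diagonal)
  finally show ?thesis by simp
qed

lemma tile_op_scale: "tile_op t (\<lambda>xs. s * F xs) xs = s * tile_op t F xs"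
  by (simp add: tile_op_def sum_distrib_left mult.left_commute)

lemma amplitude_scale: "amplitude D (\<lambda>xs. s * F xs) = (\<lambda>xs. s * amplitude D F xs)"
proof (induction D)
  case (Cons L D)
  obtain l t r where "L = (l, t, r)" by (cases L)
  with Cons show ?case by (simp add: tile_op_scale)
qed simp

lemma amplitude_add_strands:
  assumes "composable us D vs" "length xl = length l" "length xm = length us"
    "set xm \<subseteq> X"
  shows "amplitude (add_strands l r D) F (xl @ xm @ xr) = amplitude D (\<lambda>zs. F (xl @ zs @ xr)) xm"
  using assms(1,3,4)
proof (induction D arbitrary: us xm)
  case Nil
  then show ?case by (simp add: add_strands_def)
next
  case (Cons L D)
  obtain l' t r' where L: "L = (l', t, r')" by (cases L)
  have add: "add_strands l r (L # D) = (l @ l', t, r' @ r) # add_strands l r D"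
    by (simp add: add_strands_def L)
  have comp: "composable (l' @ tile_cod t @ r') D vs" and len: "length xm = length l' + length (tile_dom t) + length r'"
    using Cons.prems L by auto
  let ?xs = "\<lambda>zs. take (length l') xm @ zs @ drop (length l' + length (tile_dom t)) xm"
  have *: "amplitude (add_strands l r D) F (xl @ ?xs zs @ xr) = amplitude D (\<lambda>zs. F (xl @ zs @ xr)) (?xs zs)"
    if "zs \<in> colour_lists (length (tile_cod t))" for zs
  proof (rule Cons.IH[OF comp])
    show "length (?xs zs) = length (l' @ tile_cod t @ r')" using that len by (simp add: colour_lists_def)
    show "set (?xs zs) \<subseteq> X"
      using that Cons.prems(3) set_take_subset[of "length l'" xm] set_drop_subset[of "length l' + length (tile_dom t)" xm]
      by (auto simp: colour_lists_def)
  qed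
  then show ?case
    unfolding add using len assms(2) by (simp add: L tile_op_def)
qed

text \<open>This is the invariance under exchanging the heights of two events.\<close>

lemma tile_op_exchange:
  "tile_op s (\<lambda>zs. tile_op t (\<lambda>ws. F zs ws) ys) xs = tile_op t (\<lambda>ws. tile_op s (\<lambda>zs. F zs ws) xs) ys"
  unfolding tile_op_def sum_distrib_left by (subst sum.swap) (simp add: mult_ac)

text \<open>The generators of the Temperley-Lieb algebra on three strands, which are the horizontal smoothings
  of the two left and of the two right strands.\<close>

definition E1 :: "('c \<Rightarrow> 'c \<Rightarrow> 'c \<Rightarrow> complex) \<Rightarrow> 'c \<Rightarrow> 'c \<Rightarrow> 'c \<Rightarrow> complex" where
  "E1 F p q r = (if p = q then \<Sum>w\<in>X. F w w r else 0)"

definition E2 :: "('c \<Rightarrow> 'c \<Rightarrow> 'c \<Rightarrow> complex) \<Rightarrow> 'c \<Rightarrow> 'c \<Rightarrow> 'c \<Rightarrow> complex" where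
  "E2 F p q r = (if q = r then \<Sum>w\<in>X. F p w w else 0)"

lemma E1_E1: "E1 (E1 F) p q r = of_nat (card X) * E1 F p q r"
  by (simp add: E1_def)

lemma E2_E2: "E2 (E2 F) p q r = of_nat (card X) * E2 F p q r"
  by (simp add: E2_def)

lemma E1_E2_E1: "r \<in> X \<Longrightarrow> E1 (E2 (E1 F)) p q r = E1 F p q r"
  using finite_X by (simp add: E1_def E2_def)

lemma E2_E1_E2: "p \<in> X \<Longrightarrow> E2 (E1 (E2 F)) p q r = E2 F p q r"
  using finite_X by (simp add: E1_def E2_def)

lemma E1_linear:
  "E1 (\<lambda>p q r. a * F p q r + b * G p q r) = (\<lambda>p q r. a * E1 F p q r + b * E1 G p q r)"
  by (auto simp: E1_def fun_eq_iff sum.distrib sum_distrib_left)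

lemma E2_linear:
  "E2 (\<lambda>p q r. a * F p q r + b * G p q r) = (\<lambda>p q r. a * E2 F p q r + b * E2 G p q r)"
  by (auto simp: E2_def fun_eq_iff sum.distrib sum_distrib_left)

text \<open>After expansion into the Temperley-Lieb algebra, the two sides of the third move differ only in the
  coefficients of the two generators; this identity makes them agree.\<close>

lemma kauffman_weights_III:
  assumes "x \<noteq> Virtual" "y \<noteq> Virtual" "z \<noteq> Virtual" "\<not> (x = z \<and> x \<noteq> y)"
  shows "horizontal_weight x * vertical_weight y * vertical_weight z +
    vertical_weight x * vertical_weight y * horizontal_weight z +
    horizontal_weight x * vertical_weight y * horizontal_weight z * of_nat (card X) +
    horizontal_weight x * horizontal_weight y * horizontal_weight z =
    vertical_weight x * horizontal_weight y * vertical_weight z"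
  using assms A_nonzero
  by (cases x; cases y; cases z) (simp_all add: kauffman_weights_def card_X field_simps power2_eq_square)

lemma vertical_horizontal: "vertical_weight k * horizontal_weight k = 1"
  using A_nonzero by (simp add: kauffman_weights_def)

lemma kauffman_weights_II:
  assumes "k \<noteq> Virtual"
  shows "vertical_weight k * vertical_weight k + horizontal_weight k * horizontal_weight k +
    of_nat (card X) = 0"
  using A_nonzero by (simp add: kauffman_weights_def card_X field_simps power2_eq_square)


text \<open>The boundary lines are quantified existentially; they are determined by the diagrams unless both
  diagrams are empty.\<close>

definition proportional :: "complex \<Rightarrow> diagram \<Rightarrow> diagram \<Rightarrow> bool" where
  "proportional s D E \<longleftrightarrow> (\<exists>us vs. composable us D vs \<and> composable us E vs \<and>
     (\<forall>F. \<forall>xs\<in>colour_lists (length us). amplitude D F xs = s * amplitude E F xs))"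

lemma colour_lists_2: "colour_lists (Suc (Suc 0)) = {[p, q] | p q. p \<in> X \<and> q \<in> X}"
  by (auto simp: colour_lists_Suc colour_lists_0)

lemma colour_lists_3: "colour_lists (Suc (Suc (Suc 0))) = {[p, q, r] | p q r. p \<in> X \<and> q \<in> X \<and> r \<in> X}"
  by (auto simp: colour_lists_Suc colour_lists_0)

lemma colour_lists_1: "colour_lists (Suc 0) = {[p] | p. p \<in> X}"
  by (auto simp: colour_lists_Suc colour_lists_0)

lemmas tile_ops = tile_op_Cup tile_op_Cap tile_op_virtual tile_op_classical

lemma U_commute: "c \<in> X \<Longrightarrow> U m (U n c) = U n (U m c)"
  by (metis U_add add.commute)

text \<open>Sliding a crossing over a minimum or a maximum exchanges its two smoothings, and so does flipping its
  kind.  For a virtual crossing the colour of the minimum has to be shifted, which is possible because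
  it is summed over.\<close>

lemma planar_isotopy_proportional:
  assumes "planar_isotopy U' V"
  shows "proportional 1 U' V"
  using assms
proof (cases rule: planar_isotopy.cases)
  case (exchange s m t)
  have "amplitude U' F xs = amplitude V F xs"
    if xs: "xs \<in> colour_lists (length (tile_dom s @ m @ tile_dom t))" for F xs
  proof -
    let ?s = "length (tile_dom s)" and ?t = "length (tile_dom t)"
    define xl xm xr where "xl = take ?s xs" and "xm = take (length m) (drop ?s xs)"
      and "xr = drop (length m) (drop ?s xs)"
    have xs': "xs = xl @ xm @ xr" unfolding xl_def xm_def xr_def by (metis append_take_drop_id)
    have len: "length xl = ?s" "length xm = length m" "length xr = ?t"
      using xs by (auto simp: xl_def xm_def xr_def colour_lists_def)
    have "amplitude U' F xs = tile_op s (\<lambda>zs. tile_op t (\<lambda>ws. F (zs @ xm @ ws)) xr) xl"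
      using len by (simp add: exchange xs' tile_op_def[of s] colour_lists_def)
    also have "\<dots> = tile_op t (\<lambda>ws. tile_op s (\<lambda>zs. F (zs @ xm @ ws)) xl) xr"
      by (rule tile_op_exchange)
    also have "\<dots> = amplitude V F xs"
      using len by (simp add: exchange xs')
    finally show ?thesis .
  qed
  then show ?thesis unfolding proportional_def
    by (intro exI[of _ "tile_dom s @ m @ tile_dom t"] exI[of _ "tile_cod s @ m @ tile_cod t"])
      (simp add: exchange)
next
  case (zigzag_right c)
  show ?thesis unfolding proportional_def
    by (intro exI[of _ "[c]"])
      (use finite_X in \<open>auto simp: zigzag_right colour_lists_1 tile_ops cong: sum.cong\<close>)
next
  case (zigzag_left c)
  show ?thesis unfolding proportional_def
    by (intro exI[of _ "[c]"])
      (use finite_X in \<open>auto simp: zigzag_left colour_lists_1 tile_ops cong: sum.cong\<close>)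
next
  case (slide_cup c e k)
  have "amplitude U' F [p] = amplitude V F [p]" if p: "p \<in> X" for F p
  proof (cases "k = Virtual")
    case True
    have "(\<Sum>y\<in>X. F [y, U (- dsign c) p, U (- dsign e) y]) = (\<Sum>y\<in>X. F [U (dsign e) y, U (- dsign c) p, y])"
      using sum_U[of "\<lambda>y. F [y, U (- dsign c) p, U (- dsign e) y]" "dsign e"] U_inverse
      by (simp cong: sum.cong)
    then show ?thesis using p by (simp add: slide_cup True tile_ops cong: sum.cong)
  next
    case False
    then have "flip k \<noteq> Virtual" "vertical_weight (flip k) = horizontal_weight k"
      "horizontal_weight (flip k) = vertical_weight k"
      by (cases k; simp add: kauffman_weights_def)+
    then show ?thesis using p False finite_X
      by (simp add: slide_cup tile_ops sum.distrib flip: sum_distrib_left cong: sum.cong)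
  qed
  then show ?thesis unfolding proportional_def
    by (intro exI[of _ "[e]"] exI[of _ "[c, e, opp c]"]) (auto simp: slide_cup colour_lists_1 simp del: amplitude.simps)
next
  case (slide_cap k c e)
  have "amplitude U' F [p, q, r] = amplitude V F [p, q, r]" if p: "p \<in> X" "q \<in> X" "r \<in> X" for F p q r
  proof (cases "k = Virtual")
    case True
    have "U (- dsign e) p = r \<longleftrightarrow> p = U (dsign e) r" using p U_inverse by metis
    then show ?thesis using p U_closed by (simp add: slide_cap True tile_ops)
  next
    case False
    then have "flip k \<noteq> Virtual" "vertical_weight (flip k) = horizontal_weight k"
      "horizontal_weight (flip k) = vertical_weight k"
      by (cases k; simp add: kauffman_weights_def)+
    then show ?thesis using p False finite_X
      by (auto simp: slide_cap tile_ops cong: sum.cong)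
  qed
  then show ?thesis unfolding proportional_def
    by (intro exI[of _ "[c, e, opp c]"] exI[of _ "[e]"])
     (auto simp: slide_cap colour_lists_3 simp del: amplitude.simps)
qed

text \<open>The factor by which a curl changes the amplitude.\<close>

definition kink :: "crossing_kind \<Rightarrow> complex" where
  "kink k = (case k of Over \<Rightarrow> - (A powi (- 3)) | Under \<Rightarrow> - (A powi 3) | Virtual \<Rightarrow> 1)"

lemma kink_classical:
  "k \<noteq> Virtual \<Longrightarrow> vertical_weight k + horizontal_weight k * of_nat (card X) = kink k"
  using A_nonzero
  by (cases k) (simp_all add: kink_def kauffman_weights_def card_X field_simps power2_eq_square power3_eq_cube power_int_minus)

lemma move_I_proportional:
  assumes "move_I k U' V"
  shows "proportional (kink k) U' V"
  using assms
proof (cases rule: move_I.cases)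
  case (1 c)
  have "amplitude U' F [p, q] = kink k * amplitude V F [p, q]" if p: "p \<in> X" "q \<in> X" for F p q
  proof (cases "k = Virtual")
    case True
    then show ?thesis using p U_closed U_inject by (auto simp: 1 tile_ops kink_def)
  next
    case False
    then show ?thesis using p by (auto simp: 1 tile_ops algebra_simps simp flip: kink_classical cong: sum.cong)
  qed
  then show ?thesis unfolding proportional_def
    by (intro exI[of _ "[opp c, c]"] exI[of _ "[]"])
      (auto simp: 1 colour_lists_2 simp del: amplitude.simps)
next
  case (2 c)
  have "amplitude U' F [] = kink k * amplitude V F []" for F
  proof (cases "k = Virtual")
    case True
    then show ?thesis using sum_U[of "\<lambda>y. F [y, y]" "dsign c"]
      by (simp add: 2 tile_ops kink_def cong: sum.cong)
  next
    case False
    then show ?thesis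
      by (simp add: 2 tile_ops sum.distrib algebra_simps flip: kink_classical sum_distrib_left cong: sum.cong)
  qed
  then show ?thesis unfolding proportional_def
    by (intro exI[of _ "[]"] exI[of _ "[opp c, c]"])
      (auto simp: 2 colour_lists_0 simp del: amplitude.simps)
qed

lemma move_II_proportional:
  assumes "move_II k U' V"
  shows "proportional 1 U' V"
  using assms
proof (cases rule: move_II.cases)
  case (1 a b)
  have "amplitude U' F [p, q] = amplitude V F [p, q]" if p: "p \<in> X" "q \<in> X" for F p q
  proof (cases "k = Virtual")
    case True
    then show ?thesis using p U_closed U_inverse by (simp add: 1 tile_ops)
  next
    case False
    then have fl: "flip k \<noteq> Virtual" "vertical_weight (flip k) = horizontal_weight k"
      "horizontal_weight (flip k) = vertical_weight k"
      by (cases k; simp add: kauffman_weights_def)+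
    let ?v = "vertical_weight k" and ?h = "horizontal_weight k" and ?S = "\<Sum>z\<in>X. F [z, z]"
    have "amplitude U' F [p, q] = ?v * ?h * F [p, q] + (if p = q then (?v * ?v + ?h * ?h + ?v * ?h * of_nat (card X)) * ?S else 0)"
      using p False fl by (auto simp: 1 tile_ops sum.distrib algebra_simps simp flip: sum_distrib_left cong: sum.cong)
    then show ?thesis using kauffman_weights_II[OF False] vertical_horizontal[of k] by (simp add: 1)
  qed
  then show ?thesis unfolding proportional_def
    by (intro exI[of _ "[a, b]"]) (auto simp: 1 colour_lists_2 simp del: amplitude.simps)
qed

lemma move_III_proportional:
  assumes "\<And>F p q r. p \<in> X \<Longrightarrow> q \<in> X \<Longrightarrow> r \<in> X \<Longrightarrow>
    amplitude [([], Cross x a b, [c]), ([b], Cross y a c, []), ([], Cross z b c, [a])] F [p, q, r] =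
    amplitude [([a], Cross z b c, []), ([], Cross y a c, [b]), ([c], Cross x a b, [])] F [p, q, r]"
  shows "proportional 1 [([], Cross x a b, [c]), ([b], Cross y a c, []), ([], Cross z b c, [a])]
     [([a], Cross z b c, []), ([], Cross y a c, [b]), ([c], Cross x a b, [])]"
  unfolding proportional_def
  by (intro exI[of _ "[a, b, c]"] exI[of _ "[c, b, a]"])
    (use assms in \<open>auto simp: colour_lists_3 simp del: amplitude.simps\<close>)

text \<open>Both sides are expanded in the products \<open>1\<close>, \<open>E1\<close>, \<open>E2\<close>, \<open>E1 E2\<close> and \<open>E2 E1\<close>; the two
  sides differ by exchanging the roles of \<open>E1\<close> and \<open>E2\<close> and of \<open>x\<close> and \<open>z\<close>.\<close>

lemma classical_III_proportional:
  assumes k: "x \<noteq> Virtual" "y \<noteq> Virtual" "z \<noteq> Virtual" "\<not> (x = z \<and> x \<noteq> y)"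
    and m: "move_III x y z U' V"
  shows "proportional 1 U' V"
  using m
proof (cases rule: move_III.cases)
  case (1 a b c)
  show ?thesis unfolding 1
  proof (rule move_III_proportional)
    fix F :: "'c list \<Rightarrow> complex" and p q r assume p: "p \<in> X" "q \<in> X" "r \<in> X"
    let ?v = vertical_weight and ?h = horizontal_weight
    define G where "G = (\<lambda>p q r. F [p, q, r])"
    define R1 where "R1 k F = (\<lambda>p q r. ?v k * F p q r + ?h k * E1 F p q r)" for k F
    define R2 where "R2 k F = (\<lambda>p q r. ?v k * F p q r + ?h k * E2 F p q r)" for k F
    have "amplitude [([], Cross x a b, [c]), ([b], Cross y a c, []), ([], Cross z b c, [a])] F [p, q, r] =
        R1 x (R2 y (R1 z G)) p q r"
      using p k by (simp add: tile_ops R1_def R2_def E1_def E2_def G_def cong: sum.cong if_cong)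
    also have "\<dots> = ?v x * ?v y * ?v z * G p q r + ?v x * ?h y * ?v z * E2 G p q r +
       (?h x * ?v y * ?v z + ?v x * ?v y * ?h z + ?h x * ?v y * ?h z * of_nat (card X) +
          ?h x * ?h y * ?h z) * E1 G p q r +
       ?h x * ?h y * ?v z * E1 (E2 G) p q r + ?v x * ?h y * ?h z * E2 (E1 G) p q r"
      unfolding R1_def R2_def E1_linear E2_linear E1_E1 E1_E2_E1[OF p(3)] by (simp add: algebra_simps)
    also have "\<dots> = ?v x * ?v y * ?v z * G p q r + ?v x * ?h y * ?v z * E1 G p q r +
       (?h z * ?v y * ?v x + ?v z * ?v y * ?h x + ?h z * ?v y * ?h x * of_nat (card X) +
          ?h z * ?h y * ?h x) * E2 G p q r +
       ?h x * ?h y * ?v z * E1 (E2 G) p q r + ?v x * ?h y * ?h z * E2 (E1 G) p q r"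
      using kauffman_weights_III[of x y z] kauffman_weights_III[of z y x] k by auto
    also have "\<dots> = R2 z (R1 y (R2 x G)) p q r"
      unfolding R1_def R2_def E1_linear E2_linear E2_E2 E2_E1_E2[OF p(1)] by (simp add: algebra_simps)
    also have "\<dots> = amplitude [([a], Cross z b c, []), ([], Cross y a c, [b]), ([c], Cross x a b, [])] F [p, q, r]"
      using p k by (simp add: tile_ops R1_def R2_def E1_def E2_def G_def cong: sum.cong if_cong)
    finally show "amplitude [([], Cross x a b, [c]), ([b], Cross y a c, []), ([], Cross z b c, [a])] F [p, q, r] =
      amplitude [([a], Cross z b c, []), ([], Cross y a c, [b]), ([c], Cross x a b, [])] F [p, q, r]" .
  qed
qed

text \<open>The shift of a strand at a virtual crossing depends only on the other strand, so the order of its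
  virtual crossings does not matter.  Moving a strand across a classical crossing shifts the colours of
  all four ends of this crossing by a common amount, and smoothings commute with such a shift.\<close>

lemma virtual_III_proportional:
  assumes m: "move_III x y z U' V"
    and k: "x = Virtual \<and> y = Virtual \<or> x = Virtual \<and> z = Virtual \<or> y = Virtual \<and> z = Virtual"
  shows "proportional 1 U' V"
  using m
proof (cases rule: move_III.cases)
  case (1 a b c)
  show ?thesis unfolding 1
  proof (rule move_III_proportional)
    fix F :: "'c list \<Rightarrow> complex" and p q r assume p: "p \<in> X" "q \<in> X" "r \<in> X"
    consider "x = Virtual" "y = Virtual" "z = Virtual" | "x = Virtual" "y = Virtual" "z \<noteq> Virtual"
      | "x = Virtual" "z = Virtual" "y \<noteq> Virtual" | "y = Virtual" "z = Virtual" "x \<noteq> Virtual"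
      using k by blast
    then show "amplitude [([], Cross x a b, [c]), ([b], Cross y a c, []), ([], Cross z b c, [a])] F [p, q, r] =
      amplitude [([a], Cross z b c, []), ([], Cross y a c, [b]), ([c], Cross x a b, [])] F [p, q, r]"
    proof cases
      case 1
      then show ?thesis using p U_closed U_commute[of p] U_commute[of q] U_commute[of r]
        by (simp add: tile_ops)
    next
      case 2
      have "(\<Sum>y\<in>X. F [U (dsign a) y, U (dsign a) y, s]) = (\<Sum>y\<in>X. F [y, y, s])" for s
        by (rule sum_U[of "\<lambda>y. F [y, y, s]"])
      then show ?thesis using 2 p U_closed U_commute[of p] U_inject
        by (simp add: tile_ops cong: sum.cong)
    next
      case 3
      have *: "(\<Sum>y\<in>X. F [U (dsign b) y, s, y]) = (\<Sum>y\<in>X. F [y, s, U (- dsign b) y])" for s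
        using sum_U[of "\<lambda>y. F [y, s, U (- dsign b) y]" "dsign b"] U_inverse
        by (simp cong: sum.cong)
      have "U (- dsign b) p = r \<longleftrightarrow> p = U (dsign b) r" using p U_inverse by metis
      then show ?thesis using 3 p U_closed U_commute[of q] U_inverse *
        by (simp add: tile_ops cong: sum.cong)
    next
      case 4
      have "(\<Sum>y\<in>X. F [s, U (- dsign c) y, U (- dsign c) y]) = (\<Sum>y\<in>X. F [s, y, y])" for s
        by (rule sum_U[of "\<lambda>y. F [s, y, y]"])
      then show ?thesis using 4 p U_closed U_commute[of r] U_inject
        by (simp add: tile_ops cong: sum.cong)
    qed
  qed
qed

lemma proportional_composable:
  assumes "proportional s U' V" "U' \<noteq> []" "composable ws (add_strands l r U') ws'"
  obtains us vs where "ws = l @ us @ r" "composable us U' vs" "composable us V vs"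
    "\<forall>F. \<forall>xs\<in>colour_lists (length us). amplitude U' F xs = s * amplitude V F xs"
proof -
  obtain us vs where uv: "composable us U' vs" "composable us V vs"
    "\<forall>F. \<forall>xs\<in>colour_lists (length us). amplitude U' F xs = s * amplitude V F xs"
    using assms(1) by (auto simp: proportional_def)
  have "ws = l @ us @ r"
    using assms(2,3) uv(1) by (cases U') (auto simp: add_strands_def)
  with uv show thesis using that by blast
qed

end

lemma composable_append:
  "composable us (D @ E) ws \<longleftrightarrow> (\<exists>vs. composable us D vs \<and> composable vs E ws)"
  by (induction D arbitrary: us) auto

lemma (in bracket_colours) amplitude_local_move:
  assumes "proportional s U' V" "U' \<noteq> []" "composable [] (P @ add_strands l r U' @ Q) []"
  shows "amplitude (P @ add_strands l r U' @ Q) F [] = s * amplitude (P @ add_strands l r V @ Q) F []"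
proof -
  obtain ws ws' where w: "composable [] P ws" "composable ws (add_strands l r U') ws'"
    using assms(3) by (auto simp: composable_append)
  obtain us vs where u: "ws = l @ us @ r" "composable us U' vs" "composable us V vs"
    "\<forall>F. \<forall>xs\<in>colour_lists (length us). amplitude U' F xs = s * amplitude V F xs"
    using proportional_composable[OF assms(1,2) w(2)] .
  have "amplitude (add_strands l r U') G xs = s * amplitude (add_strands l r V) G xs"
    if xs: "xs \<in> colour_lists (length ws)" for G xs
  proof -
    define xl xm xr where "xl = take (length l) xs" and "xm = take (length us) (drop (length l) xs)"
      and "xr = drop (length us) (drop (length l) xs)"
    have xs': "xs = xl @ xm @ xr" unfolding xl_def xm_def xr_def by (metis append_take_drop_id)
    have len: "length xl = length l" "length xm = length us" "set xm \<subseteq> X"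
      using xs set_take_subset[of "length us" "drop (length l) xs"] set_drop_subset[of "length l" xs]
      by (auto simp: xl_def xm_def xr_def colour_lists_def u(1))
    then have "xm \<in> colour_lists (length us)" by (simp add: colour_lists_def)
    then show ?thesis
      unfolding xs' using u(4)
      by (simp add: amplitude_add_strands[OF u(2) len] amplitude_add_strands[OF u(3) len])
  qed
  then have "amplitude P (amplitude (add_strands l r U') (amplitude Q F)) [] =
      amplitude P (\<lambda>xs. s * amplitude (add_strands l r V) (amplitude Q F) xs) []"
    by (intro amplitude_cong[OF w(1)]) (auto simp: colour_lists_0)
  then show ?thesis by (simp add: amplitude_append amplitude_scale)
qed

text \<open>The unit depends only on the move, and in particular not on the colours; this allows one to
  compare arrow polynomials afterwards.\<close>

theorem diagram_move_amplitude:
  assumes "diagram_move D D'"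
  shows "\<exists>(m :: int) (e :: int). (e = 1 \<or> e = - 1) \<and>
    (\<forall>(X :: 'c set) U A. bracket_colours X U A \<longrightarrow>
       bracket_colours.amplitude X U A D (\<lambda>_. 1) [] =
       of_int e * A powi m * bracket_colours.amplitude X U A D' (\<lambda>_. 1) [])"
  using assms
proof (cases rule: diagram_move.cases)
  case (1 U' V P l r Q)
  have ne: "U' \<noteq> []"
    using 1(1) by (auto elim!: planar_isotopy.cases classical_move.cases virtual_move.cases
        move_I.cases move_II.cases move_III.cases)
  have comp: "composable [] (P @ add_strands l r U' @ Q) []"
    using 1 by (simp add: virtual_link_diagram_def)
  have "\<exists>(m :: int) (e :: int). (e = 1 \<or> e = - 1) \<and>
    (\<forall>(X :: 'c set) U A. bracket_colours X U A \<longrightarrow>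
       bracket_colours.proportional X U A (of_int e * A powi m) U' V)"
  proof -
    have one: ?thesis if "\<And>(X :: 'c set) U A. bracket_colours X U A \<Longrightarrow> bracket_colours.proportional X U A 1 U' V"
      using that by (intro exI[of _ 0] exI[of _ 1]) auto
    have I: ?thesis if "move_I k U' V" for k
    proof (rule exI[of _ "case k of Over \<Rightarrow> - 3 | Under \<Rightarrow> 3 | Virtual \<Rightarrow> 0"],
        rule exI[of _ "if k = Virtual then 1 else - 1"], intro conjI allI impI)
      fix X :: "'c set" and U A assume "bracket_colours X U A"
      then interpret bracket_colours X U A .
      show "proportional (of_int (if k = Virtual then 1 else - 1) *
          A powi (case k of Over \<Rightarrow> - 3 | Under \<Rightarrow> 3 | Virtual \<Rightarrow> 0)) U' V"
        using move_I_proportional[OF that] by (cases k) (simp_all add: kink_def)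
    qed simp
    from 1(1) consider "planar_isotopy U' V" | "classical_move U' V" | "virtual_move U' V" by blast
    then show ?thesis
    proof cases
      case 1
      then show ?thesis using bracket_colours.planar_isotopy_proportional by (intro one) blast
    next
      case 2
      then show ?thesis
      proof (cases rule: classical_move.cases)
        case (classical_I k)
        then show ?thesis using I by blast
      next
        case (classical_II k)
        then show ?thesis using bracket_colours.move_II_proportional by (intro one) blast
      next
        case (classical_III x y z)
        then show ?thesis using bracket_colours.classical_III_proportional by (intro one) blast
      qed
    next
      case 3
      then show ?thesis
      proof (cases rule: virtual_move.cases)
        case virtual_I
        then show ?thesis using I by blast
      next
        case virtual_II
        then show ?thesis using bracket_colours.move_II_proportional by (intro one) blast
      next
        case virtual_III
        then show ?thesis using bracket_colours.virtual_III_proportional by (intro one) blast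
      next
        case (virtual_IV_a k)
        then show ?thesis using bracket_colours.virtual_III_proportional by (intro one) blast
      next
        case (virtual_IV_b k)
        then show ?thesis using bracket_colours.virtual_III_proportional by (intro one) blast
      next
        case (virtual_IV_c k)
        then show ?thesis using bracket_colours.virtual_III_proportional by (intro one) blast
      qed
    qed
  qed
  then show ?thesis
    using bracket_colours.amplitude_local_move[OF _ _ ne comp] 1(2,3) by metis
qed


section \<open>Evaluating Laurent polynomials\<close>

definition monomial_value :: "complex \<Rightarrow> (nat \<Rightarrow> complex) \<Rightarrow> monomial \<Rightarrow> complex" where
  "monomial_value A \<kappa> M =
     A powi fst M * (\<Prod>i\<in>Poly_Mapping.keys (snd M). \<kappa> i ^ Poly_Mapping.lookup (snd M) i)"

definition evaluate :: "complex \<Rightarrow> (nat \<Rightarrow> complex) \<Rightarrow> laurent \<Rightarrow> complex" where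
  "evaluate A \<kappa> P =
     (\<Sum>M\<in>Poly_Mapping.keys P. of_int (Poly_Mapping.lookup P M) * monomial_value A \<kappa> M)"

lemma prod_keys_superset:
  fixes \<kappa> :: "nat \<Rightarrow> complex"
  assumes "finite I" "Poly_Mapping.keys e \<subseteq> I"
  shows "(\<Prod>i\<in>Poly_Mapping.keys e. \<kappa> i ^ Poly_Mapping.lookup e i) =
    (\<Prod>i\<in>I. \<kappa> i ^ Poly_Mapping.lookup e i)"
  by (rule prod.mono_neutral_left) (use assms in \<open>auto simp: in_keys_iff\<close>)

lemma monomial_value_add:
  assumes "A \<noteq> 0"
  shows "monomial_value A \<kappa> (M + M') = monomial_value A \<kappa> M * monomial_value A \<kappa> M'"
proof -
  let ?I = "Poly_Mapping.keys (snd M) \<union> Poly_Mapping.keys (snd M')"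
  have "finite ?I" by simp
  note * = prod_keys_superset[OF this]
  have "Poly_Mapping.keys (snd (M + M')) \<subseteq> ?I" by (simp add: Poly_Mapping.keys_add)
  from *[OF this] *[of "snd M"] *[of "snd M'"] show ?thesis
    using assms
    by (simp add: monomial_value_def power_int_add lookup_add power_add prod.distrib)
qed

lemma evaluate_superset:
  assumes "finite I" "Poly_Mapping.keys P \<subseteq> I"
  shows "evaluate A \<kappa> P = (\<Sum>M\<in>I. of_int (Poly_Mapping.lookup P M) * monomial_value A \<kappa> M)"
  unfolding evaluate_def by (rule sum.mono_neutral_left) (use assms in \<open>auto simp: in_keys_iff\<close>)

lemma evaluate_add: "evaluate A \<kappa> (P + Q) = evaluate A \<kappa> P + evaluate A \<kappa> Q"
proof -
  let ?I = "Poly_Mapping.keys P \<union> Poly_Mapping.keys Q"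
  have "finite ?I" by simp
  note * = evaluate_superset[OF this]
  have "Poly_Mapping.keys (P + Q) \<subseteq> ?I" by (rule Poly_Mapping.keys_add)
  from *[OF this] *[of P] *[of Q] show ?thesis
    by (simp add: lookup_add algebra_simps sum.distrib)
qed

lemma evaluate_zero [simp]: "evaluate A \<kappa> 0 = 0"
  by (simp add: evaluate_def)

lemma evaluate_uminus: "evaluate A \<kappa> (- P) = - evaluate A \<kappa> P"
  using evaluate_add[of A \<kappa> P "- P"] by (simp add: eq_neg_iff_add_eq_0 add.commute)

lemma evaluate_diff: "evaluate A \<kappa> (P - Q) = evaluate A \<kappa> P - evaluate A \<kappa> Q"
  using evaluate_add[of A \<kappa> P "- Q"] by (simp add: evaluate_uminus)

lemma evaluate_sum: "evaluate A \<kappa> (\<Sum>x\<in>I. P x) = (\<Sum>x\<in>I. evaluate A \<kappa> (P x))"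
  by (induction I rule: infinite_finite_induct) (auto simp: evaluate_add)

lemma evaluate_single: "evaluate A \<kappa> (Poly_Mapping.single M c) = of_int c * monomial_value A \<kappa> M"
  by (simp add: evaluate_def)

lemma evaluate_one [simp]: "evaluate A \<kappa> 1 = 1"
  using evaluate_single[of A \<kappa> 0 1] by (simp add: monomial_value_def)

lemma sum_singles: "P = (\<Sum>M\<in>Poly_Mapping.keys P. Poly_Mapping.single M (Poly_Mapping.lookup P M))"
  by (rule poly_mapping_eqI) (auto simp: lookup_sum lookup_single when_def in_keys_iff sum.delta')

lemma evaluate_mult:
  assumes "A \<noteq> 0"
  shows "evaluate A \<kappa> (P * Q) = evaluate A \<kappa> P * evaluate A \<kappa> Q"
proof -
  have "evaluate A \<kappa> (P * Q) = evaluate A \<kappa>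
      ((\<Sum>M\<in>Poly_Mapping.keys P. Poly_Mapping.single M (Poly_Mapping.lookup P M)) *
       (\<Sum>M\<in>Poly_Mapping.keys Q. Poly_Mapping.single M (Poly_Mapping.lookup Q M)))"
    using sum_singles[of P] sum_singles[of Q] by simp
  also have "\<dots> = evaluate A \<kappa> P * evaluate A \<kappa> Q"
    by (simp add: sum_product evaluate_sum mult_single evaluate_single monomial_value_add[OF assms])
      (simp add: evaluate_def sum_product mult_ac)
  finally show ?thesis .
qed

lemma evaluate_power: "A \<noteq> 0 \<Longrightarrow> evaluate A \<kappa> (P ^ n) = evaluate A \<kappa> P ^ n"
  by (induction n) (auto simp: evaluate_mult)

lemma evaluate_prod: "A \<noteq> 0 \<Longrightarrow> evaluate A \<kappa> (\<Prod>x\<in>I. P x) = (\<Prod>x\<in>I. evaluate A \<kappa> (P x))"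
  by (induction I rule: infinite_finite_induct) (auto simp: evaluate_mult)

lemma evaluate_A_power: "evaluate A \<kappa> (A_power m) = A powi m"
  by (simp add: A_power_def evaluate_single monomial_value_def)

lemma evaluate_K_var: "evaluate A \<kappa> (K_var i) = \<kappa> i"
  by (simp add: K_var_def evaluate_single monomial_value_def)

lemma (in link_diagram) loops_nonempty: "card (loops D S) > 0"
proof -
  have "D \<noteq> []" "composable [] D []" using valid by (auto simp: virtual_link_diagram_def)
  then obtain L E where D: "D = L # E" "bottom L = []" "composable (top L) E []" by (cases D) auto
  then have "top L \<noteq> []"
    by (cases L rule: top.cases; cases "tile_of L") auto
  then have "strands D 1 \<noteq> []" using top_eq_strands[of 0] D by simp
  then have "(1, 0) \<in> points D" by (simp add: points_eq)
  then have "loops D S \<noteq> {}" by (auto simp: loops_def)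
  moreover have "finite (loops D S)" using finite_components by (simp add: loops_eq_components)
  ultimately show ?thesis by (simp add: card_gt_0_iff)
qed

text \<open>The value of \<open>\<kappa>\<close> at \<open>0\<close> is left free, since the variable with index \<open>0\<close> never occurs.  One factor
  \<open>card X\<close> remains because the arrow polynomial has one factor $d$ less than there are loops.\<close>

theorem (in bracket_diagram) amplitude_eq_evaluate:
  assumes N: "card X > 0"
    and \<kappa>: "\<And>a. a > 0 \<Longrightarrow> \<kappa> a = of_nat (card (fixed_colours (2 * int a))) / of_nat (card X)"
  shows "amplitude D (\<lambda>_. 1) [] = of_nat (card X) * evaluate A \<kappa> (arrow_polynomial D)"
proof -
  let ?N = "of_nat (card X) :: complex"
  have d: "evaluate A \<kappa> loop_value = ?N"
    by (simp add: loop_value_def evaluate_diff evaluate_uminus evaluate_A_power card_X power_int_minus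
        power_int_numeral flip: power_inverse)
  have weight: "(\<Prod>n\<in>classical_crossings D. smoothing_weight (n \<in> S) (tile_of (D ! n))) =
      A powi (int (alpha D S) - int (beta D S))" for S
  proof -
    have fin: "finite (classical_crossings D)" by (auto simp: classical_crossings_def)
    have "(\<Prod>n\<in>classical_crossings D. smoothing_weight (n \<in> S) (tile_of (D ! n))) =
        (\<Prod>n\<in>classical_crossings D. if coefficient_A D S n then A else inverse A)"
      by (rule prod.cong) (auto simp: smoothing_weight_def coefficient_A_def)
    also have "\<dots> = A ^ alpha D S * inverse A ^ beta D S"
      using fin by (simp add: prod.If_cases alpha_def beta_def Int_def)
    also have "\<dots> = A powi (int (alpha D S) - int (beta D S))"
      using A_nonzero by (simp add: power_int_diff divide_inverse power_inverse)
    finally show ?thesis .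
  qed
  have loops: "of_nat (\<Prod>C\<in>loops D S. card (fixed_colours (2 * int (arrow_number D S C)))) =
      ?N * evaluate A \<kappa> (loop_value ^ (card (loops D S) - 1) * state_bracket D S)" for S
  proof -
    have "of_nat (card (fixed_colours (2 * int (arrow_number D S C)))) = ?N * evaluate A \<kappa> (loop_bracket D S C)" for C
      using N \<kappa> fixed_colours_zero by (auto simp: loop_bracket_def evaluate_K_var)
    then have "of_nat (\<Prod>C\<in>loops D S. card (fixed_colours (2 * int (arrow_number D S C)))) =
        ?N ^ card (loops D S) * (\<Prod>C\<in>loops D S. evaluate A \<kappa> (loop_bracket D S C))"
      by (simp add: of_nat_prod prod.distrib)
    also have "?N ^ card (loops D S) = ?N * ?N ^ (card (loops D S) - 1)"
      using loops_nonempty[of S] by (simp add: power_eq_if)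
    finally show ?thesis
      using A_nonzero by (simp add: evaluate_mult evaluate_power evaluate_prod d state_bracket_def)
  qed
  show ?thesis
    unfolding amplitude_eq_state_sum card_colourings_points arrow_polynomial_def weight loops
    using A_nonzero by (simp add: evaluate_sum evaluate_mult evaluate_A_power sum_distrib_left mult_ac)
qed

section \<open>The k-degree of the arrow polynomial\<close>

lemma k_degree_superset:
  assumes "finite I" "Poly_Mapping.keys (snd M) \<subseteq> I"
  shows "k_degree M = (\<Sum>i\<in>I. i * Poly_Mapping.lookup (snd M) i)"
  unfolding k_degree_def by (rule sum.mono_neutral_left) (use assms in \<open>auto simp: in_keys_iff\<close>)

lemma k_degree_add: "k_degree (M + M') = k_degree M + k_degree M'"
proof -
  let ?I = "Poly_Mapping.keys (snd M) \<union> Poly_Mapping.keys (snd M')"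
  have "finite ?I" by simp
  note * = k_degree_superset[OF this]
  have "Poly_Mapping.keys (snd (M + M')) \<subseteq> ?I" by (simp add: Poly_Mapping.keys_add)
  from *[OF this] *[of M] *[of M'] show ?thesis
    by (simp add: lookup_add algebra_simps sum.distrib)
qed

definition degree_le :: "nat \<Rightarrow> laurent \<Rightarrow> bool" where
  "degree_le n P \<longleftrightarrow> (\<forall>M\<in>Poly_Mapping.keys P. k_degree M \<le> n)"

lemma degree_le_mono: "degree_le m P \<Longrightarrow> m \<le> n \<Longrightarrow> degree_le n P"
  by (auto simp: degree_le_def)

lemma degree_le_mult: "degree_le m P \<Longrightarrow> degree_le n Q \<Longrightarrow> degree_le (m + n) (P * Q)"
  unfolding degree_le_def
proof
  fix M assume PQ: "\<forall>M\<in>Poly_Mapping.keys P. k_degree M \<le> m" "\<forall>M\<in>Poly_Mapping.keys Q. k_degree M \<le> n"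
    and "M \<in> Poly_Mapping.keys (P * Q)"
  then obtain a b where "M = a + b" "a \<in> Poly_Mapping.keys P" "b \<in> Poly_Mapping.keys Q"
    using keys_mult[of P Q] by blast
  then show "k_degree M \<le> m + n" using PQ by (simp add: k_degree_add add_mono)
qed

lemma degree_le_diff: "degree_le n P \<Longrightarrow> degree_le n Q \<Longrightarrow> degree_le n (P - Q)"
  unfolding degree_le_def using keys_diff[of P Q] by blast

lemma degree_le_uminus: "degree_le n P \<Longrightarrow> degree_le n (- P)"
  by (simp add: degree_le_def)

lemma degree_le_one: "degree_le 0 1"
  by (simp add: degree_le_def k_degree_def)

lemma degree_le_power: "degree_le 0 P \<Longrightarrow> degree_le 0 (P ^ n)"
  by (induction n) (use degree_le_mult[of 0 P 0] degree_le_one in auto)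

lemma degree_le_prod: "(\<And>x. x \<in> I \<Longrightarrow> degree_le (n x) (P x)) \<Longrightarrow> degree_le (sum n I) (prod P I)"
  by (induction I rule: infinite_finite_induct) (auto intro: degree_le_mult simp: degree_le_one)

lemma degree_le_sum: "(\<And>x. x \<in> I \<Longrightarrow> degree_le n (P x)) \<Longrightarrow> degree_le n (sum P I)"
  unfolding degree_le_def using keys_sum[of P I] by blast

lemma degree_le_A_power: "degree_le 0 (A_power m)"
  by (simp add: degree_le_def A_power_def k_degree_def)

lemma (in link_diagram) degree_arrow_polynomial: "degree_le (num_virtual D) (arrow_polynomial D)"
  unfolding arrow_polynomial_def
proof (rule degree_le_sum)
  fix S
  have "degree_le 0 (loop_value ^ (card (loops D S) - 1))"
    unfolding loop_value_def by (intro degree_le_power degree_le_diff degree_le_uminus degree_le_A_power)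
  from degree_le_mult[OF degree_le_A_power this]
  have "degree_le 0 (A_power (int (alpha D S) - int (beta D S)) * loop_value ^ (card (loops D S) - 1))"
    by simp
  moreover have "degree_le (\<Sum>C\<in>loops D S. arrow_number D S C) (state_bracket D S)"
    unfolding state_bracket_def
  proof (rule degree_le_prod)
    fix C show "degree_le (arrow_number D S C) (loop_bracket D S C)"
      using degree_le_one by (auto simp: loop_bracket_def K_var_def degree_le_def k_degree_def)
  qed
  ultimately show "degree_le (num_virtual D) (A_power (int (alpha D S) - int (beta D S)) *
      loop_value ^ (card (loops D S) - 1) * state_bracket D S)"
    using degree_le_mult degree_le_mono sum_arrow_number_le by fastforce
qed

text \<open>A unit $\pm A^m$ has k-degree \<open>0\<close> and an inverse of the same form.\<close>

lemma k_degrees_single_mult: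
  fixes P :: laurent
  assumes "e = 1 \<or> e = - 1"
  shows "k_degree ` Poly_Mapping.keys (Poly_Mapping.single (m, 0) e * P) = k_degree ` Poly_Mapping.keys P"
proof -
  have sub: "k_degree ` Poly_Mapping.keys (Poly_Mapping.single (m, 0) c * Q) \<subseteq> k_degree ` Poly_Mapping.keys Q"
    for m c and Q :: laurent
  proof (rule image_subsetI)
    fix M assume "M \<in> Poly_Mapping.keys (Poly_Mapping.single (m, 0) c * Q)"
    then obtain b where b: "M = (m, 0) + b" "b \<in> Poly_Mapping.keys Q"
      using keys_mult[of "Poly_Mapping.single (m, 0) c" Q] by (auto split: if_splits)
    have "k_degree (m, 0) = 0" by (simp add: k_degree_def)
    then have "k_degree M = k_degree b" by (simp only: b(1) k_degree_add)
    then show "k_degree M \<in> k_degree ` Poly_Mapping.keys Q" using b(2) by simp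
  qed
  have "Poly_Mapping.single (- m, 0) e * (Poly_Mapping.single (m, 0) e * P) = P"
    using assms by (auto simp: mult_single simp flip: mult.assoc zero_prod_def)
  then show ?thesis using sub[of m e P] sub[of "- m" e "Poly_Mapping.single (m, 0) e * P"] by auto
qed


section \<open>Evaluations separate Laurent polynomials\<close>

text \<open>Uniqueness of the expansion in base \<open>B\<close>, for digits of any sign.\<close>

lemma base_expansion_zero:
  fixes d :: "nat \<Rightarrow> int"
  assumes "(\<Sum>i<n. d i * B ^ i) = 0" "\<And>i. i < n \<Longrightarrow> \<bar>d i\<bar> < B"
  shows "i < n \<Longrightarrow> d i = 0"
  using assms
proof (induction n arbitrary: d i)
  case (Suc n)
  have B: "B > 0" using Suc.prems(3)[of 0] by simp
  have "(\<Sum>i<Suc n. d i * B ^ i) = d 0 + B * (\<Sum>i<n. d (Suc i) * B ^ i)"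
    by (simp only: sum.lessThan_Suc_shift) (simp add: sum_distrib_left mult_ac)
  then have *: "d 0 + B * (\<Sum>i<n. d (Suc i) * B ^ i) = 0" using Suc.prems(2) by simp
  then have "B dvd d 0" by (metis dvd_add_triv_right_iff dvd_0_right dvd_triv_left dvd_add_left_iff)
  then have d0: "d 0 = 0" using Suc.prems(3)[of 0] B by (metis zdvd_not_zless zero_less_Suc abs_dvd_iff
      dvd_abs_iff zero_less_abs_iff)
  with * B have "(\<Sum>i<n. d (Suc i) * B ^ i) = 0" by simp
  with Suc.IH[of _ "\<lambda>i. d (Suc i)"] Suc.prems(3) have "\<And>i. i < n \<Longrightarrow> d (Suc i) = 0" by simp
  with d0 Suc.prems(1) show ?case by (cases i) auto
qed simp

lemma power_int_tendsto_zero: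
  assumes "n < (0::int)"
  shows "(\<lambda>t. of_nat t powi n :: 'a :: real_normed_field) \<longlonglongrightarrow> 0"
proof -
  have "(\<lambda>t. inverse (of_nat t) ^ nat (- n) :: 'a) \<longlonglongrightarrow> 0 ^ nat (- n)"
    by (intro tendsto_power lim_inverse_n)
  moreover have "nat (- n) \<noteq> 0" using assms by simp
  ultimately show ?thesis using assms by (simp add: power_int_def power_inverse zero_power)
qed

text \<open>If the functions have different orders of growth, then the fastest one cannot be cancelled by the
  others.\<close>

lemma eventually_sum_nonzero:
  fixes f :: "'m \<Rightarrow> nat \<Rightarrow> complex" and \<phi> :: "'m \<Rightarrow> int"
  assumes fin: "finite I" and ne: "I \<noteq> {}" and inj: "inj_on \<phi> I"
    and c: "\<And>M. M \<in> I \<Longrightarrow> c M \<noteq> 0" and L: "\<And>M. M \<in> I \<Longrightarrow> L M \<noteq> 0"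
    and lim: "\<And>M. M \<in> I \<Longrightarrow> (\<lambda>t. f M t / of_nat t powi \<phi> M) \<longlonglongrightarrow> L M"
  shows "\<forall>\<^sub>F t in sequentially. (\<Sum>M\<in>I. c M * f M t) \<noteq> 0"
proof -
  have "Max (\<phi> ` I) \<in> \<phi> ` I" using fin ne by simp
  then obtain M0 where "M0 \<in> I" and Max: "Max (\<phi> ` I) = \<phi> M0" by (rule imageE)
  then have M0: "M0 \<in> I" "\<And>M. M \<in> I \<Longrightarrow> \<phi> M \<le> \<phi> M0"
    using fin by (simp_all flip: Max)
  have "(\<lambda>t. c M * f M t / of_nat t powi \<phi> M0) \<longlonglongrightarrow> (if M = M0 then c M0 * L M0 else 0)"
    if M: "M \<in> I" for M
  proof (cases "M = M0")
    case True
    then show ?thesis using tendsto_mult_left[OF lim[OF M], of "c M"] by simp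
  next
    case False
    then have "\<phi> M - \<phi> M0 < 0" using inj M M0 by (metis inj_onD diff_less_0_iff_less order_le_less)
    from tendsto_mult[OF tendsto_mult_left[OF lim[OF M], of "c M"] power_int_tendsto_zero[OF this]]
    have "(\<lambda>t. c M * (f M t / of_nat t powi \<phi> M) * of_nat t powi (\<phi> M - \<phi> M0)) \<longlonglongrightarrow> 0" by simp
    moreover have "\<forall>\<^sub>F t in sequentially. c M * (f M t / of_nat t powi \<phi> M) * of_nat t powi (\<phi> M - \<phi> M0) =
        c M * f M t / of_nat t powi \<phi> M0"
      using eventually_gt_at_top[of 0] by eventually_elim (simp add: power_int_diff)
    ultimately show ?thesis using False by (simp add: tendsto_cong)
  qed
  then have "(\<lambda>t. \<Sum>M\<in>I. c M * f M t / of_nat t powi \<phi> M0) \<longlonglongrightarrow> (\<Sum>M\<in>I. if M = M0 then c M0 * L M0 else 0)"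
    by (rule tendsto_sum)
  then have "(\<lambda>t. (\<Sum>M\<in>I. c M * f M t) / of_nat t powi \<phi> M0) \<longlonglongrightarrow> c M0 * L M0"
    using fin M0(1) by (simp add: sum_divide_distrib)
  moreover have "c M0 * L M0 \<noteq> 0" using c L M0 by simp
  ultimately have "\<forall>\<^sub>F t in sequentially. (\<Sum>M\<in>I. c M * f M t) / of_nat t powi \<phi> M0 \<noteq> 0"
    by (rule tendsto_imp_eventually_ne)
  then show ?thesis by (rule eventually_mono) auto
qed

text \<open>For each \<open>l \<le> k\<close> there are \<open>c l\<close> cycles of length \<open>2 * l\<close>.  The length is even because only even
  numbers act in the formula for the colourings of a loop: \<open>2 * a\<close> fixes such a cycle if and only if
  \<open>l\<close> divides \<open>a\<close>.\<close>

definition cyclic_colours :: "nat \<Rightarrow> (nat \<Rightarrow> nat) \<Rightarrow> (nat \<times> nat \<times> int) set" where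
  "cyclic_colours k c = (SIGMA l:{1..k}. {..<c l} \<times> {0..<2 * int l})"

definition shift_colour :: "int \<Rightarrow> nat \<times> nat \<times> int \<Rightarrow> nat \<times> nat \<times> int" where
  "shift_colour m = (\<lambda>(l, i, j). (l, i, (j + m) mod (2 * int l)))"

lemma cyclic_colours_colours: "colours (cyclic_colours k c) shift_colour"
  by unfold_locales (auto simp: cyclic_colours_def shift_colour_def mod_simps ac_simps)

lemma card_cyclic_colours: "card (cyclic_colours k c) = (\<Sum>l\<in>{1..k}. 2 * l * c l)"
  by (simp add: cyclic_colours_def card_cartesian_product nat_mult_distrib mult_ac)

lemma card_fixed_colours_cyclic_colours:
  assumes "0 < a" "a < k"
  shows "card (colours.fixed_colours (cyclic_colours k c) shift_colour (2 * int a)) = (\<Sum>l\<in>{l \<in> {1..a}. l dvd a}. 2 * l * c l)"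
proof -
  interpret colours "cyclic_colours k c" shift_colour by (rule cyclic_colours_colours)
  have 1: "(j + 2 * int a) mod (2 * int l) = j \<longleftrightarrow> l dvd a" if "0 \<le> j" "j < 2 * int l" for j l
  proof -
    have "(j + 2 * int a) mod (2 * int l) = j \<longleftrightarrow> (j + 2 * int a) mod (2 * int l) = j mod (2 * int l)"
      using that by simp
    also have "\<dots> \<longleftrightarrow> 2 * int l dvd 2 * int a" by (simp add: mod_eq_dvd_iff)
    finally show ?thesis by simp
  qed
  have 2: "l \<le> a" if "l dvd a" for l using that assms(1) by (simp add: dvd_imp_le)
  have "fixed_colours (2 * int a) = (SIGMA l:{l \<in> {1..a}. l dvd a}. {..<c l} \<times> {0..<2 * int l})"
  proof (intro set_eqI)
    fix x :: "nat \<times> nat \<times> int"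
    obtain l i j where x: "x = (l, i, j)" by (cases x)
    have "(l, i, j) \<in> fixed_colours (2 * int a) \<longleftrightarrow>
        l \<in> {1..k} \<and> i < c l \<and> 0 \<le> j \<and> j < 2 * int l \<and> (j + 2 * int a) mod (2 * int l) = j"
      unfolding fixed_colours_def by (auto simp: cyclic_colours_def shift_colour_def)
    also have "\<dots> \<longleftrightarrow> l \<in> {1..a} \<and> l dvd a \<and> i < c l \<and> 0 \<le> j \<and> j < 2 * int l"
      using 1 2 assms(2) by (metis atLeastAtMost_iff le_trans less_imp_le)
    also have "\<dots> \<longleftrightarrow> (l, i, j) \<in> (SIGMA l:{l \<in> {1..a}. l dvd a}. {..<c l} \<times> {0..<2 * int l})"
      by auto
    finally show "x \<in> fixed_colours (2 * int a) \<longleftrightarrow>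
        x \<in> (SIGMA l:{l \<in> {1..a}. l dvd a}. {..<c l} \<times> {0..<2 * int l})"
      by (simp only: x)
  qed
  then show ?thesis by (simp add: card_cartesian_product nat_mult_distrib mult_ac)
qed

lemma dominant_term:
  fixes \<sigma> :: "nat \<Rightarrow> nat"
  assumes "finite J" "j \<in> J" "\<And>l. l \<in> J \<Longrightarrow> l \<noteq> j \<Longrightarrow> \<sigma> l < \<sigma> j"
  shows "(\<lambda>t. of_nat (\<Sum>l\<in>J. 2 * l * t ^ \<sigma> l) / of_nat t powi int (\<sigma> j) :: 'a :: real_normed_field) \<longlonglongrightarrow> of_nat (2 * j)"
proof -
  have "(\<lambda>t. of_nat (2 * l) * of_nat t powi (int (\<sigma> l) - int (\<sigma> j)) :: 'a) \<longlonglongrightarrow>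
      (if l = j then of_nat (2 * j) else 0)" if "l \<in> J" for l
  proof (cases "l = j")
    case False
    then have "int (\<sigma> l) - int (\<sigma> j) < 0" using assms(3)[OF that] by simp
    from tendsto_mult_left[OF power_int_tendsto_zero[OF this]] False show ?thesis by fastforce
  qed simp
  then have "(\<lambda>t. \<Sum>l\<in>J. of_nat (2 * l) * of_nat t powi (int (\<sigma> l) - int (\<sigma> j)) :: 'a) \<longlonglongrightarrow>
      (\<Sum>l\<in>J. if l = j then of_nat (2 * j) else 0)"
    by (rule tendsto_sum)
  then have "(\<lambda>t. \<Sum>l\<in>J. of_nat (2 * l) * of_nat t powi (int (\<sigma> l) - int (\<sigma> j)) :: 'a) \<longlonglongrightarrow> of_nat (2 * j)"
    using assms(1,2) by (simp only: sum.delta if_True)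
  moreover have "\<forall>\<^sub>F t in sequentially. (\<Sum>l\<in>J. of_nat (2 * l) * of_nat t powi (int (\<sigma> l) - int (\<sigma> j)) :: 'a) =
      of_nat (\<Sum>l\<in>J. 2 * l * t ^ \<sigma> l) / of_nat t powi int (\<sigma> j)"
    using eventually_gt_at_top[of 0]
    by eventually_elim (simp add: power_int_diff sum_divide_distrib)
  ultimately show ?thesis by (simp add: tendsto_cong)
qed

text \<open>The number \<open>a\<close> solves the equation with the sign removed; \<open>\<i> * a\<close> solves the original one.\<close>

lemma bracket_parameter:
  assumes "n \<ge> (2 :: real)"
  defines "a \<equiv> sqrt ((n + sqrt (n\<^sup>2 - 4)) / 2)"
  shows "a > 0" "a\<^sup>2 + inverse (a\<^sup>2) = n"
proof -
  have n4: "n\<^sup>2 \<ge> 4" using assms(1) power_mono[of 2 n 2] by simp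
  define r where "r = sqrt (n\<^sup>2 - 4)"
  have r: "r\<^sup>2 = n\<^sup>2 - 4" "r \<ge> 0" using n4 by (auto simp: r_def)
  have a2: "a\<^sup>2 = (n + r) / 2" using r assms(1) by (simp add: a_def r_def)
  show "a > 0" using r assms(1) unfolding a_def r_def[symmetric] by simp
  have "(n + r) * (n - r) = 4" using r(1) by (simp add: algebra_simps power2_eq_square)
  then have "inverse ((n + r) / 2) = (n - r) / 2"
    using r(2) assms(1) by (simp add: field_simps)
  then show "a\<^sup>2 + inverse (a\<^sup>2) = n" unfolding a2 by (simp add: field_simps)
qed


text \<open>There are $t^{\sigma(l)}$ cycles of length \<open>2 * l\<close>, for a rapidly increasing \<open>\<sigma>\<close> and a large
  parameter \<open>t\<close>.  The fixed points of \<open>2 * a\<close> are then mostly those on the cycles of length \<open>2 * a\<close>,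
  and almost all colours lie on the cycles of length \<open>2 * k\<close>.  So $K_a$ grows like
  $t^{\sigma(a)-\sigma(k)}$ and $A$ like $t^{\sigma(k)/2}$, up to constants, and the exponent \<open>\<phi> M\<close> of
  \<open>t\<close> in a monomial \<open>M\<close> determines \<open>M\<close>.\<close>

theorem evaluation_separates:
  fixes G :: laurent
  assumes "G \<noteq> 0"
  obtains X A \<kappa> where "bracket_colours (X :: (nat \<times> nat \<times> int) set) shift_colour A" "card X > 0"
    "\<And>a. a > 0 \<Longrightarrow> \<kappa> a = of_nat (card (colours.fixed_colours X shift_colour (2 * int a))) / of_nat (card X)"
    "evaluate A \<kappa> G \<noteq> 0"
proof -
  define I where "I = Poly_Mapping.keys G"
  have fin_I: "finite I" and ne_I: "I \<noteq> {}" using assms by (auto simp: I_def)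
  have "finite (\<Union>M\<in>I. Poly_Mapping.keys (snd M))" using fin_I by simp
  then obtain k0 where k0: "\<forall>i\<in>(\<Union>M\<in>I. Poly_Mapping.keys (snd M)). i < k0"
    by (meson finite_nat_set_iff_bounded)
  define k where "k = Suc k0"
  have keys: "Poly_Mapping.keys (snd M) \<subseteq> {..<k}" if "M \<in> I" for M
    using k0 that by (auto simp: k_def less_Suc_eq)
  have k: "k > 0" by (simp add: k_def)
  let ?e = "\<lambda>M i. Poly_Mapping.lookup (snd M) i"
  \<comment> \<open>The digits of the exponent of growth in base \<open>B\<close>; the exponents \<open>\<sigma>\<close> are even
      in order that the square root $t^{\sigma(k)/2}$ has an integral exponent.\<close>
  define w where "w M i = (if i < k then 2 * int (?e M i) else fst M - 2 * (\<Sum>i<k. int (?e M i)))"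
    for M :: monomial and i
  have "finite ((\<lambda>(M, i). \<bar>w M i\<bar>) ` (I \<times> {..k}))" using fin_I by simp
  then obtain b where b: "\<forall>x\<in>(\<lambda>(M, i). \<bar>w M i\<bar>) ` (I \<times> {..k}). x \<le> b"
    by (meson Max_ge)
  define B where "B = nat (2 * \<bar>b\<bar> + 2)"
  have B: "B \<ge> 2" by (simp add: B_def)
  have w_B: "\<bar>w M i - w M' i\<bar> < int B" if "M \<in> I" "M' \<in> I" "i < Suc k" for M M' i
  proof -
    have "\<bar>w M i\<bar> \<le> b" "\<bar>w M' i\<bar> \<le> b" using b that by force+
    then show ?thesis by (simp add: B_def)
  qed
  define \<sigma> where "\<sigma> i = 2 * B ^ i" for i :: nat
  have \<sigma>_mono: "\<sigma> i < \<sigma> j" if "i < j" for i j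
    using that B by (simp add: \<sigma>_def power_strict_increasing)
  define \<phi> where "\<phi> M = (\<Sum>i<Suc k. w M i * int B ^ i)" for M
  have inj: "inj_on \<phi> I"
  proof (rule inj_onI)
    fix M M' assume M: "M \<in> I" "M' \<in> I" "\<phi> M = \<phi> M'"
    have "(\<Sum>i<Suc k. (w M i - w M' i) * int B ^ i) = 0"
      using M(3) unfolding \<phi>_def left_diff_distrib sum_subtractf by simp
    then have w: "w M i = w M' i" if "i < Suc k" for i
      using base_expansion_zero[of "\<lambda>i. w M i - w M' i" "int B" "Suc k" i] w_B[OF M(1,2)] that by simp
    have e: "?e M i = ?e M' i" if "i < k" for i using w[of i] that by (simp add: w_def)
    have "?e M i = ?e M' i" for i
    proof (cases "i < k")
      case False
      then have "i \<notin> Poly_Mapping.keys (snd M)" "i \<notin> Poly_Mapping.keys (snd M')" using keys M by blast+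
      then show ?thesis by (simp add: in_keys_iff)
    qed (rule e)
    then have "snd M = snd M'" by (rule poly_mapping_eqI)
    moreover have "fst M = fst M'" using w[of k] e by (simp add: w_def)
    ultimately show "M = M'" by (rule prod_eqI[rotated])
  qed
  have \<phi>_eq: "\<phi> M = int (B ^ k) * fst M + (\<Sum>i<k. (int (\<sigma> i) - int (\<sigma> k)) * int (?e M i))" for M
  proof -
    have "\<phi> M = (\<Sum>i<k. 2 * int (?e M i) * int B ^ i) + (fst M - 2 * (\<Sum>i<k. int (?e M i))) * int B ^ k"
      by (simp add: \<phi>_def w_def)
    also have "\<dots> = int (B ^ k) * fst M + (\<Sum>i<k. (int (\<sigma> i) - int (\<sigma> k)) * int (?e M i))"
      by (simp add: \<sigma>_def algebra_simps sum_subtractf sum_distrib_left)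
    finally show ?thesis .
  qed
  define X where "X t = cyclic_colours k (\<lambda>l. t ^ \<sigma> l)" for t :: nat
  define N where "N t = card (X t)" for t
  have N_eq: "N t = (\<Sum>l\<in>{1..k}. 2 * l * t ^ \<sigma> l)" for t
    by (simp add: N_def X_def card_cyclic_colours)
  define s where "s t a = card (colours.fixed_colours (X t) shift_colour (2 * int a))" for t a
  have s_eq: "s t a = (\<Sum>l\<in>{l \<in> {1..a}. l dvd a}. 2 * l * t ^ \<sigma> l)" if "0 < a" "a < k" for t a
    unfolding s_def X_def by (rule card_fixed_colours_cyclic_colours[OF that])
  \<comment> \<open>The arbitrary value at \<open>0\<close> is chosen such that this variable has its own rate of growth, too.\<close>
  define \<kappa> where "\<kappa> t i = (if i = 0 then of_nat t powi (int (\<sigma> 0) - int (\<sigma> k))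
      else of_nat (s t i) / of_nat (N t) :: complex)" for t i
  define a where "a t = sqrt ((real (N t) + sqrt ((real (N t))\<^sup>2 - 4)) / 2)" for t
  define A where "A t = \<i> * of_real (a t)" for t
  have N_ge: "N t \<ge> 2" if "t \<ge> 1" for t
  proof -
    have "2 * 1 * t ^ \<sigma> 1 \<le> N t"
      unfolding N_eq using k by (intro member_le_sum[of 1 "{1..k}" "\<lambda>l. 2 * l * t ^ \<sigma> l"]) auto
    moreover have "t ^ \<sigma> 1 \<ge> 1" using that by simp
    ultimately show ?thesis by linarith
  qed
  have bracket: "bracket_colours (X t) shift_colour (A t)" if t: "t \<ge> 1" for t
  proof -
    have a: "a t > 0" "(a t)\<^sup>2 + inverse ((a t)\<^sup>2) = real (N t)"
      using bracket_parameter[of "real (N t)"] N_ge[OF t] by (simp_all add: a_def)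
    have "- (A t ^ 2) - inverse (A t) ^ 2 = of_real ((a t)\<^sup>2 + inverse ((a t)\<^sup>2))"
      by (simp add: A_def power_mult_distrib power_inverse)
    then have "of_nat (card (X t)) = - (A t ^ 2) - inverse (A t) ^ 2"
      by (simp add: a(2) N_def)
    with a(1) show ?thesis
      by (intro bracket_colours.intro bracket_colours_axioms.intro)
        (simp_all add: X_def cyclic_colours_colours A_def)
  qed
  have lim_N: "(\<lambda>t. of_nat (N t) / of_nat t powi int (\<sigma> k) :: complex) \<longlonglongrightarrow> of_nat (2 * k)"
    and lim_N_real: "(\<lambda>t. of_nat (N t) / of_nat t powi int (\<sigma> k) :: real) \<longlonglongrightarrow> of_nat (2 * k)"
    unfolding N_eq by (rule dominant_term; use k \<sigma>_mono in auto)+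
  define \<rho> where "\<rho> i = (if i = 0 then 1 else of_nat (2 * i) / of_nat (2 * k) :: complex)" for i
  have \<rho>: "\<rho> i \<noteq> 0" for i using k by (simp add: \<rho>_def)
  have lim_\<kappa>: "(\<lambda>t. \<kappa> t i / of_nat t powi (int (\<sigma> i) - int (\<sigma> k))) \<longlonglongrightarrow> \<rho> i" if i: "i < k" for i
  proof (cases "i = 0")
    case True
    have "\<forall>\<^sub>F t in sequentially. \<kappa> t i / of_nat t powi (int (\<sigma> i) - int (\<sigma> k)) = 1"
      using eventually_gt_at_top[of 0] by eventually_elim (simp add: \<kappa>_def True)
    then show ?thesis using True by (simp add: \<rho>_def tendsto_eventually)
  next
    case False
    have "(\<lambda>t. of_nat (s t i) / of_nat t powi int (\<sigma> i) :: complex) \<longlonglongrightarrow> of_nat (2 * i)"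
      using False i \<sigma>_mono by (simp only: s_eq neq0_conv) (intro dominant_term, auto)
    from tendsto_divide[OF this lim_N]
    have "(\<lambda>t. (of_nat (s t i) / of_nat t powi int (\<sigma> i)) / (of_nat (N t) / of_nat t powi int (\<sigma> k))) \<longlonglongrightarrow> \<rho> i"
      using k False by (simp add: \<rho>_def)
    moreover have "\<forall>\<^sub>F t in sequentially. (of_nat (s t i) / of_nat t powi int (\<sigma> i)) /
        (of_nat (N t) / of_nat t powi int (\<sigma> k)) = \<kappa> t i / of_nat t powi (int (\<sigma> i) - int (\<sigma> k))"
      using eventually_gt_at_top[of 0]
      by eventually_elim (simp add: \<kappa>_def False power_int_diff field_simps)
    ultimately show ?thesis by (simp add: tendsto_cong)
  qed
  have lim_a: "(\<lambda>t. a t / real t ^ (B ^ k)) \<longlonglongrightarrow> sqrt (real (2 * k))"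
  proof -
    let ?q = "\<lambda>t. of_nat (N t) / of_nat t powi int (\<sigma> k) :: real"
    have \<sigma>0: "- 2 * int (\<sigma> k) < 0" using B by (simp add: \<sigma>_def)
    have "(\<lambda>t. sqrt ((?q t + sqrt ((?q t)\<^sup>2 - 4 * of_nat t powi (- 2 * int (\<sigma> k)))) / 2)) \<longlonglongrightarrow>
        sqrt ((of_nat (2 * k) + sqrt ((of_nat (2 * k))\<^sup>2 - 4 * 0)) / 2)"
      by (intro tendsto_intros lim_N_real power_int_tendsto_zero \<sigma>0) auto
    moreover have "\<forall>\<^sub>F t in sequentially. sqrt ((?q t + sqrt ((?q t)\<^sup>2 - 4 * of_nat t powi (- 2 * int (\<sigma> k)))) / 2) =
        a t / real t ^ (B ^ k)"
      using eventually_gt_at_top[of 0]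
    proof eventually_elim
      case (elim t)
      define T where "T = real t ^ (B ^ k)"
      have T: "T > 0" using elim by (simp add: T_def)
      have T2: "of_nat t powi int (\<sigma> k) = T\<^sup>2" "of_nat t powi (- 2 * int (\<sigma> k)) = inverse ((T\<^sup>2)\<^sup>2)"
      proof -
        show 1: "of_nat t powi int (\<sigma> k) = T\<^sup>2"
          unfolding power_int_of_nat by (simp add: T_def \<sigma>_def mult.commute[of 2] flip: power_mult)
        have "- 2 * int (\<sigma> k) = - (int (\<sigma> k) * 2)" by simp
        then show "of_nat t powi (- 2 * int (\<sigma> k)) = inverse ((T\<^sup>2)\<^sup>2)"
          by (simp only: power_int_minus power_int_mult 1 power_int_numeral)
      qed
      have "(?q t)\<^sup>2 - 4 * of_nat t powi (- 2 * int (\<sigma> k)) = ((real (N t))\<^sup>2 - 4) / (T\<^sup>2)\<^sup>2"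
        unfolding T2 by (simp add: power_divide divide_inverse left_diff_distrib power_mult_distrib power_inverse)
      then have "sqrt ((?q t)\<^sup>2 - 4 * of_nat t powi (- 2 * int (\<sigma> k))) = sqrt ((real (N t))\<^sup>2 - 4) / T\<^sup>2"
        by (simp only: real_sqrt_divide real_sqrt_abs abs_power2)
      then have "(?q t + sqrt ((?q t)\<^sup>2 - 4 * of_nat t powi (- 2 * int (\<sigma> k)))) / 2 =
          ((real (N t) + sqrt ((real (N t))\<^sup>2 - 4)) / 2) / T\<^sup>2"
        unfolding T2 by (simp add: add_divide_distrib)
      then show ?case
        using T unfolding a_def T_def[symmetric] by (simp only: real_sqrt_divide real_sqrt_abs abs_of_pos)
    qed
    ultimately have "(\<lambda>t. a t / real t ^ (B ^ k)) \<longlonglongrightarrow>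
        sqrt ((of_nat (2 * k) + sqrt ((of_nat (2 * k))\<^sup>2 - 4 * 0)) / 2)"
      by (simp only: tendsto_cong)
    also have "(of_nat (2 * k) + sqrt ((of_nat (2 * k))\<^sup>2 - 4 * 0)) / 2 = real (2 * k)"
      by (simp only: mult_zero_right diff_zero real_sqrt_abs) simp
    finally show ?thesis .
  qed
  have lim_A: "(\<lambda>t. A t / of_nat t powi int (B ^ k)) \<longlonglongrightarrow> \<i> * of_real (sqrt (real (2 * k)))"
  proof -
    have "(\<lambda>t. \<i> * of_real (a t / real t ^ (B ^ k))) \<longlonglongrightarrow> \<i> * of_real (sqrt (real (2 * k)))"
      by (intro tendsto_intros lim_a)
    then show ?thesis unfolding power_int_of_nat by (simp add: A_def)
  qed
  let ?\<alpha> = "\<i> * of_real (sqrt (real (2 * k))) :: complex"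
  have \<alpha>: "?\<alpha> \<noteq> 0" using k by simp
  have lim: "(\<lambda>t. monomial_value (A t) (\<kappa> t) M / of_nat t powi \<phi> M) \<longlonglongrightarrow>
      ?\<alpha> powi fst M * (\<Prod>i<k. \<rho> i ^ ?e M i)" if M: "M \<in> I" for M
  proof -
    have "(\<lambda>t. (A t / of_nat t powi int (B ^ k)) powi fst M *
        (\<Prod>i<k. (\<kappa> t i / of_nat t powi (int (\<sigma> i) - int (\<sigma> k))) ^ ?e M i)) \<longlonglongrightarrow>
      ?\<alpha> powi fst M * (\<Prod>i<k. \<rho> i ^ ?e M i)"
      by (intro tendsto_mult tendsto_power_int tendsto_prod tendsto_power lim_A lim_\<kappa> \<alpha>) auto
    moreover have "\<forall>\<^sub>F t in sequentially. (A t / of_nat t powi int (B ^ k)) powi fst M *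
        (\<Prod>i<k. (\<kappa> t i / of_nat t powi (int (\<sigma> i) - int (\<sigma> k))) ^ ?e M i) =
        monomial_value (A t) (\<kappa> t) M / of_nat t powi \<phi> M"
      using eventually_gt_at_top[of 0]
    proof eventually_elim
      case (elim t)
      have "of_nat t powi \<phi> M = (of_nat t powi int (B ^ k)) powi fst M *
          (\<Prod>i<k. (of_nat t powi (int (\<sigma> i) - int (\<sigma> k))) ^ ?e M i :: complex)"
      proof -
        have sum: "of_nat t powi sum g J = (\<Prod>i\<in>J. of_nat t powi g i :: complex)"
          if "finite J" for g and J :: "nat set"
          using that elim by (induction J) (auto simp: power_int_add)
        have "of_nat t powi \<phi> M = (of_nat t powi (int (B ^ k) * fst M) *
            (\<Prod>i<k. of_nat t powi ((int (\<sigma> i) - int (\<sigma> k)) * int (?e M i))) :: complex)"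
          unfolding \<phi>_eq using elim by (subst power_int_add, simp, subst sum) auto
        then show ?thesis by (simp only: power_int_mult power_int_of_nat)
      qed
      then show ?case
        using keys[OF M]
        by (simp add: monomial_value_def prod_keys_superset[of "{..<k}"] power_int_divide_distrib
            power_divide prod_dividef)
    qed
    ultimately show ?thesis by (simp add: tendsto_cong)
  qed
  have "\<forall>\<^sub>F t in sequentially. (\<Sum>M\<in>I. of_int (Poly_Mapping.lookup G M) * monomial_value (A t) (\<kappa> t) M) \<noteq> 0"
    by (rule eventually_sum_nonzero[OF fin_I ne_I inj _ _ lim])
      (use \<alpha> \<rho> in \<open>auto simp: I_def in_keys_iff\<close>)
  then have "\<forall>\<^sub>F t in sequentially. evaluate (A t) (\<kappa> t) G \<noteq> 0 \<and> t \<ge> 1"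
    using eventually_ge_at_top[of 1] by eventually_elim (simp add: evaluate_def I_def)
  then obtain t where t: "evaluate (A t) (\<kappa> t) G \<noteq> 0" "t \<ge> 1"
    using eventually_happens'[OF sequentially_bot] by blast
  show thesis
  proof (rule that[OF bracket[OF t(2)] _ _ t(1)])
    show "card (X t) > 0" using N_ge[OF t(2)] by (simp add: N_def)
    show "\<kappa> t a = of_nat (card (colours.fixed_colours (X t) shift_colour (2 * int a))) / of_nat (card (X t))" if "a > 0" for a
      using that by (simp add: \<kappa>_def s_def N_def)
  qed
qed


section \<open>The virtual crossing number\<close>

text \<open>The difference of the two sides has no nonzero evaluation.\<close>

lemma arrow_polynomial_diagram_move:
  assumes "diagram_move D D'"
  shows "\<exists>m e. (e = 1 \<or> e = - 1) \<and>
    arrow_polynomial D = Poly_Mapping.single (m, 0) e * arrow_polynomial D'"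
proof -
  obtain m e :: int where e: "e = 1 \<or> e = - 1"
    and eq: "\<And>(X :: (nat \<times> nat \<times> int) set) U A. bracket_colours X U A \<Longrightarrow>
       bracket_colours.amplitude X U A D (\<lambda>_. 1) [] =
       of_int e * A powi m * bracket_colours.amplitude X U A D' (\<lambda>_. 1) []"
    using diagram_move_amplitude[OF assms] by blast
  define G where "G = arrow_polynomial D - Poly_Mapping.single (m, 0) e * arrow_polynomial D'"
  have "G = 0"
  proof (rule ccontr)
    assume "G \<noteq> 0"
    then obtain X A \<kappa> where X: "bracket_colours (X :: (nat \<times> nat \<times> int) set) shift_colour A" "card X > 0"
      and \<kappa>: "\<And>a. a > 0 \<Longrightarrow> \<kappa> a = of_nat (card (colours.fixed_colours X shift_colour (2 * int a))) / of_nat (card X)"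
      and G: "evaluate A \<kappa> G \<noteq> 0"
      by (rule evaluation_separates) blast
    interpret X: bracket_colours X shift_colour A by (rule X(1))
    have "virtual_link_diagram D" "virtual_link_diagram D'"
      using assms by (auto elim: diagram_move.cases)
    then interpret D: bracket_diagram D X shift_colour A + D': bracket_diagram D' X shift_colour A
      by unfold_locales
    have "of_nat (card X) * evaluate A \<kappa> (arrow_polynomial D) =
        of_int e * A powi m * (of_nat (card X) * evaluate A \<kappa> (arrow_polynomial D'))"
      using eq[OF X(1)] D.amplitude_eq_evaluate[OF X(2) \<kappa>] D'.amplitude_eq_evaluate[OF X(2) \<kappa>] by simp
    then have "evaluate A \<kappa> (arrow_polynomial D) = of_int e * A powi m * evaluate A \<kappa> (arrow_polynomial D')"
      using X(2) by (auto simp: mult.left_commute)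
    then have "evaluate A \<kappa> G = 0"
      using X.A_nonzero
      by (simp add: G_def evaluate_diff evaluate_mult evaluate_single monomial_value_def)
    with G show False by simp
  qed
  then show ?thesis using e by (auto simp: G_def)
qed

lemma k_degrees_virtually_equivalent:
  assumes "virtually_equivalent D D'"
  shows "k_degree ` Poly_Mapping.keys (arrow_polynomial D) = k_degree ` Poly_Mapping.keys (arrow_polynomial D')"
  using assms unfolding virtually_equivalent_def
proof (induction rule: equivclp_induct)
  case (step y z)
  then show ?case using arrow_polynomial_diagram_move k_degrees_single_mult by metis
qed simp

text \<open>A primitive sixth root of unity has loop value \<open>1\<close>, so one colour suffices, and the two coefficients
  at a classical crossing add up to \<open>1\<close>; hence all transfer operators preserve the function \<open>1\<close>.\<close>

lemma arrow_polynomial_nonzero: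
  assumes "virtual_link_diagram D"
  shows "arrow_polynomial D \<noteq> 0"
proof -
  define A where "A = Complex (1 / 2) (sqrt 3 / 2)"
  have A2: "A * A = A - 1" by (simp add: A_def complex_eq_iff)
  have A: "A \<noteq> 0" by (simp add: A_def complex_eq_iff)
  have inv: "inverse A = 1 - A"
    using A2 A by (intro inverse_unique) (simp add: algebra_simps)
  have sum: "A + inverse A = 1" by (simp add: inv)
  have "- (A ^ 2) - inverse A ^ 2 = 1"
    by (simp add: inv power2_eq_square algebra_simps A2)
  then have bc: "bracket_colours {0 :: nat} (\<lambda>_ x. x) A"
    by unfold_locales (use A in auto)
  interpret bracket_colours "{0 :: nat}" "\<lambda>_ x. x" A by (rule bc)
  interpret bracket_diagram D "{0 :: nat}" "\<lambda>_ x. x" A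
    using assms by unfold_locales
  have one: "tile_op t (\<lambda>_. s) xs = s" if "xs \<in> colour_lists (length (tile_dom t))" for t s xs
  proof (cases t)
    case (Cross k a b)
    have "kauffman_weights k = (A, inverse A) \<or> kauffman_weights k = (inverse A, A)" by (simp add: kauffman_weights_def)
    then have "vertical_weight k * s + horizontal_weight k * s = (A + inverse A) * s"
      by (auto simp: algebra_simps)
    with Cross that sum show ?thesis
      by (cases "k = Virtual") (auto simp: colour_lists_2 tile_ops)
  qed (use that in \<open>auto simp: colour_lists_0 colour_lists_2 tile_ops\<close>)
  have "amplitude E (\<lambda>_. 1) xs = 1" if "composable us E vs" "xs \<in> colour_lists (length us)" for us E vs xs
    using that
  proof (induction E arbitrary: us xs)
    case (Cons L E)
    then have xs: "xs \<in> colour_lists (length (bottom L))" by simp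
    have "amplitude E (\<lambda>_. 1) zs = 1" if "zs \<in> colour_lists (length (top L))" for zs
      using Cons that by auto
    then have "amplitude (L # E) (\<lambda>_. 1) xs = layer_op L (\<lambda>_. 1) xs"
      using xs by (simp add: layer_op_eq_sum del: layer_op.simps)
    also have "\<dots> = 1"
    proof -
      obtain l t r where L: "L = (l, t, r)" by (cases L)
      let ?xm = "take (length (tile_dom t)) (drop (length l) xs)"
      have "?xm \<in> colour_lists (length (tile_dom t))" using xs by (auto simp: L colour_lists_def dest!: in_set_takeD in_set_dropD)
      then show ?thesis using one by (simp add: L)
    qed
    finally show ?case .
  qed simp
  from this[of "[]" D "[]" "[]"] have "amplitude D (\<lambda>_. 1) [] = 1"
    using assms by (simp add: virtual_link_diagram_def colour_lists_0)
  moreover have "amplitude D (\<lambda>_. 1) [] = evaluate A (\<lambda>a. of_nat (card (fixed_colours (2 * int a)))) (arrow_polynomial D)"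
    by (subst amplitude_eq_evaluate) auto
  ultimately show ?thesis by auto
qed

theorem theorem2p3:
  fixes K :: diagram
  assumes "virtual_link_diagram K"
  shows "virtual_crossing_number K \<ge> max_k_degree (arrow_polynomial K)"
proof -
  have "virtually_equivalent K K" by (simp add: virtually_equivalent_def)
  then have "\<exists>v D. virtual_link_diagram D \<and> virtually_equivalent K D \<and> num_virtual D = v"
    using assms by blast
  from LeastI_ex[OF this] obtain D where D: "virtual_link_diagram D" "virtually_equivalent K D"
    "num_virtual D = virtual_crossing_number K"
    unfolding virtual_crossing_number_def by blast
  let ?k = "k_degree ` Poly_Mapping.keys (arrow_polynomial D)"
  have "max_k_degree (arrow_polynomial K) = Max ?k"
    unfolding max_k_degree_def k_degrees_virtually_equivalent[OF D(2)] ..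
  also have "\<dots> \<le> num_virtual D"
  proof (rule Max.boundedI)
    show "?k \<noteq> {}" using arrow_polynomial_nonzero[OF D(1)] by simp
    show "n \<le> num_virtual D" if "n \<in> ?k" for n
      using that link_diagram.degree_arrow_polynomial[OF link_diagram.intro[OF D(1)]]
      by (auto simp: degree_le_def)
  qed simp
  finally show ?thesis using D(3) by simp
qed

end
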